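(* Let $\mathcal{Q}$ be a small quantaloid and let $\mathcal{C}$ be a saturated class of presheaves on $\mathcal{Q}$-categories. For a $\mathcal{Q}$-category $\mathbb{A}$ let $J_{\mathbb{A}}:\mathcal{C}(\mathbb{A})\to\mathcal{P}(\mathbb{A})$ be the inclusion of the full subcategory of $\mathcal{P}(\mathbb{A})$ on those presheaves on $\mathbb{A}$ that are elements of $\mathcal{C}$. Then the 2-functor $$\mathcal{C}:\mathrm{Cat}(\mathcal{Q})\to\mathrm{Cat}(\mathcal{Q}):\big(F:\mathbb{A}\to\mathbb{B}\big)\mapsto\big(\mathbb{B}(-,F-)\otimes-:\mathcal{C}(\mathbb{A})\to\mathcal{C}(\mathbb{B})\big)$$ together with the transformation $J:\mathcal{C}\Rightarrow\mathcal{P}$ forms a full sub-KZ-doctrine of $\mathcal{P}$. Moreover, the $\mathcal{C}$-cocomplete $\mathcal{Q}$-categories are precisely the algebras of this KZ-doctrine, and the $\mathcal{C}$-cocontinuous functors between $\mathcal{C}$-cocomplete $\mathcal{Q}$-categories are precisely the algebra homomorphisms.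
   Context: A quantaloid is a category whose hom-sets are complete lattices and whose composition preserves arbitrary suprema in each variable. $\mathcal{Q}$ is a small quantaloid, with set of objects $\mathcal{Q}_0$. A $\mathcal{Q}$-category $\mathbb{A}$ is a set $\mathbb{A}_0$ with a type function $t:\mathbb{A}_0\to\mathcal{Q}_0$ and $\mathcal{Q}$-arrows $\mathbb{A}(a',a):ta\to ta'$ with $1_{ta}\le\mathbb{A}(a,a)$ and $\mathbb{A}(a'',a')\circ\mathbb{A}(a',a)\le\mathbb{A}(a'',a)$. A functor $F:\mathbb{A}\to\mathbb{B}$ is a type-preserving map with $\mathbb{A}(a',a)\le\mathbb{B}(Fa',Fa)$; it is fully faithful if equality always holds. A distributor $\Phi$ from $\mathbb{A}$ to $\mathbb{B}$ is a matrix of arrows $\Phi(b,a):ta\to tb$ with $\Phi(b,a')\circ\mathbb{A}(a',a)\le\Phi(b,a)$ and $\mathbb{B}(b,b')\circ\Phi(b',a)\le\Phi(b,a)$. Composition is $(\Psi\otimes\Phi)(c,a)=\bigvee_b\Psi(c,b)\circ\Phi(b,a)$, the identity on $\mathbb{A}$ is the hom-matrix of $\mathbb{A}$, and distributors are ordered elementwise; this gives a (large) quantaloid $\mathrm{Dist}(\mathcal{Q})$. For $\Phi:\mathbb{A}\to\mathbb{C}$ and $\Psi:\mathbb{B}\to\mathbb{C}$ in $\mathrm{Dist}(\mathcal{Q})$, the lifting $[\Psi,\Phi]:\mathbb{A}\to\mathbb{B}$ is the largest distributor with $\Psi\otimes[\Psi,\Phi]\le\Phi$. A functor $F:\mathbb{A}\to\mathbb{B}$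 gives a distributor $\mathbb{B}(-,F-):\mathbb{A}\to\mathbb{B}$ with right adjoint $\mathbb{B}(F-,-)$. Parallel functors are preordered by $F\le G$ iff $\mathbb{B}(-,F-)\le\mathbb{B}(-,G-)$, and $F\cong G$ means $F\le G\le F$; this makes $\mathrm{Cat}(\mathcal{Q})$ a locally (pre)ordered 2-category. Since local orders are only preorders, equations between functors (naturality, factorisations, monad and algebra laws) are understood up to $\cong$. $*_X$ is the one-object $\mathcal{Q}$-category with object of type $X$ and hom-arrow $1_X$. A presheaf on $\mathbb{A}$ is a distributor $\phi:*_X\to\mathbb{A}$, $X\in\mathcal{Q}_0$. Presheaves on $\mathbb{A}$ are the objects of the $\mathcal{Q}$-category $\mathcal{P}(\mathbb{A})$, with $t\phi=X$ and $\mathcal{P}(\mathbb{A})(\psi,\phi)=$ the single element of $[\psi,\phi]$. The Yoneda embedding is $Y_{\mathbb{A}}:\mathbb{A}\to\mathcal{P}(\mathbb{A}):a\mapsto\mathbb{A}(-,a)$ (the representable presheaves). $\mathcal{P}$ is a 2-functor on $\mathrm{Cat}(\mathcal{Q})$ via $\mathcal{P}(F)(\phi)=\mathbb{B}(-,F-)\otimes\phi$. The colimit of $F:\mathbb{A}\to\mathbb{B}$ weighted by a presheaf $\phi:*_X\to\mathbb{A}$ is an object $\mathrm{colim}(\phi,F)$ of $\mathbb{B}$ of type $X$ with $\mathbb{B}(\mathrm{colim}(\phi,F),-)=[\phi,\mathbb{B}(F-,-)]$. $G:\mathbb{B}\to\mathbb{B}'$ preserves it if $G(\mathrm{colim}(\phi,F))$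 is the $\phi$-weighted colimit of $G\circ F$. In $\mathcal{P}(\mathbb{B})$ all such colimits exist: for $G:\mathbb{A}\to\mathcal{P}(\mathbb{B})$, $\mathrm{colim}(\phi,G)(b)=\bigvee_{a}G(a)(b)\circ\phi(a)$. $\mathcal{P}$ is a 2-monad with unit $Y$ and multiplication $M_{\mathbb{A}}:\mathcal{P}(\mathcal{P}(\mathbb{A}))\to\mathcal{P}(\mathbb{A}):\Theta\mapsto\mathrm{colim}(\Theta,1_{\mathcal{P}(\mathbb{A})})$. For a class $\mathcal{C}$ of presheaves, a $\mathcal{Q}$-category is $\mathcal{C}$-cocomplete if it has all colimits weighted by elements of $\mathcal{C}$; a functor is $\mathcal{C}$-cocontinuous if it preserves all colimits weighted by elements of $\mathcal{C}$. $\mathcal{C}$ is saturated if (1) it contains all representable presheaves and (2) for each $\phi:*_X\to\mathbb{A}$ in $\mathcal{C}$ and each functor $G:\mathbb{A}\to\mathcal{P}(\mathbb{B})$ with every $G(a)$ in $\mathcal{C}$, $\mathrm{colim}(\phi,G)$ is in $\mathcal{C}$. A KZ-doctrine on a locally ordered 2-category $\mathcal{K}$ is a 2-monad $(\mathcal{T},\mu,\eta)$ on $\mathcal{K}$ with $\mathcal{T}(\eta_K)\le\eta_{\mathcal{T}(K)}$ for all objects $K$. $\mathcal{P}$ is a KZ-doctrine. A full sub-KZ-doctrine of $\mathcal{P}$ is a pair $(\mathcal{T},\varepsilon)$ of a 2-functor $\mathcal{T}$ on $\mathrm{Cat}(\mathcal{Q})$ and a 2-natural transformation $\varepsilon:\mathcal{T}\Rightarrow\mathcal{P}$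 with all components fully faithful, such that there are (essentially unique) factorisations $M\circ(\varepsilon*\varepsilon)=\varepsilon\circ\mu$ and $Y=\varepsilon\circ\eta$, where $(\varepsilon*\varepsilon)_{\mathbb{A}}=\mathcal{P}(\varepsilon_{\mathbb{A}})\circ\varepsilon_{\mathcal{T}(\mathbb{A})}$; then $(\mathcal{T},\mu,\eta)$ is a KZ-doctrine. A $\mathcal{T}$-algebra is a $\mathcal{Q}$-category $\mathbb{B}$ with a functor $L:\mathcal{T}(\mathbb{B})\to\mathbb{B}$ satisfying $L\circ\eta_{\mathbb{B}}\cong1$ and $L\circ\mu_{\mathbb{B}}\cong L\circ\mathcal{T}(L)$; for a KZ-doctrine such $L$ is left adjoint to $\eta_{\mathbb{B}}$, so it is essentially unique and being an algebra is a property. A homomorphism $G:(\mathbb{B},L)\to(\mathbb{B}',L')$ is a functor with $G\circ L\cong L'\circ\mathcal{T}(G)$. *)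

theory Defs
  imports "HOL-Algebra.Complete_Lattice" "HOL-Library.Nat_Bijection"
begin

section \<open>Sets\<close>

text \<open>
  A class of presheaves ranges over all \<open>\<Q>\<close>-categories at once, including those of the form
  \<open>\<P>(\<P>(\<A>))\<close>, so the objects of all \<open>\<Q>\<close>-categories have to live in one type. That type
  is a universe of sets: \<open>elts u\<close> is the collection of elements of the set \<open>u\<close>, and a
  collection \<open>S\<close> of individuals is a set (as opposed to a proper class) if \<open>S \<in> range elts\<close>.
  The axioms are those of Zermelo-Fraenkel set theory (with choice, inherited from HOL) that are
  needed; every model of ZFC is an instance. Infinity and foundation are not needed and not imposed.
\<close>

class set_universe =
  fixes elts :: "'a \<Rightarrow> 'a set"
  assumes elts_ext: "elts x = elts y \<Longrightarrow> x = y"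
    and elts_separation: "S \<subseteq> elts x \<Longrightarrow> S \<in> range elts"
    and elts_Union: "(\<Union>y\<in>elts x. elts y) \<in> range elts"
    and elts_Pow: "{y. elts y \<subseteq> elts x} \<in> range elts"
    and elts_replacement: "f ` elts x \<in> range elts"

text \<open>The axioms are consistent: the hereditarily finite sets, coded by natural numbers, satisfy them.\<close>

lemma hereditarily_finite_set_universe: "class.set_universe set_decode"
proof -
  have fin: "S \<in> range set_decode" if "finite S" for S
    using set_encode_inverse[OF that] by (metis rangeI)
  show ?thesis
  proof
    show "x = y" if "set_decode x = set_decode y" for x y
      using that by (metis set_decode_inverse)
    show "S \<in> range set_decode" if "S \<subseteq> set_decode x" for S x
      using that by (intro fin) (auto intro: finite_subset)
    show "(\<Union>y\<in>set_decode x. set_decode y) \<in> range set_decode" for x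
      by (intro fin) simp
    show "{y. set_decode y \<subseteq> set_decode x} \<in> range set_decode" for x
      by (intro fin finite_subset[OF _ finite_atMost[of x]]) (auto intro: subset_decode_imp_le)
    show "f ` set_decode x \<in> range set_decode" for f x
      by (intro fin) simp
  qed
qed

definition small :: "'v::set_universe itself \<Rightarrow> 'b set \<Rightarrow> bool"
  where "small T S \<longleftrightarrow> (\<exists>(f :: 'b \<Rightarrow> 'v) u. bij_betw f S (elts u))"

text \<open>A bijection between a small collection of arbitrary type and a set of the universe.\<close>

definition code :: "'b set \<Rightarrow> 'b \<Rightarrow> 'v::set_universe"
  where "code S = (SOME f. \<exists>u. bij_betw f S (elts u))"

section \<open>Quantaloids\<close>

record ('o, 'm) quantaloid_data =
  Ob :: "'o set"
  Arr :: "'m set"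
  Dom :: "'m \<Rightarrow> 'o"
  Cod :: "'m \<Rightarrow> 'o"
  Id :: "'o \<Rightarrow> 'm"
  comp :: "'m \<Rightarrow> 'm \<Rightarrow> 'm" (infixl \<open>\<cdot>\<index>\<close> 70)
  leq :: "'m \<Rightarrow> 'm \<Rightarrow> bool" (infix \<open>\<preceq>\<index>\<close> 50)

definition Hom :: "('o, 'm) quantaloid_data \<Rightarrow> 'o \<Rightarrow> 'o \<Rightarrow> 'm set"
  where "Hom Q X Y = {f \<in> Arr Q. Dom Q f = X \<and> Cod Q f = Y}"

definition Hom_lattice :: "('o, 'm) quantaloid_data \<Rightarrow> 'o \<Rightarrow> 'o \<Rightarrow> 'm gorder"
  where "Hom_lattice Q X Y = \<lparr>carrier = Hom Q X Y, eq = (=), le = leq Q\<rparr>"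

locale quantaloid =
  fixes Q :: "('o, 'm) quantaloid_data" (structure)
  assumes Dom_Cod: "f \<in> Arr Q \<Longrightarrow> Dom Q f \<in> Ob Q \<and> Cod Q f \<in> Ob Q"
    and Id_Hom: "X \<in> Ob Q \<Longrightarrow> Id Q X \<in> Hom Q X X"
    and comp_Hom: "\<lbrakk>f \<in> Hom Q X Y; g \<in> Hom Q Y Z\<rbrakk> \<Longrightarrow> g \<cdot> f \<in> Hom Q X Z"
    and comp_assoc: "\<lbrakk>f \<in> Hom Q W X; g \<in> Hom Q X Y; h \<in> Hom Q Y Z\<rbrakk> \<Longrightarrow> h \<cdot> g \<cdot> f = h \<cdot> (g \<cdot> f)"
    and comp_Id: "f \<in> Hom Q X Y \<Longrightarrow> f \<cdot> Id Q X = f"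
    and Id_comp: "f \<in> Hom Q X Y \<Longrightarrow> Id Q Y \<cdot> f = f"
    and Hom_complete: "\<lbrakk>X \<in> Ob Q; Y \<in> Ob Q\<rbrakk> \<Longrightarrow> complete_lattice (Hom_lattice Q X Y)"
    and comp_Sup: "\<lbrakk>X \<in> Ob Q; S \<subseteq> Hom Q X Y; g \<in> Hom Q Y Z\<rbrakk> \<Longrightarrow>
        g \<cdot> (\<Squnion>\<^bsub>Hom_lattice Q X Y\<^esub> S) = \<Squnion>\<^bsub>Hom_lattice Q X Z\<^esub> ((\<lambda>f. g \<cdot> f) ` S)"
    and Sup_comp: "\<lbrakk>Z \<in> Ob Q; S \<subseteq> Hom Q Y Z; f \<in> Hom Q X Y\<rbrakk> \<Longrightarrow>
        (\<Squnion>\<^bsub>Hom_lattice Q Y Z\<^esub> S) \<cdot> f = \<Squnion>\<^bsub>Hom_lattice Q X Z\<^esub> ((\<lambda>g. g \<cdot> f) ` S)"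

section \<open>Categories, functors and distributors enriched in a quantaloid\<close>

text \<open>
  Type functions, hom-matrices, functors and distributors are extensional functions on their
  domains, so that HOL equality is equality of the mathematical objects. Matrices are indexed
  covariant argument last, as in \<open>\<A>(a', a) : t a \<rightarrow> t a'\<close>.
\<close>

record ('v, 'o, 'm) qcat =
  objs :: "'v set"
  tp :: "'v \<Rightarrow> 'o"
  hom :: "'v \<times> 'v \<Rightarrow> 'm"

definition qcategory :: "('o, 'm) quantaloid_data \<Rightarrow> ('v::set_universe, 'o, 'm) qcat \<Rightarrow> bool"
  where "qcategory Q A \<longleftrightarrow>
    objs A \<in> range elts \<and>
    tp A \<in> objs A \<rightarrow>\<^sub>E Ob Q \<and>
    hom A \<in> extensional (objs A \<times> objs A) \<and>
    (\<forall>a'\<in>objs A. \<forall>a\<in>objs A. hom A (a', a) \<in> Hom Q (tp A a) (tp A a')) \<and>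
    (\<forall>a\<in>objs A. Id Q (tp A a) \<preceq>\<^bsub>Q\<^esub> hom A (a, a)) \<and>
    (\<forall>a''\<in>objs A. \<forall>a'\<in>objs A. \<forall>a\<in>objs A. hom A (a'', a') \<cdot>\<^bsub>Q\<^esub> hom A (a', a) \<preceq>\<^bsub>Q\<^esub> hom A (a'', a))"

definition functors :: "('o, 'm) quantaloid_data \<Rightarrow> ('v, 'o, 'm) qcat \<Rightarrow> ('v, 'o, 'm) qcat \<Rightarrow> ('v \<Rightarrow> 'v) set"
  where "functors Q A B = {F \<in> objs A \<rightarrow>\<^sub>E objs B.
    (\<forall>a\<in>objs A. tp B (F a) = tp A a) \<and>
    (\<forall>a'\<in>objs A. \<forall>a\<in>objs A. hom A (a', a) \<preceq>\<^bsub>Q\<^esub> hom B (F a', F a))}"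

definition id_functor :: "('v, 'o, 'm) qcat \<Rightarrow> 'v \<Rightarrow> 'v"
  where "id_functor A = (\<lambda>a\<in>objs A. a)"

definition fully_faithful :: "('v, 'o, 'm) qcat \<Rightarrow> ('v, 'o, 'm) qcat \<Rightarrow> ('v \<Rightarrow> 'v) \<Rightarrow> bool"
  where "fully_faithful A B F \<longleftrightarrow> (\<forall>a'\<in>objs A. \<forall>a\<in>objs A. hom A (a', a) = hom B (F a', F a))"

text \<open>The distributors from \<open>A\<close> to \<open>B\<close>.\<close>

definition distributors ::
    "('o, 'm) quantaloid_data \<Rightarrow> ('v, 'o, 'm) qcat \<Rightarrow> ('v, 'o, 'm) qcat \<Rightarrow> ('v \<times> 'v \<Rightarrow> 'm) set"
  where "distributors Q A B = {\<Phi> \<in> extensional (objs B \<times> objs A).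
    (\<forall>b\<in>objs B. \<forall>a\<in>objs A. \<Phi> (b, a) \<in> Hom Q (tp A a) (tp B b)) \<and>
    (\<forall>b\<in>objs B. \<forall>a'\<in>objs A. \<forall>a\<in>objs A. \<Phi> (b, a') \<cdot>\<^bsub>Q\<^esub> hom A (a', a) \<preceq>\<^bsub>Q\<^esub> \<Phi> (b, a)) \<and>
    (\<forall>b\<in>objs B. \<forall>b'\<in>objs B. \<forall>a\<in>objs A. hom B (b, b') \<cdot>\<^bsub>Q\<^esub> \<Phi> (b', a) \<preceq>\<^bsub>Q\<^esub> \<Phi> (b, a))}"

definition dist_le :: "('o, 'm) quantaloid_data \<Rightarrow> ('v, 'o, 'm) qcat \<Rightarrow> ('v, 'o, 'm) qcat \<Rightarrow>
    ('v \<times> 'v \<Rightarrow> 'm) \<Rightarrow> ('v \<times> 'v \<Rightarrow> 'm) \<Rightarrow> bool"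
  where "dist_le Q A B \<Phi> \<Psi> \<longleftrightarrow> (\<forall>b\<in>objs B. \<forall>a\<in>objs A. \<Phi> (b, a) \<preceq>\<^bsub>Q\<^esub> \<Psi> (b, a))"

text \<open>\<open>dist_comp Q A B C \<Psi> \<Phi>\<close> is \<open>\<Psi> \<otimes> \<Phi>\<close> for \<open>\<Phi> : A \<rightarrow> B\<close> and \<open>\<Psi> : B \<rightarrow> C\<close>.\<close>

definition dist_comp :: "('o, 'm) quantaloid_data \<Rightarrow>
    ('v, 'o, 'm) qcat \<Rightarrow> ('v, 'o, 'm) qcat \<Rightarrow> ('v, 'o, 'm) qcat \<Rightarrow>
    ('v \<times> 'v \<Rightarrow> 'm) \<Rightarrow> ('v \<times> 'v \<Rightarrow> 'm) \<Rightarrow> 'v \<times> 'v \<Rightarrow> 'm"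
  where "dist_comp Q A B C \<Psi> \<Phi> = (\<lambda>(c, a)\<in>objs C \<times> objs A.
    \<Squnion>\<^bsub>Hom_lattice Q (tp A a) (tp C c)\<^esub> ((\<lambda>b. \<Psi> (c, b) \<cdot>\<^bsub>Q\<^esub> \<Phi> (b, a)) ` objs B))"

text \<open>\<open>lifting Q A B C \<Psi> \<Phi>\<close> is \<open>[\<Psi>, \<Phi>] : A \<rightarrow> B\<close> for \<open>\<Phi> : A \<rightarrow> C\<close> and \<open>\<Psi> : B \<rightarrow> C\<close>.\<close>

definition lifting :: "('o, 'm) quantaloid_data \<Rightarrow>
    ('v, 'o, 'm) qcat \<Rightarrow> ('v, 'o, 'm) qcat \<Rightarrow> ('v, 'o, 'm) qcat \<Rightarrow>
    ('v \<times> 'v \<Rightarrow> 'm) \<Rightarrow> ('v \<times> 'v \<Rightarrow> 'm) \<Rightarrow> 'v \<times> 'v \<Rightarrow> 'm"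
  where "lifting Q A B C \<Psi> \<Phi> = (THE \<Theta>.
    \<Theta> \<in> distributors Q A B \<and> dist_le Q A C (dist_comp Q A B C \<Psi> \<Theta>) \<Phi> \<and>
    (\<forall>\<Theta>'\<in>distributors Q A B. dist_le Q A C (dist_comp Q A B C \<Psi> \<Theta>') \<Phi> \<longrightarrow> dist_le Q A B \<Theta>' \<Theta>))"

text \<open>The distributors \<open>B(-,F-) : A \<rightarrow> B\<close> and \<open>B(F-,-) : B \<rightarrow> A\<close> induced by a functor \<open>F : A \<rightarrow> B\<close>.\<close>

definition lower_star :: "('v, 'o, 'm) qcat \<Rightarrow> ('v, 'o, 'm) qcat \<Rightarrow> ('v \<Rightarrow> 'v) \<Rightarrow> 'v \<times> 'v \<Rightarrow> 'm"
  where "lower_star A B F = (\<lambda>(b, a)\<in>objs B \<times> objs A. hom B (b, F a))"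

definition upper_star :: "('v, 'o, 'm) qcat \<Rightarrow> ('v, 'o, 'm) qcat \<Rightarrow> ('v \<Rightarrow> 'v) \<Rightarrow> 'v \<times> 'v \<Rightarrow> 'm"
  where "upper_star A B F = (\<lambda>(a, b)\<in>objs A \<times> objs B. hom B (F a, b))"

definition functor_le :: "('o, 'm) quantaloid_data \<Rightarrow> ('v, 'o, 'm) qcat \<Rightarrow> ('v, 'o, 'm) qcat \<Rightarrow>
    ('v \<Rightarrow> 'v) \<Rightarrow> ('v \<Rightarrow> 'v) \<Rightarrow> bool"
  where "functor_le Q A B F G \<longleftrightarrow> dist_le Q A B (lower_star A B F) (lower_star A B G)"

definition functor_iso :: "('o, 'm) quantaloid_data \<Rightarrow> ('v, 'o, 'm) qcat \<Rightarrow> ('v, 'o, 'm) qcat \<Rightarrow>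
    ('v \<Rightarrow> 'v) \<Rightarrow> ('v \<Rightarrow> 'v) \<Rightarrow> bool"
  where "functor_iso Q A B F G \<longleftrightarrow> functor_le Q A B F G \<and> functor_le Q A B G F"

section \<open>Presheaves\<close>

definition pt :: "'v::set_universe"
  where "pt = (THE u. elts u = {})"

text \<open>The category \<open>*\<^sub>X\<close>; its object is named by the empty set.\<close>

definition star :: "('o, 'm) quantaloid_data \<Rightarrow> 'o \<Rightarrow> ('v::set_universe, 'o, 'm) qcat"
  where "star Q X = \<lparr>objs = {pt}, tp = (\<lambda>_\<in>{pt}. X), hom = (\<lambda>_\<in>{pt} \<times> {pt}. Id Q X)\<rparr>"

text \<open>
  A presheaf is recorded together with its type, which a matrix with no rows does not determine.
\<close>

type_synonym ('v, 'o, 'm) psh = "'o \<times> ('v \<times> 'v \<Rightarrow> 'm)"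

definition presheaves ::
    "('o, 'm) quantaloid_data \<Rightarrow> ('v::set_universe, 'o, 'm) qcat \<Rightarrow> ('v, 'o, 'm) psh set"
  where "presheaves Q A = {(X, \<phi>). X \<in> Ob Q \<and> \<phi> \<in> distributors Q (star Q X) A}"

definition representable ::
    "('v::set_universe, 'o, 'm) qcat \<Rightarrow> 'v \<Rightarrow> ('v, 'o, 'm) psh"
  where "representable A a = (tp A a, \<lambda>(a', _)\<in>objs A \<times> {pt}. hom A (a', a))"

text \<open>
  The objects of \<open>\<P>(A)\<close> are individuals of the universe standing for the presheaves on \<open>A\<close>:
  \<open>psh_obj\<close> turns presheaves into objects of \<open>\<P>(A)\<close>, \<open>obj_psh\<close> is its inverse.
\<close>

definition psh_obj ::
    "('o, 'm) quantaloid_data \<Rightarrow> ('v::set_universe, 'o, 'm) qcat \<Rightarrow> ('v, 'o, 'm) psh \<Rightarrow> 'v"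
  where "psh_obj Q A = code (presheaves Q A)"

definition obj_psh ::
    "('o, 'm) quantaloid_data \<Rightarrow> ('v::set_universe, 'o, 'm) qcat \<Rightarrow> 'v \<Rightarrow> ('v, 'o, 'm) psh"
  where "obj_psh Q A = the_inv_into (presheaves Q A) (psh_obj Q A)"

definition psh_hom :: "('o, 'm) quantaloid_data \<Rightarrow> ('v::set_universe, 'o, 'm) qcat \<Rightarrow>
    ('v, 'o, 'm) psh \<Rightarrow> ('v, 'o, 'm) psh \<Rightarrow> 'm"
  where "psh_hom Q A \<psi> \<phi> =
    lifting Q (star Q (fst \<phi>)) (star Q (fst \<psi>)) A (snd \<psi>) (snd \<phi>) (pt, pt)"

definition P_obj ::
    "('o, 'm) quantaloid_data \<Rightarrow> ('v::set_universe, 'o, 'm) qcat \<Rightarrow> ('v, 'o, 'm) qcat"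
  where "P_obj Q A = \<lparr>
    objs = psh_obj Q A ` presheaves Q A,
    tp = (\<lambda>\<phi>\<in>psh_obj Q A ` presheaves Q A. fst (obj_psh Q A \<phi>)),
    hom = (\<lambda>(\<psi>, \<phi>)\<in>psh_obj Q A ` presheaves Q A \<times> psh_obj Q A ` presheaves Q A.
      psh_hom Q A (obj_psh Q A \<psi>) (obj_psh Q A \<phi>))\<rparr>"

definition P_map :: "('o, 'm) quantaloid_data \<Rightarrow>
    ('v::set_universe, 'o, 'm) qcat \<Rightarrow> ('v, 'o, 'm) qcat \<Rightarrow> ('v \<Rightarrow> 'v) \<Rightarrow> 'v \<Rightarrow> 'v"
  where "P_map Q A B F = (\<lambda>\<phi>\<in>objs (P_obj Q A).
    let (X, \<Phi>) = obj_psh Q A \<phi>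
    in psh_obj Q B (X, dist_comp Q (star Q X) A B (lower_star A B F) \<Phi>))"

definition Yoneda :: "('o, 'm) quantaloid_data \<Rightarrow> ('v::set_universe, 'o, 'm) qcat \<Rightarrow> 'v \<Rightarrow> 'v"
  where "Yoneda Q A = (\<lambda>a\<in>objs A. psh_obj Q A (representable A a))"

section \<open>Weighted colimits\<close>

text \<open>\<open>c\<close> is a colimit of \<open>F : A \<rightarrow> B\<close> weighted by the presheaf \<open>\<phi>\<close> on \<open>A\<close>.\<close>

definition is_colim :: "('o, 'm) quantaloid_data \<Rightarrow>
    ('v::set_universe, 'o, 'm) qcat \<Rightarrow> ('v, 'o, 'm) qcat \<Rightarrow> ('v, 'o, 'm) psh \<Rightarrow> ('v \<Rightarrow> 'v) \<Rightarrow> 'v \<Rightarrow> bool"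
  where "is_colim Q A B \<phi> F c \<longleftrightarrow> c \<in> objs B \<and> tp B c = fst \<phi> \<and>
    (\<lambda>(_, b)\<in>{pt} \<times> objs B. hom B (c, b)) =
      lifting Q B (star Q (fst \<phi>)) A (snd \<phi>) (upper_star A B F)"

definition colim :: "('o, 'm) quantaloid_data \<Rightarrow>
    ('v::set_universe, 'o, 'm) qcat \<Rightarrow> ('v, 'o, 'm) qcat \<Rightarrow> ('v, 'o, 'm) psh \<Rightarrow> ('v \<Rightarrow> 'v) \<Rightarrow> 'v"
  where "colim Q A B \<phi> F = (SOME c. is_colim Q A B \<phi> F c)"

definition P_mult :: "('o, 'm) quantaloid_data \<Rightarrow> ('v::set_universe, 'o, 'm) qcat \<Rightarrow> 'v \<Rightarrow> 'v"
  where "P_mult Q A = (\<lambda>\<Theta>\<in>objs (P_obj Q (P_obj Q A)).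
    colim Q (P_obj Q A) (P_obj Q A) (obj_psh Q (P_obj Q A) \<Theta>) (id_functor (P_obj Q A)))"

definition preserves_colim :: "('o, 'm) quantaloid_data \<Rightarrow>
    ('v::set_universe, 'o, 'm) qcat \<Rightarrow> ('v, 'o, 'm) qcat \<Rightarrow> ('v, 'o, 'm) qcat \<Rightarrow>
    ('v, 'o, 'm) psh \<Rightarrow> ('v \<Rightarrow> 'v) \<Rightarrow> ('v \<Rightarrow> 'v) \<Rightarrow> bool"
  where "preserves_colim Q A B B' \<phi> F G \<longleftrightarrow>
    (\<forall>c. is_colim Q A B \<phi> F c \<longrightarrow> is_colim Q A B' \<phi> (compose (objs A) G F) (G c))"

section \<open>Classes of presheaves\<close>

text \<open>\<open>C A\<close> is the collection of those members of the class \<open>C\<close> that are presheaves on \<open>A\<close>.\<close>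

type_synonym ('v, 'o, 'm) psh_class = "('v, 'o, 'm) qcat \<Rightarrow> ('v, 'o, 'm) psh set"

definition presheaf_class ::
    "('o, 'm) quantaloid_data \<Rightarrow> ('v::set_universe, 'o, 'm) psh_class \<Rightarrow> bool"
  where "presheaf_class Q C \<longleftrightarrow> (\<forall>A. qcategory Q A \<longrightarrow> C A \<subseteq> presheaves Q A)"

definition cocomplete ::
    "('o, 'm) quantaloid_data \<Rightarrow> ('v::set_universe, 'o, 'm) psh_class \<Rightarrow> ('v, 'o, 'm) qcat \<Rightarrow> bool"
  where "cocomplete Q C B \<longleftrightarrow>
    (\<forall>A \<phi> F. qcategory Q A \<and> \<phi> \<in> C A \<and> F \<in> functors Q A B \<longrightarrow> (\<exists>c. is_colim Q A B \<phi> F c))"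

definition cocontinuous :: "('o, 'm) quantaloid_data \<Rightarrow> ('v::set_universe, 'o, 'm) psh_class \<Rightarrow>
    ('v, 'o, 'm) qcat \<Rightarrow> ('v, 'o, 'm) qcat \<Rightarrow> ('v \<Rightarrow> 'v) \<Rightarrow> bool"
  where "cocontinuous Q C B B' G \<longleftrightarrow>
    (\<forall>A \<phi> F. qcategory Q A \<and> \<phi> \<in> C A \<and> F \<in> functors Q A B \<longrightarrow> preserves_colim Q A B B' \<phi> F G)"

definition saturated ::
    "('o, 'm) quantaloid_data \<Rightarrow> ('v::set_universe, 'o, 'm) psh_class \<Rightarrow> bool"
  where "saturated Q C \<longleftrightarrow>
    (\<forall>A. qcategory Q A \<longrightarrow> (\<forall>a\<in>objs A. representable A a \<in> C A)) \<and>
    (\<forall>A B \<phi> G. qcategory Q A \<and> qcategory Q B \<and> \<phi> \<in> C A \<and> G \<in> functors Q A (P_obj Q B) \<and>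
        (\<forall>a\<in>objs A. obj_psh Q B (G a) \<in> C B) \<longrightarrow>
      obj_psh Q B (colim Q A (P_obj Q B) \<phi> G) \<in> C B)"

definition full_subcat :: "('v, 'o, 'm) qcat \<Rightarrow> 'v set \<Rightarrow> ('v, 'o, 'm) qcat"
  where "full_subcat A S =
    \<lparr>objs = S, tp = restrict (tp A) S, hom = restrict (hom A) (S \<times> S)\<rparr>"

definition C_obj :: "('o, 'm) quantaloid_data \<Rightarrow> ('v::set_universe, 'o, 'm) psh_class \<Rightarrow>
    ('v, 'o, 'm) qcat \<Rightarrow> ('v, 'o, 'm) qcat"
  where "C_obj Q C A = full_subcat (P_obj Q A) (psh_obj Q A ` C A)"

definition C_map :: "('o, 'm) quantaloid_data \<Rightarrow> ('v::set_universe, 'o, 'm) psh_class \<Rightarrow>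
    ('v, 'o, 'm) qcat \<Rightarrow> ('v, 'o, 'm) qcat \<Rightarrow> ('v \<Rightarrow> 'v) \<Rightarrow> 'v \<Rightarrow> 'v"
  where "C_map Q C A B F = restrict (P_map Q A B F) (objs (C_obj Q C A))"

definition J :: "('o, 'm) quantaloid_data \<Rightarrow> ('v::set_universe, 'o, 'm) psh_class \<Rightarrow>
    ('v, 'o, 'm) qcat \<Rightarrow> 'v \<Rightarrow> 'v"
  where "J Q C A = (\<lambda>\<phi>\<in>objs (C_obj Q C A). \<phi>)"

section \<open>Doctrines on the 2-category of categories\<close>

text \<open>
  A 2-functor on \<open>Cat(\<Q>)\<close> is given by its action on objects and its action on arrows (the
  latter taking the domain and codomain as arguments); as \<open>Cat(\<Q>)\<close> is locally ordered, its action
  on 2-cells is monotonicity, and 2-naturality is naturality. Functoriality is strict; the other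
  equations between functors hold up to \<open>\<cong>\<close>.
\<close>

type_synonym ('v, 'o, 'm) on_obj = "('v, 'o, 'm) qcat \<Rightarrow> ('v, 'o, 'm) qcat"
type_synonym ('v, 'o, 'm) on_arr = "('v, 'o, 'm) qcat \<Rightarrow> ('v, 'o, 'm) qcat \<Rightarrow> ('v \<Rightarrow> 'v) \<Rightarrow> 'v \<Rightarrow> 'v"
type_synonym ('v, 'o, 'm) trans = "('v, 'o, 'm) qcat \<Rightarrow> 'v \<Rightarrow> 'v"

definition two_functor :: "('o, 'm) quantaloid_data \<Rightarrow>
    ('v::set_universe, 'o, 'm) on_obj \<Rightarrow> ('v, 'o, 'm) on_arr \<Rightarrow> bool"
  where "two_functor Q T T' \<longleftrightarrow>
    (\<forall>A. qcategory Q A \<longrightarrow> qcategory Q (T A)) \<and>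
    (\<forall>A B F. qcategory Q A \<and> qcategory Q B \<and> F \<in> functors Q A B \<longrightarrow>
      T' A B F \<in> functors Q (T A) (T B)) \<and>
    (\<forall>A. qcategory Q A \<longrightarrow> T' A A (id_functor A) = id_functor (T A)) \<and>
    (\<forall>A B C F G. qcategory Q A \<and> qcategory Q B \<and> qcategory Q C \<and>
        F \<in> functors Q A B \<and> G \<in> functors Q B C \<longrightarrow>
      T' A C (compose (objs A) G F) = compose (objs (T A)) (T' B C G) (T' A B F)) \<and>
    (\<forall>A B F G. qcategory Q A \<and> qcategory Q B \<and> F \<in> functors Q A B \<and> G \<in> functors Q A B \<and>
        functor_le Q A B F G \<longrightarrow>
      functor_le Q (T A) (T B) (T' A B F) (T' A B G))"

definition two_natural :: "('o, 'm) quantaloid_data \<Rightarrow>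
    ('v::set_universe, 'o, 'm) on_obj \<Rightarrow> ('v, 'o, 'm) on_arr \<Rightarrow>
    ('v, 'o, 'm) on_obj \<Rightarrow> ('v, 'o, 'm) on_arr \<Rightarrow> ('v, 'o, 'm) trans \<Rightarrow> bool"
  where "two_natural Q S S' T T' \<alpha> \<longleftrightarrow>
    (\<forall>A. qcategory Q A \<longrightarrow> \<alpha> A \<in> functors Q (S A) (T A)) \<and>
    (\<forall>A B F. qcategory Q A \<and> qcategory Q B \<and> F \<in> functors Q A B \<longrightarrow>
      functor_iso Q (S A) (T B)
        (compose (objs (S A)) (\<alpha> B) (S' A B F)) (compose (objs (S A)) (T' A B F) (\<alpha> A)))"

definition two_monad :: "('o, 'm) quantaloid_data \<Rightarrow>
    ('v::set_universe, 'o, 'm) on_obj \<Rightarrow> ('v, 'o, 'm) on_arr \<Rightarrow>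
    ('v, 'o, 'm) trans \<Rightarrow> ('v, 'o, 'm) trans \<Rightarrow> bool"
  where "two_monad Q T T' \<mu> \<eta> \<longleftrightarrow>
    two_functor Q T T' \<and>
    two_natural Q (\<lambda>A. T (T A)) (\<lambda>A B F. T' (T A) (T B) (T' A B F)) T T' \<mu> \<and>
    two_natural Q (\<lambda>A. A) (\<lambda>A B F. F) T T' \<eta> \<and>
    (\<forall>A. qcategory Q A \<longrightarrow>
      functor_iso Q (T (T (T A))) (T A)
        (compose (objs (T (T (T A)))) (\<mu> A) (T' (T (T A)) (T A) (\<mu> A)))
        (compose (objs (T (T (T A)))) (\<mu> A) (\<mu> (T A))) \<and>
      functor_iso Q (T A) (T A) (compose (objs (T A)) (\<mu> A) (T' A (T A) (\<eta> A))) (id_functor (T A)) \<and>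
      functor_iso Q (T A) (T A) (compose (objs (T A)) (\<mu> A) (\<eta> (T A))) (id_functor (T A)))"

definition KZ_doctrine :: "('o, 'm) quantaloid_data \<Rightarrow>
    ('v::set_universe, 'o, 'm) on_obj \<Rightarrow> ('v, 'o, 'm) on_arr \<Rightarrow>
    ('v, 'o, 'm) trans \<Rightarrow> ('v, 'o, 'm) trans \<Rightarrow> bool"
  where "KZ_doctrine Q T T' \<mu> \<eta> \<longleftrightarrow>
    two_monad Q T T' \<mu> \<eta> \<and>
    (\<forall>A. qcategory Q A \<longrightarrow> functor_le Q (T A) (T (T A)) (T' A (T A) (\<eta> A)) (\<eta> (T A)))"

text \<open>The factorisations \<open>M \<circ> (\<epsilon>*\<epsilon>) \<cong> \<epsilon> \<circ> \<mu>\<close> and \<open>Y \<cong> \<epsilon> \<circ> \<eta>\<close>.\<close>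

definition factorisation :: "('o, 'm) quantaloid_data \<Rightarrow> ('v::set_universe, 'o, 'm) on_obj \<Rightarrow>
    ('v, 'o, 'm) trans \<Rightarrow> ('v, 'o, 'm) trans \<Rightarrow> ('v, 'o, 'm) trans \<Rightarrow> bool"
  where "factorisation Q T \<epsilon> \<mu> \<eta> \<longleftrightarrow> (\<forall>A. qcategory Q A \<longrightarrow>
    \<mu> A \<in> functors Q (T (T A)) (T A) \<and>
    \<eta> A \<in> functors Q A (T A) \<and>
    functor_iso Q (T (T A)) (P_obj Q A)
      (compose (objs (T (T A))) (P_mult Q A)
        (compose (objs (T (T A))) (P_map Q (T A) (P_obj Q A) (\<epsilon> A)) (\<epsilon> (T A))))
      (compose (objs (T (T A))) (\<epsilon> A) (\<mu> A)) \<and>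
    functor_iso Q A (P_obj Q A) (Yoneda Q A) (compose (objs A) (\<epsilon> A) (\<eta> A)))"

definition full_sub_KZ_doctrine :: "('o, 'm) quantaloid_data \<Rightarrow>
    ('v::set_universe, 'o, 'm) on_obj \<Rightarrow> ('v, 'o, 'm) on_arr \<Rightarrow> ('v, 'o, 'm) trans \<Rightarrow> bool"
  where "full_sub_KZ_doctrine Q T T' \<epsilon> \<longleftrightarrow>
    two_functor Q T T' \<and>
    two_natural Q T T' (P_obj Q) (P_map Q) \<epsilon> \<and>
    (\<forall>A. qcategory Q A \<longrightarrow> fully_faithful (T A) (P_obj Q A) (\<epsilon> A)) \<and>
    (\<exists>\<mu> \<eta>. factorisation Q T \<epsilon> \<mu> \<eta>)"

text \<open>\<open>L\<close> is an algebra structure on \<open>B\<close>.\<close>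

definition algebra :: "('o, 'm) quantaloid_data \<Rightarrow>
    ('v::set_universe, 'o, 'm) on_obj \<Rightarrow> ('v, 'o, 'm) on_arr \<Rightarrow>
    ('v, 'o, 'm) trans \<Rightarrow> ('v, 'o, 'm) trans \<Rightarrow> ('v, 'o, 'm) qcat \<Rightarrow> ('v \<Rightarrow> 'v) \<Rightarrow> bool"
  where "algebra Q T T' \<mu> \<eta> B L \<longleftrightarrow>
    L \<in> functors Q (T B) B \<and>
    functor_iso Q B B (compose (objs B) L (\<eta> B)) (id_functor B) \<and>
    functor_iso Q (T (T B)) B
      (compose (objs (T (T B))) L (\<mu> B)) (compose (objs (T (T B))) L (T' (T B) B L))"

definition algebra_hom :: "('o, 'm) quantaloid_data \<Rightarrow>
    ('v::set_universe, 'o, 'm) on_obj \<Rightarrow> ('v, 'o, 'm) on_arr \<Rightarrow>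
    ('v, 'o, 'm) qcat \<Rightarrow> ('v \<Rightarrow> 'v) \<Rightarrow> ('v, 'o, 'm) qcat \<Rightarrow> ('v \<Rightarrow> 'v) \<Rightarrow> ('v \<Rightarrow> 'v) \<Rightarrow> bool"
  where "algebra_hom Q T T' B L B' L' G \<longleftrightarrow>
    G \<in> functors Q B B' \<and>
    functor_iso Q (T B) B'
      (compose (objs (T B)) G L) (compose (objs (T B)) L' (T' B B' G))"

end

theory Submission
  imports Defs
begin

text \<open>
  For a presheaf \<open>\<phi>\<close> on \<open>A\<close> and a family \<open>r\<close> of arrows satisfying the action inequality of a
  presheaf, write \<open>[\<phi>, r]\<close> for the lifting (\<open>psh_res\<close>). A presheaf is determined by the values \<open>[\<phi>, r]\<close>, and
  all constructions of the presheaf monad are characterised by them: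
  \<open>[A(-,a), r] = r(a)\<close> (Yoneda), \<open>[B(-,F-) \<otimes> \<phi>, r] = [\<phi>, r \<circ> F]\<close>, and
  \<open>[colim(\<phi>, G), r] = [\<phi>, [G-, r]]\<close>. The monad laws follow by rewriting both sides with these rules,
  strictly, since isomorphic objects of \<open>\<P>(A)\<close> are equal. Saturation makes \<open>\<C>\<close> closed under
  the three constructions.

  A functor \<open>L : \<C>(B) \<rightarrow> B\<close> is an algebra iff \<open>B(L\<phi>, b) = [\<phi>, B(-,b)]\<close>, that is, iff \<open>L\<phi>\<close> is the
  \<open>\<phi>\<close>-weighted colimit of the identity. For \<open>B(L\<phi>, b) \<le> [\<phi>, B(-,b)]\<close> one uses
  \<open>\<phi>(b) = \<C>(B)(Yb, \<phi>) \<le> B(LYb, L\<phi>) = B(b, L\<phi>)\<close>. All other weighted colimits reduce to these by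
  \<open>colim(\<phi>, F) = colim(B(-,F-) \<otimes> \<phi>, 1)\<close>.
\<close>

section \<open>Small collections\<close>

text \<open>Presheaves on a category have to be objects of a category over the same universe, so the
  proof begins with set theory: a presheaf is coded by its type and the graph of its values, and
  these codes form a set because \<open>Q\<close> is small. The values [\<phi>, r] determine \<phi>
  because of one test: for \<psi> of the same type, 1 \<le> [\<phi>, \<psi>] says \<phi> \<le>
  \<psi> pointwise. As [\<phi>, \<psi>] is also the hom-arrow of \<P>(A), objects of \<P>(A) with
  the same arrows out of them coincide. Two consequences shape the rest: colimits in \<P>(A), which
  \<open>colim\<close> selects by choice, have only one candidate, given by a supremum formula; and
  the functors provided by a factorisation through \<open>J\<close> are forced, so the claim about
  all \<open>\<mu>\<close> and \<open>\<eta>\<close> reduces to the pair \<open>mult\<close> and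
  \<open>Yoneda Q\<close>. In an arbitrary B a colimit is fixed only up to isomorphism. There the
  values of L are compared through the arrows out of them, and cocontinuity, which speaks of every
  colimit, has to be transported from the colimit given by L.\<close>

lemma range_elts_empty: "{} \<in> range (elts :: 'v::set_universe \<Rightarrow> 'v set)"
  by (rule elts_separation[of _ undefined]) simp

lemma elts_pt: "elts (pt :: 'v::set_universe) = {}"
proof -
  obtain u :: 'v where u: "elts u = {}" using range_elts_empty by (auto simp: image_iff)
  show ?thesis
    unfolding pt_def
  proof (rule theI)
    show "elts u = {}" by (rule u)
    show "x = u" if "elts x = {}" for x using that u by (intro elts_ext) simp
  qed
qed

lemma range_elts_image: "S \<in> range elts \<Longrightarrow> (f :: 'v \<Rightarrow> 'v) ` S \<in> range (elts :: 'v::set_universe \<Rightarrow> 'v set)"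
  using elts_replacement[of f] by blast

lemma range_elts_subset: "S \<in> range elts \<Longrightarrow> R \<subseteq> S \<Longrightarrow> R \<in> range (elts :: 'v::set_universe \<Rightarrow> 'v set)"
  using elts_separation[of R] by blast

text \<open>The power set of the empty set is a singleton, and replacement along a constant map
  exchanges its element for \<open>x\<close>.\<close>

lemma range_elts_singleton: "{x} \<in> range (elts :: 'v::set_universe \<Rightarrow> 'v set)"
proof -
  have "{y :: 'v. elts y \<subseteq> elts pt} = {pt}"
  proof
    show "{y :: 'v. elts y \<subseteq> elts pt} \<subseteq> {pt}"
    proof
      fix y :: 'v assume "y \<in> {y. elts y \<subseteq> elts pt}"
      then have "elts y = elts pt" using elts_pt[where 'v = 'v] by auto
      then show "y \<in> {pt}" using elts_ext by blast
    qed
  qed simp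
  then have "{pt :: 'v} \<in> range elts" using elts_Pow[of "pt :: 'v"] by simp
  from range_elts_image[OF this, of "\<lambda>_. x"] show ?thesis by simp
qed

lemma smallI:
  fixes f :: "'b \<Rightarrow> 'v::set_universe" and T :: "'v itself"
  assumes "inj_on f S" "f ` S \<subseteq> R" "R \<in> range elts"
  shows "small T S"
proof -
  obtain u where "f ` S = elts u" using range_elts_subset[OF assms(3,2)] by (rule rangeE)
  then show ?thesis
    unfolding small_def bij_betw_def using assms(1) by (intro exI[of _ f] exI[of _ u]) simp
qed

lemma smallE:
  fixes T :: "'v::set_universe itself"
  assumes "small T S"
  obtains f :: "_ \<Rightarrow> 'v" and u where "inj_on f S" "f ` S = elts u"
  using assms by (auto simp: small_def bij_betw_def)

lemma small_elts: "S \<in> range elts \<Longrightarrow> small (T :: 'v::set_universe itself) (S :: 'v set)"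
  by (rule smallI[of id _ S]) simp_all

lemma small_inj_on:
  fixes T :: "'v::set_universe itself"
  assumes "small T S" "inj_on f R" "f ` R \<subseteq> S"
  shows "small T R"
proof -
  obtain g :: "_ \<Rightarrow> 'v" and u where g: "inj_on g S" "g ` S = elts u"
    by (rule smallE[OF assms(1)])
  show ?thesis
  proof (rule smallI)
    show "inj_on (g \<circ> f) R" by (rule comp_inj_on[OF assms(2) inj_on_subset[OF g(1) assms(3)]])
    show "(g \<circ> f) ` R \<subseteq> elts u" unfolding g(2)[symmetric] using assms(3) by auto
  qed simp
qed

lemma small_Pow:
  fixes T :: "'v::set_universe itself"
  assumes "small T S"
  shows "small T (Pow S)"
proof -
  obtain f :: "_ \<Rightarrow> 'v" and u where f: "inj_on f S" "f ` S = elts u"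
    by (rule smallE[OF assms])
  \<comment> \<open>Separation makes each image a set, so \<open>inv elts\<close> yields the
    individual that has exactly these elements.\<close>
  define g where "g R = inv elts (f ` R)" for R
  have g: "elts (g R) = f ` R" if "R \<in> Pow S" for R
    unfolding g_def
    by (intro f_inv_into_f elts_separation[of _ u]) (use that in \<open>auto simp flip: f(2)\<close>)
  show ?thesis
  proof (rule smallI)
    show "inj_on g (Pow S)"
    proof (rule inj_onI)
      fix R R' assume R: "R \<in> Pow S" "R' \<in> Pow S" "g R = g R'"
      then have "f ` R = f ` R'" using g[of R] g[of R'] by simp
      then show "R = R'" using R f(1) by (simp add: inj_on_image_eq_iff)
    qed
    show "g ` Pow S \<subseteq> {y. elts y \<subseteq> elts u}"
    proof (intro image_subsetI CollectI)
      fix R assume R: "R \<in> Pow S"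
      then show "elts (g R) \<subseteq> elts u" unfolding g[OF R] f(2)[symmetric] by (intro image_mono) simp
    qed
  qed (rule elts_Pow)
qed

text \<open>Pairing is not among the axioms. A two-element set is found inside the power set of
  \<open>{pt}\<close>; replacement turns it into the pair of the two given sets, to which the union
  axiom applies.\<close>

lemma range_elts_Un:
  assumes "S \<in> range elts" "R \<in> range elts"
  shows "S \<union> R \<in> range (elts :: 'v::set_universe \<Rightarrow> 'v set)"
proof -
  obtain s where s: "S = elts s" using assms(1) by (rule rangeE)
  obtain r where r: "R = elts r" using assms(2) by (rule rangeE)
  obtain v :: 'v where v: "{pt} = elts v" using range_elts_singleton[of pt] by (rule rangeE)
  have ne: "v \<noteq> pt" using v elts_pt[where 'v = 'v] by auto
  have "{pt, v} \<in> range elts"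
    by (rule range_elts_subset[OF elts_Pow[of v]]) (simp add: elts_pt)
  then have "(\<lambda>x. if x = v then s else r) ` {pt, v} \<in> range elts" by (rule range_elts_image)
  then obtain w where "(\<lambda>x. if x = v then s else r) ` {pt, v} = elts w" by (rule rangeE)
  then have "elts w = {r, s}" using ne by simp
  then show ?thesis using elts_Union[of w] by (simp add: s r Un_commute)
qed

text \<open>Kuratowski pairs embed the product into an iterated power collection. They may stay sets
  of sets of individuals, since \<open>small\<close> accepts collections of any type.\<close>

lemma small_Times:
  fixes T :: "'v::set_universe itself"
  assumes "small T S" "small T R"
  shows "small T (S \<times> R)"
proof -
  obtain f :: "_ \<Rightarrow> 'v" and u where f: "inj_on f S" "f ` S = elts u"
    by (rule smallE[OF assms(1)])
  obtain g :: "_ \<Rightarrow> 'v" and w where g: "inj_on g R" "g ` R = elts w"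
    by (rule smallE[OF assms(2)])
  show ?thesis
  proof (rule small_inj_on)
    show "small T (Pow (Pow (elts u \<union> elts w)))"
      by (intro small_Pow small_elts[OF range_elts_Un]) simp_all
    show "inj_on (\<lambda>(a, b). {{f a}, {f a, g b}}) (S \<times> R)"
    proof (rule inj_onI, clarify)
      fix a b a' b' assume o: "a \<in> S" "b \<in> R" "a' \<in> S" "b' \<in> R"
        and "{{f a}, {f a, g b}} = {{f a'}, {f a', g b'}}"
      then have "f a = f a'" "g b = g b'" by (simp_all add: doubleton_eq_iff) metis+
      then show "a = a' \<and> b = b'" using o inj_onD[OF f(1)] inj_onD[OF g(1)] by simp
    qed
    show "(\<lambda>(a, b). {{f a}, {f a, g b}}) ` (S \<times> R) \<subseteq> Pow (Pow (elts u \<union> elts w))"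
      by (auto simp flip: f(2) g(2))
  qed
qed

lemma code:
  assumes "small TYPE('v::set_universe) S"
  shows "inj_on (code S :: _ \<Rightarrow> 'v) S" "(code S :: _ \<Rightarrow> 'v) ` S \<in> range elts"
proof -
  have "\<exists>u. bij_betw (code S :: _ \<Rightarrow> 'v) S (elts u)"
    using assms someI_ex[of "\<lambda>f :: _ \<Rightarrow> 'v. \<exists>u. bij_betw f S (elts u)"] by (simp add: small_def code_def)
  then show "inj_on (code S :: _ \<Rightarrow> 'v) S" "(code S :: _ \<Rightarrow> 'v) ` S \<in> range elts"
    by (auto simp: bij_betw_def)
qed

section \<open>Arrows and liftings\<close>

context quantaloid begin

lemma Hom_Ob: "f \<in> Hom Q X Y \<Longrightarrow> X \<in> Ob Q" "f \<in> Hom Q X Y \<Longrightarrow> Y \<in> Ob Q"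
  using Dom_Cod by (auto simp: Hom_def)

lemma partial_order_Hom: "f \<in> Hom Q X Y \<Longrightarrow> partial_order (Hom_lattice Q X Y)"
  using Hom_Ob[of f X Y] Hom_complete complete_lattice.axioms(1) by blast

lemma Hom_lattice_simps [simp]:
  "carrier (Hom_lattice Q X Y) = Hom Q X Y"
  "le (Hom_lattice Q X Y) = leq Q"
  "eq (Hom_lattice Q X Y) = (=)"
  by (simp_all add: Hom_lattice_def)

lemma leq_refl: "f \<in> Hom Q X Y \<Longrightarrow> f \<preceq> f"
  using weak_partial_order.le_refl[OF partial_order.axioms(1)[OF partial_order_Hom], of f X Y f] by simp

text \<open>\<open>leq Q\<close> is one relation on all arrows, and the lattice axioms speak about
  it only inside a hom-set. Hence the membership premises here and the typing facts that accompany
  every later chain of inequalities.\<close>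

lemma leq_trans:
  assumes "f \<preceq> g" "g \<preceq> h" "f \<in> Hom Q X Y" "g \<in> Hom Q X Y" "h \<in> Hom Q X Y"
  shows "f \<preceq> h"
  using weak_partial_order.le_trans[OF partial_order.axioms(1)[OF partial_order_Hom[OF assms(3)]], of f g h]
    assms by simp

lemma leq_antisym:
  assumes "f \<preceq> g" "g \<preceq> f" "f \<in> Hom Q X Y" "g \<in> Hom Q X Y"
  shows "f = g"
  using partial_order.le_antisym[OF partial_order_Hom[OF assms(3)], of f g]
    assms by simp

text \<open>Residuals are known through the arrows below them, so this is how equations between
  residuals are proved.\<close>

lemma eq_if_same_lower_bounds:
  assumes "f \<in> Hom Q X Y" "g \<in> Hom Q X Y" and "\<And>h. h \<in> Hom Q X Y \<Longrightarrow> h \<preceq> f \<longleftrightarrow> h \<preceq> g"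
  shows "f = g"
  using assms by (auto intro!: leq_antisym[of f g X Y] leq_refl)

lemma Sup_Hom:
  assumes "X \<in> Ob Q" "Y \<in> Ob Q" "S \<subseteq> Hom Q X Y"
  shows "\<Squnion>\<^bsub>Hom_lattice Q X Y\<^esub> S \<in> Hom Q X Y"
proof -
  interpret complete_lattice "Hom_lattice Q X Y" using assms Hom_complete by blast
  show ?thesis using sup_closed[of S] assms by simp
qed

lemma Sup_le_iff:
  assumes "X \<in> Ob Q" "Y \<in> Ob Q" "S \<subseteq> Hom Q X Y" "g \<in> Hom Q X Y"
  shows "\<Squnion>\<^bsub>Hom_lattice Q X Y\<^esub> S \<preceq> g \<longleftrightarrow> (\<forall>f\<in>S. f \<preceq> g)"
proof -
  interpret complete_lattice "Hom_lattice Q X Y" using assms Hom_complete by blast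
  have S: "\<Squnion>\<^bsub>Hom_lattice Q X Y\<^esub> S \<in> Hom Q X Y" using Sup_Hom assms by blast
  show ?thesis
  proof
    assume *: "\<Squnion>\<^bsub>Hom_lattice Q X Y\<^esub> S \<preceq> g"
    show "\<forall>f\<in>S. f \<preceq> g"
      using leq_trans[OF _ * _ S assms(4)] sup_upper[of S] assms(3) by (simp add: subset_iff)
  next
    assume "\<forall>f\<in>S. f \<preceq> g"
    then show "\<Squnion>\<^bsub>Hom_lattice Q X Y\<^esub> S \<preceq> g"
      using sup_least[of S g] assms by (simp add: Upper_def subset_iff)
  qed
qed

lemma comp_Sup_le_iff:
  assumes "X \<in> Ob Q" "S \<subseteq> Hom Q X Y" "g \<in> Hom Q Y Z" "k \<in> Hom Q X Z"
  shows "g \<cdot> (\<Squnion>\<^bsub>Hom_lattice Q X Y\<^esub> S) \<preceq> k \<longleftrightarrow> (\<forall>f\<in>S. g \<cdot> f \<preceq> k)"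
  using assms Sup_le_iff[of X Z "(\<lambda>f. g \<cdot> f) ` S" k] Hom_Ob
  by (auto simp: comp_Sup intro: comp_Hom)

lemma Sup_comp_le_iff:
  assumes "Z \<in> Ob Q" "S \<subseteq> Hom Q Y Z" "f \<in> Hom Q X Y" "k \<in> Hom Q X Z"
  shows "(\<Squnion>\<^bsub>Hom_lattice Q Y Z\<^esub> S) \<cdot> f \<preceq> k \<longleftrightarrow> (\<forall>g\<in>S. g \<cdot> f \<preceq> k)"
  using assms Sup_le_iff[of X Z "(\<lambda>g. g \<cdot> f) ` S" k] Hom_Ob
  by (auto simp: Sup_comp intro: comp_Hom)

text \<open>Monotonicity is not an axiom: it is preservation of the supremum of
  \<open>{f, f'}\<close>, which is \<open>f'\<close>.\<close>

lemma comp_mono_right: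
  assumes "f \<preceq> f'" "f \<in> Hom Q X Y" "f' \<in> Hom Q X Y" "g \<in> Hom Q Y Z"
  shows "g \<cdot> f \<preceq> g \<cdot> f'"
proof -
  have ob: "X \<in> Ob Q" "Y \<in> Ob Q" using assms Hom_Ob by blast+
  have S: "{f, f'} \<subseteq> Hom Q X Y" using assms by simp
  have "\<Squnion>\<^bsub>Hom_lattice Q X Y\<^esub> {f, f'} = f'"
    using Sup_le_iff[OF ob S] Sup_Hom[OF ob S] assms
    by (intro leq_antisym[of _ _ X Y]) (auto intro: leq_refl)
  moreover have "g \<cdot> f' \<in> Hom Q X Z" using assms comp_Hom by blast
  ultimately show ?thesis
    using comp_Sup_le_iff[OF ob(1) S assms(4), of "g \<cdot> f'"] leq_refl by auto
qed

lemma comp_mono_left: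
  assumes "g \<preceq> g'" "g \<in> Hom Q Y Z" "g' \<in> Hom Q Y Z" "f \<in> Hom Q X Y"
  shows "g \<cdot> f \<preceq> g' \<cdot> f"
proof -
  have ob: "Y \<in> Ob Q" "Z \<in> Ob Q" using assms Hom_Ob by blast+
  have S: "{g, g'} \<subseteq> Hom Q Y Z" using assms by simp
  have "\<Squnion>\<^bsub>Hom_lattice Q Y Z\<^esub> {g, g'} = g'"
    using Sup_le_iff[OF ob S] Sup_Hom[OF ob S] assms
    by (intro leq_antisym[of _ _ Y Z]) (auto intro: leq_refl)
  moreover have "g' \<cdot> f \<in> Hom Q X Z" using assms comp_Hom by blast
  ultimately show ?thesis
    using Sup_comp_le_iff[OF ob(2) S assms(4), of "g' \<cdot> f"] leq_refl by auto
qed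

text \<open>One entry of a lifting matrix; \<open>I\<close> is the set of objects of the common codomain.\<close>

definition residual :: "'i set \<Rightarrow> 'o \<Rightarrow> 'o \<Rightarrow> ('i \<Rightarrow> 'm) \<Rightarrow> ('i \<Rightarrow> 'm) \<Rightarrow> 'm"
  where "residual I X Y p r = \<Squnion>\<^bsub>Hom_lattice Q X Y\<^esub> {h \<in> Hom Q X Y. \<forall>i\<in>I. p i \<cdot> h \<preceq> r i}"

lemma residual_Hom: "X \<in> Ob Q \<Longrightarrow> Y \<in> Ob Q \<Longrightarrow> residual I X Y p r \<in> Hom Q X Y"
  unfolding residual_def by (rule Sup_Hom) auto

text \<open>From left to right, preservation of suprema is essential: the supremum of all solutions
  of the inequalities is again a solution, hence so is every arrow below it.\<close>

lemma le_residual_iff: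
  assumes "h \<in> Hom Q X Y" and p: "\<And>i. i \<in> I \<Longrightarrow> p i \<in> Hom Q Y (t i)"
    and r: "\<And>i. i \<in> I \<Longrightarrow> r i \<in> Hom Q X (t i)"
  shows "h \<preceq> residual I X Y p r \<longleftrightarrow> (\<forall>i\<in>I. p i \<cdot> h \<preceq> r i)"
proof -
  have ob: "X \<in> Ob Q" "Y \<in> Ob Q" using assms Hom_Ob by blast+
  let ?S = "{h \<in> Hom Q X Y. \<forall>i\<in>I. p i \<cdot> h \<preceq> r i}"
  have R: "residual I X Y p r \<in> Hom Q X Y" using ob residual_Hom by blast
  have S: "?S \<subseteq> Hom Q X Y" by auto
  show ?thesis
  proof
    assume h: "h \<preceq> residual I X Y p r"
    show "\<forall>i\<in>I. p i \<cdot> h \<preceq> r i"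
    proof
      fix i assume i: "i \<in> I"
      have "p i \<cdot> residual I X Y p r \<preceq> r i"
        using comp_Sup_le_iff[OF ob(1) S p[OF i] r[OF i]] i unfolding residual_def by auto
      moreover have "p i \<cdot> h \<preceq> p i \<cdot> residual I X Y p r"
        by (rule comp_mono_right[OF h assms(1) R p[OF i]])
      ultimately show "p i \<cdot> h \<preceq> r i"
        using leq_trans comp_Hom[OF _ p[OF i]] R assms(1) r[OF i] by meson
    qed
  next
    assume "\<forall>i\<in>I. p i \<cdot> h \<preceq> r i"
    then show "h \<preceq> residual I X Y p r"
      using Sup_le_iff[OF ob S R] leq_refl[OF R] assms(1) unfolding residual_def by auto
  qed
qed

lemma residual_cong:
  assumes "\<And>i. i \<in> I \<Longrightarrow> p i = p' i" "\<And>i. i \<in> I \<Longrightarrow> r i = r' i"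
  shows "residual I X Y p r = residual I X Y p' r'"
  unfolding residual_def using assms by (simp cong: conj_cong ball_cong)

section \<open>Matrices over a quantaloid and the entrywise form of liftings\<close>

lemma qcat_Ob: "qcategory Q A \<Longrightarrow> a \<in> objs A \<Longrightarrow> tp A a \<in> Ob Q"
  by (auto simp: qcategory_def)

lemma qcat_Hom: "qcategory Q A \<Longrightarrow> a' \<in> objs A \<Longrightarrow> a \<in> objs A \<Longrightarrow> hom A (a', a) \<in> Hom Q (tp A a) (tp A a')"
  by (auto simp: qcategory_def)

lemma qcat_Id: "qcategory Q A \<Longrightarrow> a \<in> objs A \<Longrightarrow> Id Q (tp A a) \<preceq> hom A (a, a)"
  by (auto simp: qcategory_def)

lemma qcat_comp:
  "qcategory Q A \<Longrightarrow> a'' \<in> objs A \<Longrightarrow> a' \<in> objs A \<Longrightarrow> a \<in> objs A \<Longrightarrow>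
    hom A (a'', a') \<cdot> hom A (a', a) \<preceq> hom A (a'', a)"
  by (auto simp: qcategory_def)

lemma dist_Hom:
  "\<Phi> \<in> distributors Q A B \<Longrightarrow> b \<in> objs B \<Longrightarrow> a \<in> objs A \<Longrightarrow> \<Phi> (b, a) \<in> Hom Q (tp A a) (tp B b)"
  by (auto simp: distributors_def)

lemma dist_comp_le_iff:
  assumes A: "qcategory Q A" and C: "qcategory Q C"
    and \<Psi>: "\<Psi> \<in> distributors Q B C" and \<Theta>: "\<Theta> \<in> distributors Q A B" and \<Phi>: "\<Phi> \<in> distributors Q A C"
  shows "dist_le Q A C (dist_comp Q A B C \<Psi> \<Theta>) \<Phi> \<longleftrightarrow>
    (\<forall>c\<in>objs C. \<forall>b\<in>objs B. \<forall>a\<in>objs A. \<Psi> (c, b) \<cdot> \<Theta> (b, a) \<preceq> \<Phi> (c, a))"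
proof -
  have "dist_comp Q A B C \<Psi> \<Theta> (c, a) \<preceq> \<Phi> (c, a) \<longleftrightarrow> (\<forall>b\<in>objs B. \<Psi> (c, b) \<cdot> \<Theta> (b, a) \<preceq> \<Phi> (c, a))"
    if "c \<in> objs C" "a \<in> objs A" for c a
  proof -
    have "(\<lambda>b. \<Psi> (c, b) \<cdot> \<Theta> (b, a)) ` objs B \<subseteq> Hom Q (tp A a) (tp C c)"
      using that by (auto intro!: comp_Hom[OF dist_Hom[OF \<Theta>] dist_Hom[OF \<Psi>]])
    then show ?thesis
      using that Sup_le_iff[of "tp A a" "tp C c"] qcat_Ob[OF A] qcat_Ob[OF C] dist_Hom[OF \<Phi>]
      by (simp add: dist_comp_def)
  qed
  then show ?thesis by (auto simp: dist_le_def)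
qed

text \<open>The largest matrix satisfying the required inequality can be computed one entry at a
  time. By residuation the two action laws for it follow from those of \<open>\<Phi>\<close> and
  \<open>\<Psi>\<close>, so it is a distributor and therefore the largest distributor. This removes
  the description operator from all later arguments.\<close>

lemma lifting_eq:
  assumes A: "qcategory Q A" and B: "qcategory Q B" and C: "qcategory Q C"
    and \<Psi>: "\<Psi> \<in> distributors Q B C" and \<Phi>: "\<Phi> \<in> distributors Q A C"
  shows "lifting Q A B C \<Psi> \<Phi> = (\<lambda>(b, a)\<in>objs B \<times> objs A.
    residual (objs C) (tp A a) (tp B b) (\<lambda>c. \<Psi> (c, b)) (\<lambda>c. \<Phi> (c, a)))"
    (is "_ = ?L")
proof -
  have L_Hom: "?L (b, a) \<in> Hom Q (tp A a) (tp B b)" if "a \<in> objs A" "b \<in> objs B" for a b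
    using that qcat_Ob[OF A] qcat_Ob[OF B] by (simp add: residual_Hom)
  have le_L: "h \<preceq> ?L (b, a) \<longleftrightarrow> (\<forall>c\<in>objs C. \<Psi> (c, b) \<cdot> h \<preceq> \<Phi> (c, a))"
    if "a \<in> objs A" "b \<in> objs B" "h \<in> Hom Q (tp A a) (tp B b)" for a b h
    using that dist_Hom[OF \<Psi>] dist_Hom[OF \<Phi>]
    by (simp add: le_residual_iff[where t = "tp C"])
  have L_counit: "\<Psi> (c, b) \<cdot> ?L (b, a) \<preceq> \<Phi> (c, a)" if "a \<in> objs A" "b \<in> objs B" "c \<in> objs C" for a b c
    using that le_L[OF that(1,2) L_Hom[OF that(1,2)]] leq_refl[OF L_Hom[OF that(1,2)]] by blast
  have dist: "?L \<in> distributors Q A B"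
    unfolding distributors_def mem_Collect_eq
  proof (intro conjI ballI)
    show "?L \<in> extensional (objs B \<times> objs A)" by simp
    show "?L (b, a) \<in> Hom Q (tp A a) (tp B b)" if "a \<in> objs A" "b \<in> objs B" for a b
      using that by (rule L_Hom)
    show "?L (b, a') \<cdot> hom A (a', a) \<preceq> ?L (b, a)"
      if o: "b \<in> objs B" "a' \<in> objs A" "a \<in> objs A" for b a' a
    proof -
      note h = L_Hom[OF o(2,1)] qcat_Hom[OF A o(2,3)] 
      have "\<Psi> (c, b) \<cdot> (?L (b, a') \<cdot> hom A (a', a)) \<preceq> \<Phi> (c, a)" if c: "c \<in> objs C" for c
      proof -
        note p = dist_Hom[OF \<Psi> c o(1)] and f' = dist_Hom[OF \<Phi> c o(2)] and f = dist_Hom[OF \<Phi> c o(3)]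
        have "\<Psi> (c, b) \<cdot> ?L (b, a') \<cdot> hom A (a', a) \<preceq> \<Phi> (c, a') \<cdot> hom A (a', a)"
          by (rule comp_mono_left[OF L_counit[OF o(2,1) c] comp_Hom[OF h(1) p] f' h(2)])
        moreover have "\<Phi> (c, a') \<cdot> hom A (a', a) \<preceq> \<Phi> (c, a)"
          using \<Phi> c o by (auto simp: distributors_def)
        ultimately have "\<Psi> (c, b) \<cdot> ?L (b, a') \<cdot> hom A (a', a) \<preceq> \<Phi> (c, a)"
          by (rule leq_trans[OF _ _ comp_Hom[OF h(2) comp_Hom[OF h(1) p]] comp_Hom[OF h(2) f'] f])
        then show ?thesis by (simp only: comp_assoc[OF h(2,1) p])
      qed
      then show ?thesis using le_L[OF o(3,1) comp_Hom[OF h(2,1)]] by blast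
    qed
    show "hom B (b, b') \<cdot> ?L (b', a) \<preceq> ?L (b, a)"
      if o: "b \<in> objs B" "b' \<in> objs B" "a \<in> objs A" for b b' a
    proof -
      note h = L_Hom[OF o(3,2)] qcat_Hom[OF B o(1,2)] 
      have "\<Psi> (c, b) \<cdot> (hom B (b, b') \<cdot> ?L (b', a)) \<preceq> \<Phi> (c, a)" if c: "c \<in> objs C" for c
      proof -
        note p = dist_Hom[OF \<Psi> c o(1)] and p' = dist_Hom[OF \<Psi> c o(2)] and f = dist_Hom[OF \<Phi> c o(3)]
        have "\<Psi> (c, b) \<cdot> hom B (b, b') \<preceq> \<Psi> (c, b')"
          using \<Psi> c o by (auto simp: distributors_def)
        then have "\<Psi> (c, b) \<cdot> hom B (b, b') \<cdot> ?L (b', a) \<preceq> \<Psi> (c, b') \<cdot> ?L (b', a)"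
          by (rule comp_mono_left[OF _ comp_Hom[OF h(2) p] p' h(1)])
        then have "\<Psi> (c, b) \<cdot> hom B (b, b') \<cdot> ?L (b', a) \<preceq> \<Phi> (c, a)"
          by (rule leq_trans[OF _ L_counit[OF o(3,2) c] comp_Hom[OF h(1) comp_Hom[OF h(2) p]] comp_Hom[OF h(1) p'] f])
        then show ?thesis by (simp only: comp_assoc[OF h p])
      qed
      then show ?thesis using le_L[OF o(3,1) comp_Hom[OF h]] by blast
    qed
  qed
  show ?thesis
    unfolding lifting_def
  proof (rule the_equality)
    show largest: "?L \<in> distributors Q A B \<and> dist_le Q A C (dist_comp Q A B C \<Psi> ?L) \<Phi> \<and>
      (\<forall>\<Theta>'\<in>distributors Q A B. dist_le Q A C (dist_comp Q A B C \<Psi> \<Theta>') \<Phi> \<longrightarrow> dist_le Q A B \<Theta>' ?L)"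
    proof (intro conjI ballI impI)
      show "dist_le Q A C (dist_comp Q A B C \<Psi> ?L) \<Phi>"
        using dist_comp_le_iff[OF A C \<Psi> dist \<Phi>] L_counit by blast
      show "dist_le Q A B \<Theta>' ?L"
        if "\<Theta>' \<in> distributors Q A B" "dist_le Q A C (dist_comp Q A B C \<Psi> \<Theta>') \<Phi>" for \<Theta>'
        unfolding dist_le_def
      proof (intro ballI)
        fix b a assume "b \<in> objs B" "a \<in> objs A"
        then show "\<Theta>' (b, a) \<preceq> ?L (b, a)"
          using le_L dist_Hom[OF that(1)] dist_comp_le_iff[OF A C \<Psi> that(1) \<Phi>] that(2) by blast
      qed
    qed (rule dist)
    fix \<Theta>
    assume \<Theta>: "\<Theta> \<in> distributors Q A B \<and> dist_le Q A C (dist_comp Q A B C \<Psi> \<Theta>) \<Phi> \<and>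
      (\<forall>\<Theta>'\<in>distributors Q A B. dist_le Q A C (dist_comp Q A B C \<Psi> \<Theta>') \<Phi> \<longrightarrow> dist_le Q A B \<Theta>' \<Theta>)"
    then have "dist_le Q A B \<Theta> ?L" "dist_le Q A B ?L \<Theta>" using largest by blast+
    then have "\<Theta> (b, a) = ?L (b, a)" if "b \<in> objs B" "a \<in> objs A" for b a
      using that leq_antisym[OF _ _ dist_Hom[of \<Theta>] L_Hom] \<Theta> by (meson dist_le_def)
    moreover have "\<Theta> \<in> extensional (objs B \<times> objs A)" using \<Theta> by (simp add: distributors_def)
    ultimately show "\<Theta> = ?L"
      by (intro extensionalityI[of _ "objs B \<times> objs A"]) auto
  qed
qed

end

section \<open>Presheaves\<close>

lemma restrict_pt_eq_iff:
  "(\<lambda>(_ :: 'v, b)\<in>{pt :: 'v::set_universe} \<times> S. f b) = (\<lambda>(_, b)\<in>{pt} \<times> S. g b) \<longleftrightarrow> (\<forall>b\<in>S. f b = g b)"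
  by (auto simp: restrict_def fun_eq_iff)

abbreviation at :: "('v::set_universe, 'o, 'm) psh \<Rightarrow> 'v \<Rightarrow> 'm"
  where "at p a \<equiv> snd p (a, pt)"

definition mk_psh :: "('v::set_universe, 'o, 'm) qcat \<Rightarrow> 'o \<Rightarrow> ('v \<Rightarrow> 'm) \<Rightarrow> ('v, 'o, 'm) psh"
  where "mk_psh A X r = (X, \<lambda>(a, _)\<in>objs A \<times> {pt}. r a)"

lemma fst_mk_psh [simp]: "fst (mk_psh A X r) = X"
  by (simp add: mk_psh_def)

lemma at_mk_psh [simp]: "a \<in> objs A \<Longrightarrow> at (mk_psh A X r) a = r a"
  by (simp add: mk_psh_def)

lemma representable_eq: "representable A a = mk_psh A (tp A a) (\<lambda>a'. hom A (a', a))"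
  by (simp add: representable_def mk_psh_def)

context quantaloid begin

lemma qcategory_star: "X \<in> Ob Q \<Longrightarrow> qcategory Q (star Q X :: ('v::set_universe, 'o, 'm) qcat)"
  using Id_Hom[of X] leq_refl[OF Id_Hom[of X]] comp_Id[OF Id_Hom[of X]] range_elts_singleton
  by (auto simp: qcategory_def star_def)

lemma star_simps [simp]: "objs (star Q X) = {pt}" "tp (star Q X) pt = X" "hom (star Q X) (pt, pt) = Id Q X"
  by (simp_all add: star_def)

text \<open>
  The presheaf condition on a bare family \<open>r\<close> of arrows, with no extensionality, so that it applies to
  \<open>\<lambda>\<close>-expressions such as \<open>\<lambda>a. hom B (F a, b)\<close>.
\<close>

definition is_psh :: "('v::set_universe, 'o, 'm) qcat \<Rightarrow> 'o \<Rightarrow> ('v \<Rightarrow> 'm) \<Rightarrow> bool"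
  where "is_psh A X r \<longleftrightarrow> X \<in> Ob Q \<and> (\<forall>a\<in>objs A. r a \<in> Hom Q X (tp A a)) \<and>
    (\<forall>a'\<in>objs A. \<forall>a\<in>objs A. hom A (a', a) \<cdot> r a \<preceq> r a')"

lemma is_pshD:
  assumes "is_psh A X r"
  shows "X \<in> Ob Q" "a \<in> objs A \<Longrightarrow> r a \<in> Hom Q X (tp A a)"
    "a' \<in> objs A \<Longrightarrow> a \<in> objs A \<Longrightarrow> hom A (a', a) \<cdot> r a \<preceq> r a'"
  using assms by (auto simp: is_psh_def)

text \<open>The only arrow of \<open>star Q X\<close> acts as an identity, so of the two action laws
  of a distributor just the one for \<open>A\<close> says anything.\<close>

lemma presheaves_iff:
  "p \<in> presheaves Q A \<longleftrightarrow> is_psh A (fst p) (at p) \<and> snd p \<in> extensional (objs A \<times> {pt})"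
proof -
  have "at p a \<cdot> Id Q (fst p) \<preceq> at p a" if "at p a \<in> Hom Q (fst p) (tp A a)" for a
    using comp_Id[OF that] leq_refl[OF that] by simp
  then show ?thesis
    by (cases p) (auto simp: presheaves_def distributors_def is_psh_def)
qed

lemma is_psh_at: "p \<in> presheaves Q A \<Longrightarrow> is_psh A (fst p) (at p)"
  by (simp add: presheaves_iff)

lemma psh_Ob: "p \<in> presheaves Q A \<Longrightarrow> fst p \<in> Ob Q"
  using is_psh_at is_pshD by blast

lemma psh_Hom: "p \<in> presheaves Q A \<Longrightarrow> a \<in> objs A \<Longrightarrow> at p a \<in> Hom Q (fst p) (tp A a)"
  using is_psh_at is_pshD by blast

lemma mk_psh_presheaves: "is_psh A X r \<Longrightarrow> mk_psh A X r \<in> presheaves Q A"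
  unfolding presheaves_iff by (auto simp: is_psh_def) (auto simp: mk_psh_def)

lemma presheaf_eqI:
  assumes "p \<in> presheaves Q A" "q \<in> presheaves Q A" "fst p = fst q" "\<And>a. a \<in> objs A \<Longrightarrow> at p a = at q a"
  shows "p = q"
proof (rule prod_eqI[OF assms(3)])
  show "snd p = snd q"
    by (rule extensionalityI[of _ "objs A \<times> {pt}"]) (use assms in \<open>auto simp: presheaves_iff\<close>)
qed

lemma is_psh_representable:
  "qcategory Q A \<Longrightarrow> a \<in> objs A \<Longrightarrow> is_psh A (tp A a) (\<lambda>a'. hom A (a', a))"
  by (simp add: is_psh_def qcat_Ob qcat_Hom qcat_comp)

lemma representable_presheaves:
  "qcategory Q A \<Longrightarrow> a \<in> objs A \<Longrightarrow> representable A a \<in> presheaves Q A"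
  by (simp add: representable_eq is_psh_representable mk_psh_presheaves)

text \<open>The common domain \<open>X\<close> of the arrows \<open>r a\<close> is an argument of
  its own: over a category without objects the family does not determine it.\<close>

definition psh_res :: "('v::set_universe, 'o, 'm) qcat \<Rightarrow> 'o \<Rightarrow> ('v, 'o, 'm) psh \<Rightarrow> ('v \<Rightarrow> 'm) \<Rightarrow> 'm"
  where "psh_res A X p r = residual (objs A) X (fst p) (at p) r"

lemma psh_res_Hom: "p \<in> presheaves Q A \<Longrightarrow> X \<in> Ob Q \<Longrightarrow> psh_res A X p r \<in> Hom Q X (fst p)"
  unfolding psh_res_def by (rule residual_Hom) (auto intro: psh_Ob)

lemma le_psh_res_iff:
  assumes "p \<in> presheaves Q A" "\<And>a. a \<in> objs A \<Longrightarrow> r a \<in> Hom Q X (tp A a)" "h \<in> Hom Q X (fst p)"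
  shows "h \<preceq> psh_res A X p r \<longleftrightarrow> (\<forall>a\<in>objs A. at p a \<cdot> h \<preceq> r a)"
  unfolding psh_res_def by (rule le_residual_iff[OF assms(3) psh_Hom[OF assms(1)] assms(2)])

lemma psh_res_counit:
  assumes "p \<in> presheaves Q A" "\<And>a. a \<in> objs A \<Longrightarrow> r a \<in> Hom Q X (tp A a)" "X \<in> Ob Q" "a \<in> objs A"
  shows "at p a \<cdot> psh_res A X p r \<preceq> r a"
  using le_psh_res_iff[OF assms(1,2) psh_res_Hom[OF assms(1,3), of r]]
    leq_refl[OF psh_res_Hom[OF assms(1,3)]] assms(4) by blast

lemma psh_res_cong:
  "(\<And>a. a \<in> objs A \<Longrightarrow> r a = r' a) \<Longrightarrow> psh_res A X p r = psh_res A X p r'"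
  unfolding psh_res_def by (rule residual_cong) auto

lemma psh_hom_eq:
  assumes A: "qcategory Q A" and p: "p \<in> presheaves Q A" and q: "q \<in> presheaves Q A"
  shows "psh_hom Q A p q = psh_res A (fst q) p (at q)"
  using lifting_eq[OF qcategory_star qcategory_star A, of "fst q" "fst p" "snd p" "snd q"] p q psh_Ob
  by (auto simp: psh_hom_def psh_res_def presheaves_def)

section \<open>Functors, weighted colimits and isomorphism\<close>

lemma functor_dest:
  assumes "F \<in> functors Q A B"
  shows "a \<in> objs A \<Longrightarrow> F a \<in> objs B" "a \<in> objs A \<Longrightarrow> tp B (F a) = tp A a"
    "a' \<in> objs A \<Longrightarrow> a \<in> objs A \<Longrightarrow> hom A (a', a) \<preceq> hom B (F a', F a)"
    "F \<in> extensional (objs A)"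
  using assms by (auto simp: functors_def PiE_def)

lemma functor_Hom:
  assumes "F \<in> functors Q A B" "qcategory Q B" "a \<in> objs A" "b \<in> objs B"
  shows "hom B (F a, b) \<in> Hom Q (tp B b) (tp A a)" "hom B (b, F a) \<in> Hom Q (tp A a) (tp B b)"
  using qcat_Hom[OF assms(2), of "F a" b] qcat_Hom[OF assms(2), of b "F a"]
    functor_dest(1,2)[OF assms(1,3)] assms(4) by auto

lemma is_psh_comp_functor:
  assumes A: "qcategory Q A" and B: "qcategory Q B" and F: "F \<in> functors Q A B" and r: "is_psh B X r"
  shows "is_psh A X (\<lambda>a. r (F a))"
  unfolding is_psh_def
proof (intro conjI ballI)
  note F' = functor_dest[OF F]
  show "X \<in> Ob Q" using is_pshD[OF r] by blast
  show r_Hom: "r (F a) \<in> Hom Q X (tp A a)" if "a \<in> objs A" for a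
    using is_pshD(2)[OF r, of "F a"] F' that by simp
  fix a' a assume a: "a' \<in> objs A" "a \<in> objs A"
  have H: "hom B (F a', F a) \<in> Hom Q (tp A a) (tp A a')"
    using functor_Hom(2)[OF F B a(2) F'(1)[OF a(1)]] F'(2) a by simp
  have "hom A (a', a) \<cdot> r (F a) \<preceq> hom B (F a', F a) \<cdot> r (F a)"
    by (rule comp_mono_left[OF F'(3)[OF a] qcat_Hom[OF A a] H r_Hom[OF a(2)]])
  moreover have "hom B (F a', F a) \<cdot> r (F a) \<preceq> r (F a')"
    using is_pshD(3)[OF r] F' a by simp
  ultimately show "hom A (a', a) \<cdot> r (F a) \<preceq> r (F a')"
    by (rule leq_trans[OF _ _ comp_Hom[OF r_Hom[OF a(2)] qcat_Hom[OF A a]]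
          comp_Hom[OF r_Hom[OF a(2)] H] r_Hom[OF a(1)]])
qed

lemma is_psh_functor:
  assumes "qcategory Q A" "qcategory Q B" "F \<in> functors Q A B" "b \<in> objs B"
  shows "is_psh A (tp B b) (\<lambda>a. hom B (F a, b))"
  by (rule is_psh_comp_functor[OF assms(1-3)]) (rule is_psh_representable[OF assms(2,4)])

lemma upper_star_dist:
  assumes A: "qcategory Q A" and B: "qcategory Q B" and F: "F \<in> functors Q A B"
  shows "upper_star A B F \<in> distributors Q B A"
  using functor_dest[OF F] functor_Hom[OF F B] is_pshD(3)[OF is_psh_functor[OF A B F]] qcat_comp[OF B]
  unfolding distributors_def upper_star_def by auto

text \<open>An equation between two liftings becomes one equation of arrows for each object of
  \<open>B\<close>; this is the working form of weighted colimits.\<close>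

lemma is_colim_iff:
  assumes A: "qcategory Q A" and B: "qcategory Q B" and F: "F \<in> functors Q A B" and p: "p \<in> presheaves Q A"
  shows "is_colim Q A B p F c \<longleftrightarrow> c \<in> objs B \<and> tp B c = fst p \<and>
    (\<forall>b\<in>objs B. hom B (c, b) = psh_res A (tp B b) p (\<lambda>a. hom B (F a, b)))"
proof -
  have "lifting Q B (star Q (fst p)) A (snd p) (upper_star A B F) =
    (\<lambda>(_, b)\<in>{pt} \<times> objs B. psh_res A (tp B b) p (\<lambda>a. hom B (F a, b)))"
    using lifting_eq[OF B qcategory_star A _ upper_star_dist[OF A B F], of "fst p" "snd p"] p
    by (auto simp: presheaves_def psh_res_def upper_star_def restrict_def fun_eq_iff intro!: residual_cong)
  then show ?thesis unfolding is_colim_def by (simp add: restrict_pt_eq_iff)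
qed

text \<open>In one direction compose with \<open>hom B (b, c)\<close>, which lies above the
  identity. In the other evaluate at \<open>d = b\<close>, respectively \<open>d = c\<close>, where
  the hom-arrow lies above the identity.\<close>

lemma Id_le_hom_iff:
  assumes B: "qcategory Q B" and b: "b \<in> objs B" and c: "c \<in> objs B" and t: "tp B b = tp B c"
  shows "Id Q (tp B b) \<preceq> hom B (b, c) \<longleftrightarrow> (\<forall>d\<in>objs B. hom B (d, b) \<preceq> hom B (d, c))" (is ?lower)
    and "Id Q (tp B b) \<preceq> hom B (b, c) \<longleftrightarrow> (\<forall>d\<in>objs B. hom B (c, d) \<preceq> hom B (b, d))" (is ?upper)
proof -
  note Ibb = Id_Hom[OF qcat_Ob[OF B b]]
  have Hbc: "hom B (b, c) \<in> Hom Q (tp B b) (tp B b)"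
    using qcat_Hom[OF B b c] by (simp add: t)
  have lower: "hom B (d, b) \<preceq> hom B (d, c)" if *: "Id Q (tp B b) \<preceq> hom B (b, c)" and d: "d \<in> objs B" for d
  proof -
    note H = qcat_Hom[OF B d b]
    have Hc: "hom B (d, c) \<in> Hom Q (tp B b) (tp B d)" using qcat_Hom[OF B d c] by (simp add: t)
    have "hom B (d, b) \<cdot> Id Q (tp B b) \<preceq> hom B (d, b) \<cdot> hom B (b, c)"
      by (rule comp_mono_right[OF * Ibb Hbc H])
    then show ?thesis
      using leq_trans[OF _ qcat_comp[OF B d b c] H comp_Hom[OF Hbc H] Hc] comp_Id[OF H] by simp
  qed
  have upper: "hom B (c, d) \<preceq> hom B (b, d)" if *: "Id Q (tp B b) \<preceq> hom B (b, c)" and d: "d \<in> objs B" for d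
  proof -
    have H: "hom B (c, d) \<in> Hom Q (tp B d) (tp B b)" using qcat_Hom[OF B c d] by (simp add: t)
    have "Id Q (tp B b) \<cdot> hom B (c, d) \<preceq> hom B (b, c) \<cdot> hom B (c, d)"
      by (rule comp_mono_left[OF * Ibb Hbc H])
    then show ?thesis
      using leq_trans[OF _ qcat_comp[OF B b c d] H comp_Hom[OF H Hbc] qcat_Hom[OF B b d]] Id_comp[OF H] by simp
  qed
  show ?lower
    using lower leq_trans[OF qcat_Id[OF B b] _ Ibb qcat_Hom[OF B b b] Hbc] b by blast
  have "Id Q (tp B b) \<preceq> hom B (c, c)" "hom B (c, c) \<in> Hom Q (tp B b) (tp B b)"
    using qcat_Id[OF B c] qcat_Hom[OF B c c] by (simp_all add: t)
  then show ?upper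
    using upper leq_trans[OF _ _ Ibb _ Hbc, of "hom B (c, c)"] c by blast
qed

lemma functor_le_iff:
  assumes B: "qcategory Q B" and F: "F \<in> functors Q A B" and G: "G \<in> functors Q A B"
  shows "functor_le Q A B F G \<longleftrightarrow> (\<forall>a\<in>objs A. Id Q (tp A a) \<preceq> hom B (F a, G a))"
proof -
  have "Id Q (tp A a) \<preceq> hom B (F a, G a) \<longleftrightarrow> (\<forall>b\<in>objs B. hom B (b, F a) \<preceq> hom B (b, G a))"
    if "a \<in> objs A" for a
    using Id_le_hom_iff(1)[OF B, of "F a" "G a"] functor_dest[OF F] functor_dest[OF G] that by simp
  then show ?thesis unfolding functor_le_def dist_le_def lower_star_def by auto
qed

text \<open>The order on functors is defined by arrows into their values, whereas colimits are
  described by arrows out of them. The condition 1 \<le> B(Fa, Ga) mediates between the two.\<close>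

lemma functor_iso_iff:
  assumes B: "qcategory Q B" and F: "F \<in> functors Q A B" and G: "G \<in> functors Q A B"
  shows "functor_iso Q A B F G \<longleftrightarrow> (\<forall>a\<in>objs A. \<forall>b\<in>objs B. hom B (F a, b) = hom B (G a, b))"
proof -
  note F' = functor_dest[OF F] and G' = functor_dest[OF G]
  have "Id Q (tp A a) \<preceq> hom B (F a, G a) \<longleftrightarrow> (\<forall>b\<in>objs B. hom B (G a, b) \<preceq> hom B (F a, b))"
    and "Id Q (tp A a) \<preceq> hom B (G a, F a) \<longleftrightarrow> (\<forall>b\<in>objs B. hom B (F a, b) \<preceq> hom B (G a, b))"
    if "a \<in> objs A" for a
    using Id_le_hom_iff(2)[OF B, of "F a" "G a"] Id_le_hom_iff(2)[OF B, of "G a" "F a"] F'(1,2) G'(1,2) that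
    by simp_all
  then have "functor_iso Q A B F G \<longleftrightarrow> (\<forall>a\<in>objs A. \<forall>b\<in>objs B.
      hom B (G a, b) \<preceq> hom B (F a, b) \<and> hom B (F a, b) \<preceq> hom B (G a, b))"
    unfolding functor_iso_def functor_le_iff[OF B F G] functor_le_iff[OF B G F] by auto
  moreover have "hom B (G a, b) \<preceq> hom B (F a, b) \<and> hom B (F a, b) \<preceq> hom B (G a, b) \<longleftrightarrow> hom B (F a, b) = hom B (G a, b)"
    if "a \<in> objs A" "b \<in> objs B" for a b
    using leq_antisym[of "hom B (F a, b)" "hom B (G a, b)"] leq_refl functor_Hom(1)[OF F B that] functor_Hom(1)[OF G B that]
    by auto
  ultimately show ?thesis by simp
qed

lemma compose_functor:
  assumes "qcategory Q A" "qcategory Q B" "qcategory Q C" "F \<in> functors Q A B" "G \<in> functors Q B C"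
  shows "compose (objs A) G F \<in> functors Q A C"
proof -
  note F = functor_dest[OF assms(4)] and G = functor_dest[OF assms(5)]
  have "hom A (a', a) \<preceq> hom C (G (F a'), G (F a))" if a: "a' \<in> objs A" "a \<in> objs A" for a' a
  proof (rule leq_trans[OF F(3)[OF a] G(3)[OF F(1)[OF a(1)] F(1)[OF a(2)]]])
    show "hom A (a', a) \<in> Hom Q (tp A a) (tp A a')" by (rule qcat_Hom[OF assms(1) a])
    show "hom B (F a', F a) \<in> Hom Q (tp A a) (tp A a')"
      using qcat_Hom[OF assms(2), of "F a'" "F a"] F(1,2) a by simp
    show "hom C (G (F a'), G (F a)) \<in> Hom Q (tp A a) (tp A a')"
      using qcat_Hom[OF assms(3), of "G (F a')" "G (F a)"] F(1,2) G(1,2) a by simp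
  qed
  then show ?thesis
    using F(1,2) G(1,2) unfolding functors_def by (auto simp: compose_def)
qed

lemma id_functor: "qcategory Q A \<Longrightarrow> id_functor A \<in> functors Q A A"
  unfolding functors_def id_functor_def by (auto intro: leq_refl qcat_Hom)

lemma id_functor_apply [simp]: "a \<in> objs A \<Longrightarrow> id_functor A a = a"
  by (simp add: id_functor_def)

section \<open>Presheaves tested by their residuals\<close>

lemma psh_res_mono:
  assumes p: "p \<in> presheaves Q A" and X: "X \<in> Ob Q"
    and r: "\<And>a. a \<in> objs A \<Longrightarrow> r a \<in> Hom Q X (tp A a)" "\<And>a. a \<in> objs A \<Longrightarrow> r' a \<in> Hom Q X (tp A a)"
    and le: "\<And>a. a \<in> objs A \<Longrightarrow> r a \<preceq> r' a"
  shows "psh_res A X p r \<preceq> psh_res A X p r'"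
proof -
  note h = psh_res_Hom[OF p X, of r]
  have "at p a \<cdot> psh_res A X p r \<preceq> r' a" if a: "a \<in> objs A" for a
    by (rule leq_trans[OF psh_res_counit[OF p r(1) X a] le[OF a] comp_Hom[OF h psh_Hom[OF p a]] r(1)[OF a] r(2)[OF a]])
  then show ?thesis using le_psh_res_iff[OF p r(2) h] by blast
qed

text \<open>The universal property at \<open>h = Id Q (fst p)\<close>; it makes the pointwise order
  visible in the residuals.\<close>

lemma Id_le_psh_res_iff:
  assumes p: "p \<in> presheaves Q A" and r: "\<And>a. a \<in> objs A \<Longrightarrow> r a \<in> Hom Q (fst p) (tp A a)"
  shows "Id Q (fst p) \<preceq> psh_res A (fst p) p r \<longleftrightarrow> (\<forall>a\<in>objs A. at p a \<preceq> r a)"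
  using le_psh_res_iff[OF p r Id_Hom[OF psh_Ob[OF p]]] comp_Id[OF psh_Hom[OF p]] by simp

lemma presheaf_eq_res:
  assumes p: "p \<in> presheaves Q A" and q: "q \<in> presheaves Q A" and X: "fst p = fst q"
    and eq: "\<And>X r. is_psh A X r \<Longrightarrow> psh_res A X p r = psh_res A X q r"
  shows "p = q"
proof (rule presheaf_eqI[OF p q X])
  fix a assume a: "a \<in> objs A"
  have "Id Q (fst p) \<preceq> psh_res A (fst p) q (at q)"
    using Id_le_psh_res_iff[OF q, of "at q"] psh_Hom[OF q] leq_refl X by auto
  then have "at p a \<preceq> at q a"
    using Id_le_psh_res_iff[OF p, of "at q"] eq[OF is_psh_at[OF q]] psh_Hom[OF q] X a by simp
  moreover have "Id Q (fst q) \<preceq> psh_res A (fst q) p (at p)"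
    using Id_le_psh_res_iff[OF p, of "at p"] psh_Hom[OF p] leq_refl X by auto
  then have "at q a \<preceq> at p a"
    using Id_le_psh_res_iff[OF q, of "at p"] eq[OF is_psh_at[OF p]] psh_Hom[OF p] X a by simp
  ultimately show "at p a = at q a"
    using leq_antisym psh_Hom[OF p a] psh_Hom[OF q a] X by simp
qed

text \<open>Evaluating the family of inequalities at \<open>a' = a\<close> and using 1 \<le> A(a, a)
  bounds \<open>h\<close> by \<open>r a\<close>; conversely the action law of \<open>r\<close>
  spreads that bound to every \<open>a'\<close>.\<close>

lemma psh_res_representable:
  assumes A: "qcategory Q A" and a: "a \<in> objs A" and r: "is_psh A X r"
  shows "psh_res A X (representable A a) r = r a"
proof (rule eq_if_same_lower_bounds)
  note R = representable_presheaves[OF A a]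
  have f: "fst (representable A a) = tp A a" by (simp add: representable_eq)
  show "psh_res A X (representable A a) r \<in> Hom Q X (tp A a)"
    using psh_res_Hom[OF R is_pshD(1)[OF r]] by (simp add: f)
  show ra: "r a \<in> Hom Q X (tp A a)" by (rule is_pshD(2)[OF r a])
  fix h assume h: "h \<in> Hom Q X (tp A a)"
  have "h \<preceq> psh_res A X (representable A a) r \<longleftrightarrow> (\<forall>a'\<in>objs A. hom A (a', a) \<cdot> h \<preceq> r a')"
    using le_psh_res_iff[OF R is_pshD(2)[OF r]] h f by (simp add: representable_eq)
  also have "\<dots> \<longleftrightarrow> h \<preceq> r a"
  proof
    assume "\<forall>a'\<in>objs A. hom A (a', a) \<cdot> h \<preceq> r a'"
    moreover have "Id Q (tp A a) \<cdot> h \<preceq> hom A (a, a) \<cdot> h"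
      by (rule comp_mono_left[OF qcat_Id[OF A a] Id_Hom[OF qcat_Ob[OF A a]] qcat_Hom[OF A a a] h])
    ultimately show "h \<preceq> r a"
      using leq_trans[OF _ _ h comp_Hom[OF h qcat_Hom[OF A a a]] ra] a Id_comp[OF h] by simp
  next
    assume le: "h \<preceq> r a"
    show "\<forall>a'\<in>objs A. hom A (a', a) \<cdot> h \<preceq> r a'"
    proof
      fix a' assume a': "a' \<in> objs A"
      note H = qcat_Hom[OF A a' a]
      show "hom A (a', a) \<cdot> h \<preceq> r a'"
        by (rule leq_trans[OF comp_mono_right[OF le h ra H] is_pshD(3)[OF r a' a] comp_Hom[OF h H]
              comp_Hom[OF ra H] is_pshD(2)[OF r a']])
    qed
  qed
  finally show "h \<preceq> psh_res A X (representable A a) r \<longleftrightarrow> h \<preceq> r a" .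
qed

section \<open>Weighted suprema of presheaves\<close>

text \<open>The formula for the colimit in \<open>\<P>(B)\<close> of a family \<open>g\<close> of presheaves on \<open>B\<close>, weighted by \<open>p\<close>.\<close>

definition wsum :: "('v::set_universe, 'o, 'm) qcat \<Rightarrow> ('v, 'o, 'm) qcat \<Rightarrow>
    ('v, 'o, 'm) psh \<Rightarrow> ('v \<Rightarrow> ('v, 'o, 'm) psh) \<Rightarrow> ('v, 'o, 'm) psh"
  where "wsum A B p g = mk_psh B (fst p) (\<lambda>b.
    \<Squnion>\<^bsub>Hom_lattice Q (fst p) (tp B b)\<^esub> ((\<lambda>a. at (g a) b \<cdot> at p a) ` objs A))"

text \<open>Only the types are constrained, so that functors into \<P>(B), representables along a
  functor, and the decoding \<open>psh A\<close> on \<open>CC A\<close> are all covered.\<close>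

definition psh_family :: "('v::set_universe, 'o, 'm) qcat \<Rightarrow> ('v, 'o, 'm) qcat \<Rightarrow> ('v \<Rightarrow> ('v, 'o, 'm) psh) \<Rightarrow> bool"
  where "psh_family A B g \<longleftrightarrow> (\<forall>a\<in>objs A. g a \<in> presheaves Q B \<and> fst (g a) = tp A a)"

lemma fst_wsum [simp]: "fst (wsum A B p g) = fst p"
  by (simp add: wsum_def)

lemma wsum_term_Hom:
  assumes "p \<in> presheaves Q A" "psh_family A B g" "a \<in> objs A" "b \<in> objs B"
  shows "at (g a) b \<cdot> at p a \<in> Hom Q (fst p) (tp B b)"
proof (rule comp_Hom[OF psh_Hom[OF assms(1,3)]])
  show "at (g a) b \<in> Hom Q (tp A a) (tp B b)"
    using psh_Hom[of "g a" B b] assms(2-4) by (auto simp: psh_family_def)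
qed

lemma at_wsum_Hom:
  assumes "qcategory Q B" "p \<in> presheaves Q A" "psh_family A B g" "b \<in> objs B"
  shows "at (wsum A B p g) b \<in> Hom Q (fst p) (tp B b)"
  using Sup_Hom[OF psh_Ob[OF assms(2)] qcat_Ob[OF assms(1,4)]] wsum_term_Hom[OF assms(2,3) _ assms(4)] assms(4)
  by (auto simp: wsum_def intro!: Sup_Hom psh_Ob[OF assms(2)] qcat_Ob[OF assms(1)])

text \<open>Distributing over the supremum and reassociating lets \<open>at p a\<close> meet
  \<open>h\<close> first. This is the shape in which one residual nests inside another.\<close>

lemma at_wsum_comp_le_iff:
  assumes B: "qcategory Q B" and p: "p \<in> presheaves Q A" and g: "psh_family A B g"
    and b: "b \<in> objs B" and h: "h \<in> Hom Q X (fst p)" and k: "k \<in> Hom Q X (tp B b)"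
  shows "at (wsum A B p g) b \<cdot> h \<preceq> k \<longleftrightarrow> (\<forall>a\<in>objs A. at (g a) b \<cdot> (at p a \<cdot> h) \<preceq> k)"
proof -
  have "at (g a) b \<cdot> at p a \<cdot> h = at (g a) b \<cdot> (at p a \<cdot> h)" if a: "a \<in> objs A" for a
  proof (rule comp_assoc[OF h psh_Hom[OF p a]])
    show "at (g a) b \<in> Hom Q (tp A a) (tp B b)"
      using psh_Hom[of "g a" B b] g a b by (auto simp: psh_family_def)
  qed
  moreover have "(\<lambda>a. at (g a) b \<cdot> at p a) ` objs A \<subseteq> Hom Q (fst p) (tp B b)"
    using wsum_term_Hom[OF p g _ b] by auto
  ultimately show ?thesis
    using Sup_comp_le_iff[OF qcat_Ob[OF B b] _ h k] b by (simp add: wsum_def)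
qed

lemma at_wsum_upper:
  assumes B: "qcategory Q B" and p: "p \<in> presheaves Q A" and g: "psh_family A B g"
    and b: "b \<in> objs B" and a: "a \<in> objs A"
  shows "at (g a) b \<cdot> at p a \<preceq> at (wsum A B p g) b"
  using at_wsum_comp_le_iff[OF B p g b Id_Hom[OF psh_Ob[OF p]] at_wsum_Hom[OF B p g b]]
    leq_refl[OF at_wsum_Hom[OF B p g b]] comp_Id[OF at_wsum_Hom[OF B p g b]] comp_Id[OF psh_Hom[OF p a]] a
  by auto

lemma wsum_presheaves:
  assumes B: "qcategory Q B" and p: "p \<in> presheaves Q A" and g: "psh_family A B g"
  shows "wsum A B p g \<in> presheaves Q B"
proof -
  let ?s = "\<lambda>b. \<Squnion>\<^bsub>Hom_lattice Q (fst p) (tp B b)\<^esub> ((\<lambda>a. at (g a) b \<cdot> at p a) ` objs A)"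
  have s: "at (wsum A B p g) b = ?s b" if "b \<in> objs B" for b
    using that by (simp add: wsum_def)
  have "is_psh B (fst p) ?s"
    unfolding is_psh_def
  proof (intro conjI ballI)
    show "fst p \<in> Ob Q" by (rule psh_Ob[OF p])
    show "?s b \<in> Hom Q (fst p) (tp B b)" if "b \<in> objs B" for b
      using at_wsum_Hom[OF B p g that] s[OF that] by simp
    fix b' b assume b': "b' \<in> objs B" and b: "b \<in> objs B"
    note H = qcat_Hom[OF B b' b] and Hs = at_wsum_Hom[OF B p g b']
    have "hom B (b', b) \<cdot> (at (g a) b \<cdot> at p a) \<preceq> at (wsum A B p g) b'" if a: "a \<in> objs A" for a
    proof -
      note pa = psh_Hom[OF p a]
      have ga: "g a \<in> presheaves Q B" "fst (g a) = tp A a" using g a by (auto simp: psh_family_def)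
      have Hb: "at (g a) b \<in> Hom Q (tp A a) (tp B b)" and Hb': "at (g a) b' \<in> Hom Q (tp A a) (tp B b')"
        using psh_Hom[OF ga(1)] ga(2) b b' by auto
      have "hom B (b', b) \<cdot> at (g a) b \<cdot> at p a \<preceq> at (g a) b' \<cdot> at p a"
        by (rule comp_mono_left[OF is_pshD(3)[OF is_psh_at[OF ga(1)] b' b] comp_Hom[OF Hb H] Hb' pa])
      then have "hom B (b', b) \<cdot> at (g a) b \<cdot> at p a \<preceq> at (wsum A B p g) b'"
        by (rule leq_trans[OF _ at_wsum_upper[OF B p g b' a] comp_Hom[OF pa comp_Hom[OF Hb H]] comp_Hom[OF pa Hb'] Hs])
      then show ?thesis by (simp only: comp_assoc[OF pa Hb H])
    qed
    then show "hom B (b', b) \<cdot> ?s b \<preceq> ?s b'"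
      using comp_Sup_le_iff[OF psh_Ob[OF p] _ H Hs, of "(\<lambda>a. at (g a) b \<cdot> at p a) ` objs A"]
        wsum_term_Hom[OF p g _ b] s[OF b'] by auto
  qed
  then show ?thesis unfolding wsum_def by (rule mk_psh_presheaves)
qed

text \<open>By residuation, lying below either side means the same doubly indexed family of
  inequalities; just the quantifiers over \<open>A\<close> and \<open>B\<close> change
  places.\<close>

lemma psh_res_wsum:
  assumes B: "qcategory Q B" and p: "p \<in> presheaves Q A" and g: "psh_family A B g" and r: "is_psh B X r"
  shows "psh_res B X (wsum A B p g) r = psh_res A X p (\<lambda>a. psh_res B X (g a) r)"
proof (rule eq_if_same_lower_bounds)
  note X = is_pshD(1)[OF r] and r' = is_pshD(2)[OF r] and W = wsum_presheaves[OF B p g]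
  have ga: "g a \<in> presheaves Q B" "fst (g a) = tp A a" if "a \<in> objs A" for a
    using g that by (auto simp: psh_family_def)
  have R: "psh_res B X (g a) r \<in> Hom Q X (tp A a)" if "a \<in> objs A" for a
    using psh_res_Hom[OF ga(1)[OF that] X] ga(2)[OF that] by simp
  show "psh_res B X (wsum A B p g) r \<in> Hom Q X (fst p)"
    using psh_res_Hom[OF W X] by simp
  show "psh_res A X p (\<lambda>a. psh_res B X (g a) r) \<in> Hom Q X (fst p)"
    by (rule psh_res_Hom[OF p X])
  fix h assume h: "h \<in> Hom Q X (fst p)"
  have "h \<preceq> psh_res B X (wsum A B p g) r \<longleftrightarrow> (\<forall>b\<in>objs B. at (wsum A B p g) b \<cdot> h \<preceq> r b)"
    using le_psh_res_iff[OF W r'] h by simp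
  also have "\<dots> \<longleftrightarrow> (\<forall>b\<in>objs B. \<forall>a\<in>objs A. at (g a) b \<cdot> (at p a \<cdot> h) \<preceq> r b)"
    using at_wsum_comp_le_iff[OF B p g _ h r'] by simp
  also have "\<dots> \<longleftrightarrow> (\<forall>a\<in>objs A. at p a \<cdot> h \<preceq> psh_res B X (g a) r)"
    using le_psh_res_iff[OF ga(1) r'] comp_Hom[OF h psh_Hom[OF p]] ga(2) by auto
  also have "\<dots> \<longleftrightarrow> h \<preceq> psh_res A X p (\<lambda>a. psh_res B X (g a) r)"
    using le_psh_res_iff[OF p R h] by simp
  finally show "h \<preceq> psh_res B X (wsum A B p g) r \<longleftrightarrow> h \<preceq> psh_res A X p (\<lambda>a. psh_res B X (g a) r)" .
qed

text \<open>The common source of functoriality for \<open>C_map\<close> and \<open>mult\<close>. The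
  previous rule reduces it to q(a) \<le> [g(a), colim(q, g)], that is, to the terms lying below
  their supremum.\<close>

lemma wsum_mono:
  assumes B: "qcategory Q B" and p: "p \<in> presheaves Q A" and q: "q \<in> presheaves Q A" and g: "psh_family A B g"
  shows "psh_res A (fst q) p (at q) \<preceq> psh_res B (fst q) (wsum A B p g) (at (wsum A B q g))"
proof -
  note W = wsum_presheaves[OF B q g] and X = psh_Ob[OF q]
  have W': "is_psh B (fst q) (at (wsum A B q g))" using is_psh_at[OF W] by simp
  have ga: "g a \<in> presheaves Q B" "fst (g a) = tp A a" if "a \<in> objs A" for a
    using g that by (auto simp: psh_family_def)
  show ?thesis
    unfolding psh_res_wsum[OF B p g W']
  proof (rule psh_res_mono[OF p X psh_Hom[OF q]])
    fix a assume a: "a \<in> objs A"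
    show "psh_res B (fst q) (g a) (at (wsum A B q g)) \<in> Hom Q (fst q) (tp A a)"
      using psh_res_Hom[OF ga(1)[OF a] X] ga(2)[OF a] by simp
    show "at q a \<preceq> psh_res B (fst q) (g a) (at (wsum A B q g))"
      using le_psh_res_iff[OF ga(1)[OF a] is_pshD(2)[OF W']] psh_Hom[OF q a] ga(2)[OF a]
        at_wsum_upper[OF B q g _ a] by simp
  qed
qed

section \<open>Pushing weights along a functor\<close>

text \<open>\<open>push A B F p\<close> is \<open>B(-,F-) \<otimes> p\<close> (see \<open>push_eq\<close>), as a weighted sum of representables.\<close>

definition push :: "('v::set_universe, 'o, 'm) qcat \<Rightarrow> ('v, 'o, 'm) qcat \<Rightarrow> ('v \<Rightarrow> 'v) \<Rightarrow>
    ('v, 'o, 'm) psh \<Rightarrow> ('v, 'o, 'm) psh"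
  where "push A B F p = wsum A B p (\<lambda>a. representable B (F a))"

lemma fst_push [simp]: "fst (push A B F p) = fst p"
  by (simp add: push_def)

lemma push_eq:
  "(fst p, dist_comp Q (star Q (fst p)) A B (lower_star A B F) (snd p)) = push A B F p"
  by (auto simp: push_def wsum_def mk_psh_def dist_comp_def lower_star_def representable_def restrict_def fun_eq_iff
      intro!: arg_cong[of _ _ "\<lambda>S. \<Squnion>\<^bsub>Hom_lattice Q X Y\<^esub> S" for X Y] image_cong)

lemma psh_family_representable:
  assumes "qcategory Q B" "F \<in> functors Q A B"
  shows "psh_family A B (\<lambda>a. representable B (F a))"
  using representable_presheaves[OF assms(1) functor_dest(1)[OF assms(2)]] functor_dest(2)[OF assms(2)]
  by (simp add: psh_family_def) (simp add: representable_eq)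

lemma push_presheaves:
  assumes "qcategory Q B" "F \<in> functors Q A B" "p \<in> presheaves Q A"
  shows "push A B F p \<in> presheaves Q B"
  unfolding push_def by (rule wsum_presheaves[OF assms(1,3) psh_family_representable[OF assms(1,2)]])

text \<open>On representables the inner residual of \<open>psh_res_wsum\<close> collapses by the
  Yoneda rule.\<close>

lemma psh_res_push:
  assumes B: "qcategory Q B" and F: "F \<in> functors Q A B" and p: "p \<in> presheaves Q A" and r: "is_psh B X r"
  shows "psh_res B X (push A B F p) r = psh_res A X p (\<lambda>a. r (F a))"
  unfolding push_def psh_res_wsum[OF B p psh_family_representable[OF B F] r]
  by (rule psh_res_cong) (simp add: psh_res_representable[OF B _ r] functor_dest(1)[OF F])

lemma push_id:
  assumes "qcategory Q A" "p \<in> presheaves Q A"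
  shows "push A A (id_functor A) p = p"
proof (rule presheaf_eq_res[of _ A])
  show "psh_res A X (push A A (id_functor A) p) r = psh_res A X p r" if "is_psh A X r" for X r
    unfolding psh_res_push[OF assms(1) id_functor[OF assms(1)] assms(2) that]
    by (rule psh_res_cong) simp
qed (use assms in \<open>simp_all add: push_presheaves id_functor\<close>)

lemma push_compose:
  assumes A: "qcategory Q A" and B: "qcategory Q B" and C: "qcategory Q C"
    and F: "F \<in> functors Q A B" and G: "G \<in> functors Q B C" and p: "p \<in> presheaves Q A"
  shows "push A C (compose (objs A) G F) p = push B C G (push A B F p)"
proof (rule presheaf_eq_res[of _ C])
  note GF = compose_functor[OF A B C F G] and Fp = push_presheaves[OF B F p]
  show "push A C (compose (objs A) G F) p \<in> presheaves Q C"
    by (rule push_presheaves[OF C GF p])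
  show "push B C G (push A B F p) \<in> presheaves Q C"
    by (rule push_presheaves[OF C G Fp])
  fix X r assume r: "is_psh C X r"
  have "psh_res C X (push B C G (push A B F p)) r = psh_res B X (push A B F p) (\<lambda>b. r (G b))"
    by (rule psh_res_push[OF C G Fp r])
  also have "\<dots> = psh_res A X p (\<lambda>a. r (G (F a)))"
    by (rule psh_res_push[OF B F p is_psh_comp_functor[OF B C G r]])
  also have "\<dots> = psh_res C X (push A C (compose (objs A) G F) p) r"
    unfolding psh_res_push[OF C GF p r] by (rule psh_res_cong) (simp add: compose_def)
  finally show "psh_res C X (push A C (compose (objs A) G F) p) r = psh_res C X (push B C G (push A B F p)) r" ..
qed simp

text \<open>The unit of the adjunction between pushing along \<open>F\<close> and precomposing with
  \<open>F\<close>: 1 \<le> [push p, push p] = [p, (push p)F].\<close>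

lemma at_le_push:
  assumes B: "qcategory Q B" and F: "F \<in> functors Q A B" and p: "p \<in> presheaves Q A" and a: "a \<in> objs A"
  shows "at p a \<preceq> at (push A B F p) (F a)"
proof -
  note P = push_presheaves[OF B F p]
  have H: "at (push A B F p) (F a) \<in> Hom Q (fst p) (tp A a)" if "a \<in> objs A" for a
    using psh_Hom[OF P, of "F a"] functor_dest(1,2)[OF F that] by simp
  have "Id Q (fst p) \<preceq> psh_res B (fst p) (push A B F p) (at (push A B F p))"
    using Id_le_psh_res_iff[OF P, of "at (push A B F p)"] psh_Hom[OF P] leq_refl by auto
  moreover have "is_psh B (fst p) (at (push A B F p))" using is_psh_at[OF P] by simp
  ultimately show ?thesis
    using psh_res_push[OF B F p] Id_le_psh_res_iff[OF p H] a by simp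
qed

text \<open>Apart from reducing colimits to those of an identity, this identifies the multiplication
  (\<open>F\<close> an inclusion \<open>J\<close>) and handles preservation of colimits
  (\<open>G\<close> arbitrary).\<close>

lemma is_colim_push_iff:
  assumes A: "qcategory Q A" and B: "qcategory Q B" and C: "qcategory Q C"
    and F: "F \<in> functors Q A B" and G: "G \<in> functors Q B C" and p: "p \<in> presheaves Q A"
  shows "is_colim Q B C (push A B F p) G c \<longleftrightarrow> is_colim Q A C p (compose (objs A) G F) c"
proof -
  have "psh_res B (tp C d) (push A B F p) (\<lambda>b. hom C (G b, d)) =
      psh_res A (tp C d) p (\<lambda>a. hom C (compose (objs A) G F a, d))" if "d \<in> objs C" for d
    unfolding psh_res_push[OF B F p is_psh_functor[OF B C G that]]
    by (rule psh_res_cong) (simp add: compose_def)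
  then show ?thesis
    unfolding is_colim_iff[OF B C G push_presheaves[OF B F p]] is_colim_iff[OF A C compose_functor[OF A B C F G] p]
    by simp
qed

section \<open>Congruences, full subcategories and transport along isomorphisms\<close>

lemma wsum_cong: "(\<And>a. a \<in> objs A \<Longrightarrow> g a = g' a) \<Longrightarrow> wsum A B p g = wsum A B p g'"
  unfolding wsum_def by (simp cong: image_cong)

lemma compose_id_functor:
  assumes "F \<in> functors Q A B"
  shows "compose (objs A) (id_functor B) F = F" "compose (objs A) F (id_functor A) = F"
  by (rule extensionalityI[of _ "objs A"];
      use functor_dest(1,4)[OF assms] in \<open>simp add: compose_def\<close>)+

lemma is_psh_cong: "(\<And>a. a \<in> objs A \<Longrightarrow> r a = r' a) \<Longrightarrow> is_psh A X r = is_psh A X r'"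
  unfolding is_psh_def by simp

lemma qcategory_full_subcat:
  assumes "qcategory Q A" "S \<subseteq> objs A"
  shows "qcategory Q (full_subcat A S)"
proof -
  have "S \<in> range elts"
    using range_elts_subset[OF _ assms(2)] assms(1) by (simp add: qcategory_def)
  then show ?thesis
    using assms(1) assms(2)[THEN subsetD] unfolding qcategory_def full_subcat_def by auto
qed

lemma functor_iso_lower_iff:
  assumes B: "qcategory Q B" and F: "F \<in> functors Q A B" and G: "G \<in> functors Q A B"
  shows "functor_iso Q A B F G \<longleftrightarrow> (\<forall>a\<in>objs A. \<forall>b\<in>objs B. hom B (b, F a) = hom B (b, G a))"
proof -
  have "hom B (b, F a) \<preceq> hom B (b, G a) \<and> hom B (b, G a) \<preceq> hom B (b, F a) \<longleftrightarrow> hom B (b, F a) = hom B (b, G a)"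
    if "a \<in> objs A" "b \<in> objs B" for a b
    using leq_antisym[of "hom B (b, F a)" "hom B (b, G a)"] leq_refl functor_Hom(2)[OF F B that] functor_Hom(2)[OF G B that]
    by auto
  then show ?thesis
    unfolding functor_iso_def functor_le_def dist_le_def lower_star_def by auto
qed

text \<open>For the laws that hold as equalities of values. Since it speaks of values alone, the
  composites in a monad law need not first be shown to be functors.\<close>

lemma functor_iso_eqI:
  assumes "qcategory Q B" "\<And>a. a \<in> objs A \<Longrightarrow> F a = G a" "\<And>a. a \<in> objs A \<Longrightarrow> G a \<in> objs B"
  shows "functor_iso Q A B F G"
  using assms leq_refl[OF qcat_Hom[OF assms(1)]]
  by (simp add: functor_iso_def functor_le_def dist_le_def lower_star_def)

text \<open>Isomorphism of \<open>c\<close> and \<open>e\<close> amounts to 1 \<le> B(c, e) and 1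
  \<le> B(e, c), and a functor only enlarges hom-arrows.\<close>

lemma functor_preserves_iso:
  assumes B: "qcategory Q B" and B': "qcategory Q B'" and G: "G \<in> functors Q B B'"
    and c: "c \<in> objs B" and e: "e \<in> objs B" and t: "tp B c = tp B e"
    and iso: "\<And>b. b \<in> objs B \<Longrightarrow> hom B (c, b) = hom B (e, b)" and d: "d \<in> objs B'"
  shows "hom B' (G c, d) = hom B' (G e, d)"
proof -
  have le: "hom B' (G e, d) \<preceq> hom B' (G c, d)"
    if c: "c \<in> objs B" and e: "e \<in> objs B" and t: "tp B c = tp B e"
      and iso: "\<And>b. b \<in> objs B \<Longrightarrow> hom B (c, b) = hom B (e, b)" for c e
  proof -
    note G' = functor_dest[OF G]
    have "Id Q (tp B c) \<preceq> hom B (c, e)" using qcat_Id[OF B e] iso[OF e] t by simp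
    moreover have "Id Q (tp B c) \<in> Hom Q (tp B c) (tp B c)" by (rule Id_Hom[OF qcat_Ob[OF B c]])
    moreover have "hom B (c, e) \<in> Hom Q (tp B c) (tp B c)" using qcat_Hom[OF B c e] t by simp
    moreover have "hom B' (G c, G e) \<in> Hom Q (tp B c) (tp B c)"
      using qcat_Hom[OF B', of "G c" "G e"] G'(1,2) c e t by simp
    ultimately have "Id Q (tp B c) \<preceq> hom B' (G c, G e)"
      using leq_trans G'(3)[OF c e] by blast
    then show ?thesis
      using Id_le_hom_iff(2)[OF B', of "G c" "G e"] G'(1,2) c e t d by simp
  qed
  have "hom B' (G c, d) \<in> Hom Q (tp B' d) (tp B c)" "hom B' (G e, d) \<in> Hom Q (tp B' d) (tp B c)"
    using functor_Hom(1)[OF G B' c d] functor_Hom(1)[OF G B' e d] t by simp_all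
  then show ?thesis
    using leq_antisym le[OF c e t iso] le[OF e c t[symmetric] iso[symmetric]] by blast
qed

lemma is_colim_iso:
  assumes A: "qcategory Q A" and B: "qcategory Q B" and F: "F \<in> functors Q A B" and p: "p \<in> presheaves Q A"
    and c: "is_colim Q A B p F c" and d: "d \<in> objs B" "tp B d = tp B c" "\<And>b. b \<in> objs B \<Longrightarrow> hom B (d, b) = hom B (c, b)"
  shows "is_colim Q A B p F d"
  using c d unfolding is_colim_iff[OF A B F p] by simp

end

section \<open>The category of presheaves\<close>

text \<open>The token \<open>U\<close> ties the locale to one universe, whose type does not occur in
  \<open>Q\<close>.\<close>

locale small_quantaloid = quantaloid Q
  for Q :: "('o, 'm) quantaloid_data" (structure) +
  fixes U :: "'v::set_universe itself"
  assumes small_Ob: "small U (Ob Q)" and small_Arr: "small U (Arr Q)"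
begin

abbreviation qcat :: "('v, 'o, 'm) qcat \<Rightarrow> bool" where "qcat \<equiv> qcategory Q"

text \<open>Type and graph of a presheaf determine it and lie in a product built from small
  collections. This is where the smallness of the quantaloid enters.\<close>

lemma small_presheaves:
  assumes "qcat A"
  shows "small TYPE('v) (presheaves Q A)"
proof (rule small_inj_on)
  let ?f = "\<lambda>p. (fst p, (\<lambda>a. (a, at p a)) ` objs A)"
  have "small TYPE('v) (objs A)" using assms by (intro small_elts) (simp add: qcategory_def)
  \<comment> \<open>The value of \<open>small\<close> depends on the type of its token only, so
    unfolding exchanges \<open>U\<close> for the canonical token.\<close>
  moreover have "small TYPE('v) (Ob Q)" "small TYPE('v) (Arr Q)"
    using small_Ob small_Arr by (simp_all add: small_def)
  ultimately show "small TYPE('v) (Ob Q \<times> Pow (objs A \<times> Arr Q))"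
    by (intro small_Times small_Pow)
  show "inj_on ?f (presheaves Q A)"
  proof (rule inj_onI)
    fix p q assume "p \<in> presheaves Q A" "q \<in> presheaves Q A" "?f p = ?f q"
    then show "p = q" by (intro presheaf_eqI[of p A q]) auto
  qed
  show "?f ` presheaves Q A \<subseteq> Ob Q \<times> Pow (objs A \<times> Arr Q)"
  proof (rule image_subsetI)
    fix p assume p: "p \<in> presheaves Q A"
    have "(\<lambda>a. (a, at p a)) ` objs A \<subseteq> objs A \<times> Arr Q"
      using psh_Hom[OF p] by (auto simp: Hom_def)
    then show "?f p \<in> Ob Q \<times> Pow (objs A \<times> Arr Q)" using psh_Ob[OF p] by simp
  qed
qed

abbreviation obj :: "('v, 'o, 'm) qcat \<Rightarrow> ('v, 'o, 'm) psh \<Rightarrow> 'v" where "obj \<equiv> psh_obj Q"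
abbreviation psh :: "('v, 'o, 'm) qcat \<Rightarrow> 'v \<Rightarrow> ('v, 'o, 'm) psh" where "psh \<equiv> obj_psh Q"
abbreviation PP :: "('v, 'o, 'm) qcat \<Rightarrow> ('v, 'o, 'm) qcat" where "PP \<equiv> P_obj Q"

lemma obj_P: "p \<in> presheaves Q A \<Longrightarrow> obj A p \<in> objs (PP A)"
  by (simp add: P_obj_def)

lemma psh_obj_inverse: "qcat A \<Longrightarrow> p \<in> presheaves Q A \<Longrightarrow> psh A (obj A p) = p"
  unfolding obj_psh_def psh_obj_def by (rule the_inv_into_f_f) (auto intro: code small_presheaves)

lemma P_objE:
  assumes "qcat A" "u \<in> objs (PP A)"
  shows "psh A u \<in> presheaves Q A" "obj A (psh A u) = u"
  using assms by (auto simp: P_obj_def psh_obj_inverse)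

lemma tp_P: "u \<in> objs (PP A) \<Longrightarrow> tp (PP A) u = fst (psh A u)"
  by (simp add: P_obj_def)

lemma hom_P:
  assumes "qcat A" "u \<in> objs (PP A)" "v \<in> objs (PP A)"
  shows "hom (PP A) (u, v) = psh_res A (fst (psh A v)) (psh A u) (at (psh A v))"
proof -
  have "hom (PP A) (u, v) = psh_hom Q A (psh A u) (psh A v)"
    using assms by (auto simp: P_obj_def)
  then show ?thesis using assms by (simp add: psh_hom_eq P_objE)
qed

lemma le_hom_P_iff:
  assumes A: "qcat A" and uv: "u \<in> objs (PP A)" "v \<in> objs (PP A)" and h: "h \<in> Hom Q (fst (psh A v)) (fst (psh A u))"
  shows "h \<preceq> hom (PP A) (u, v) \<longleftrightarrow> (\<forall>a\<in>objs A. at (psh A u) a \<cdot> h \<preceq> at (psh A v) a)"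
  unfolding hom_P[OF A uv] by (rule le_psh_res_iff[OF P_objE(1)[OF A uv(1)] psh_Hom[OF P_objE(1)[OF A uv(2)]] h])

lemma Id_le_hom_P_iff:
  assumes A: "qcat A" and uv: "u \<in> objs (PP A)" "v \<in> objs (PP A)" and t: "fst (psh A u) = fst (psh A v)"
  shows "Id Q (fst (psh A u)) \<preceq> hom (PP A) (u, v) \<longleftrightarrow> (\<forall>a\<in>objs A. at (psh A u) a \<preceq> at (psh A v) a)"
proof -
  note p = P_objE(1)[OF A uv(1)]
  show ?thesis
    using le_hom_P_iff[OF A uv, of "Id Q (fst (psh A u))"] t Id_Hom[OF psh_Ob[OF p]] comp_Id[OF psh_Hom[OF p]]
    by simp
qed

lemma qcategory_P:
  assumes A: "qcat A"
  shows "qcat (PP A)"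
proof -
  note P = P_objE(1)[OF A]
  have Hom_P: "hom (PP A) (u, v) \<in> Hom Q (fst (psh A v)) (fst (psh A u))"
    if "u \<in> objs (PP A)" "v \<in> objs (PP A)" for u v
    unfolding hom_P[OF A that] by (rule psh_res_Hom[OF P[OF that(1)] psh_Ob[OF P[OF that(2)]]])
  have counit: "at (psh A u) a \<cdot> hom (PP A) (u, v) \<preceq> at (psh A v) a"
    if "u \<in> objs (PP A)" "v \<in> objs (PP A)" "a \<in> objs A" for u v a
    using le_hom_P_iff[OF A that(1,2) Hom_P[OF that(1,2)]] leq_refl[OF Hom_P[OF that(1,2)]] that(3) by blast
  show ?thesis
    unfolding qcategory_def
  proof (intro conjI ballI)
    show "objs (PP A) \<in> range elts"
      using code(2)[OF small_presheaves[OF A]] by (simp add: P_obj_def psh_obj_def)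
    show "tp (PP A) \<in> objs (PP A) \<rightarrow>\<^sub>E Ob Q"
      using psh_Ob[OF P] by (auto simp: P_obj_def)
    show "hom (PP A) \<in> extensional (objs (PP A) \<times> objs (PP A))"
      by (simp add: P_obj_def)
    fix u assume u: "u \<in> objs (PP A)"
    show "Id Q (tp (PP A) u) \<preceq> hom (PP A) (u, u)"
      using Id_le_hom_P_iff[OF A u u] leq_refl[OF psh_Hom[OF P[OF u]]] tp_P[OF u] by simp
    fix v assume v: "v \<in> objs (PP A)"
    show "hom (PP A) (u, v) \<in> Hom Q (tp (PP A) v) (tp (PP A) u)"
      using Hom_P[OF u v] tp_P u v by simp
    fix w assume w: "w \<in> objs (PP A)"
    \<comment> \<open>By residuation the composition law only asks for the counit inequality to be
      applied twice, first at \<open>u\<close> and then at \<open>v\<close>.\<close>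
    have "at (psh A u) a \<cdot> (hom (PP A) (u, v) \<cdot> hom (PP A) (v, w)) \<preceq> at (psh A w) a" if a: "a \<in> objs A" for a
    proof -
      note Hu = psh_Hom[OF P[OF u] a] and Hv = psh_Hom[OF P[OF v] a] and Hw = psh_Hom[OF P[OF w] a]
      have "at (psh A u) a \<cdot> hom (PP A) (u, v) \<cdot> hom (PP A) (v, w) \<preceq> at (psh A v) a \<cdot> hom (PP A) (v, w)"
        by (rule comp_mono_left[OF counit[OF u v a] comp_Hom[OF Hom_P[OF u v] Hu] Hv Hom_P[OF v w]])
      then have "at (psh A u) a \<cdot> hom (PP A) (u, v) \<cdot> hom (PP A) (v, w) \<preceq> at (psh A w) a"
        by (rule leq_trans[OF _ counit[OF v w a] comp_Hom[OF Hom_P[OF v w] comp_Hom[OF Hom_P[OF u v] Hu]]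
            comp_Hom[OF Hom_P[OF v w] Hv] Hw])
      then show ?thesis by (simp only: comp_assoc[OF Hom_P[OF v w] Hom_P[OF u v] Hu])
    qed
    then show "hom (PP A) (u, v) \<cdot> hom (PP A) (v, w) \<preceq> hom (PP A) (u, w)"
      using le_hom_P_iff[OF A u w comp_Hom[OF Hom_P[OF v w] Hom_P[OF u v]]] by blast
  qed
qed

text \<open>Bundling \<open>r\<close> into an object of \<P>(A) turns residuals of \<open>u\<close>
  into hom-arrows out of \<open>u\<close>, so facts about one transfer to the other.\<close>

lemma hom_P_mk_psh:
  assumes A: "qcat A" and u: "u \<in> objs (PP A)" and r: "is_psh A X r"
  shows "hom (PP A) (u, obj A (mk_psh A X r)) = psh_res A X (psh A u) r"
  unfolding hom_P[OF A u obj_P[OF mk_psh_presheaves[OF r]]] psh_obj_inverse[OF A mk_psh_presheaves[OF r]] fst_mk_psh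
  by (rule psh_res_cong) simp

text \<open>The family is \<P>(B)(G-, d), where \<open>d\<close> is the object that bundles
  \<open>r\<close>; such families satisfy the action law for any functor \<open>G\<close>.\<close>

lemma is_psh_psh_res:
  assumes A: "qcat A" and B: "qcat B" and G: "G \<in> functors Q A (PP B)" and r: "is_psh B X r"
  shows "is_psh A X (\<lambda>a. psh_res B X (psh B (G a)) r)"
proof -
  let ?d = "obj B (mk_psh B X r)"
  have d: "?d \<in> objs (PP B)" by (rule obj_P[OF mk_psh_presheaves[OF r]])
  have "tp (PP B) ?d = X"
    using tp_P[OF d] psh_obj_inverse[OF B mk_psh_presheaves[OF r]] by simp
  then have "is_psh A X (\<lambda>a. hom (PP B) (G a, ?d))"
    using is_psh_functor[OF A qcategory_P[OF B] G d] by simp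
  then show ?thesis
    by (rule iffD1[OF is_psh_cong, rotated]) (rule hom_P_mk_psh[OF B functor_dest(1)[OF G] r])
qed

text \<open>The category of presheaves is skeletal: its hom-arrows out of an object already comprise
  all residuals of that presheaf.\<close>

lemma P_obj_eqI:
  assumes A: "qcat A" and u: "u \<in> objs (PP A)" and v: "v \<in> objs (PP A)"
    and t: "tp (PP A) u = tp (PP A) v" and h: "\<And>d. d \<in> objs (PP A) \<Longrightarrow> hom (PP A) (u, d) = hom (PP A) (v, d)"
  shows "u = v"
proof -
  have "psh A u = psh A v"
  proof (rule presheaf_eq_res[OF P_objE(1)[OF A u] P_objE(1)[OF A v]])
    show "fst (psh A u) = fst (psh A v)" using t tp_P[OF u] tp_P[OF v] by simp
    show "psh_res A X (psh A u) r = psh_res A X (psh A v) r" if "is_psh A X r" for X r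
      using h[OF obj_P[OF mk_psh_presheaves[OF that]]]
      unfolding hom_P_mk_psh[OF A u that] hom_P_mk_psh[OF A v that] .
  qed
  from arg_cong[OF this, of "obj A"] show ?thesis
    unfolding P_objE(2)[OF A u] P_objE(2)[OF A v] .
qed

section \<open>Existence and strict uniqueness of colimits of presheaves\<close>

lemma psh_family_functor:
  assumes "qcat A" "qcat B" "G \<in> functors Q A (PP B)"
  shows "psh_family A B (\<lambda>a. psh B (G a))"
  unfolding psh_family_def
proof (intro ballI conjI)
  fix a assume "a \<in> objs A"
  note G = functor_dest(1,2)[OF assms(3) this]
  show "psh B (G a) \<in> presheaves Q B" by (rule P_objE(1)[OF assms(2) G(1)])
  show "fst (psh B (G a)) = tp A a" using tp_P[OF G(1)] G(2) by simp
qed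

lemma is_colim_wsum:
  assumes A: "qcat A" and B: "qcat B" and G: "G \<in> functors Q A (PP B)" and p: "p \<in> presheaves Q A"
  shows "is_colim Q A (PP B) p G (obj B (wsum A B p (\<lambda>a. psh B (G a))))"
  unfolding is_colim_iff[OF A qcategory_P[OF B] G p]
proof (intro conjI ballI)
  let ?w = "wsum A B p (\<lambda>a. psh B (G a))"
  note fam = psh_family_functor[OF A B G]
  note W = wsum_presheaves[OF B p fam]
  show c: "obj B ?w \<in> objs (PP B)" by (rule obj_P[OF W])
  show "tp (PP B) (obj B ?w) = fst p" unfolding tp_P[OF c] psh_obj_inverse[OF B W] by simp
  fix d assume d: "d \<in> objs (PP B)"
  have "hom (PP B) (obj B ?w, d) = psh_res B (tp (PP B) d) ?w (at (psh B d))"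
    unfolding hom_P[OF B c d] psh_obj_inverse[OF B W] tp_P[OF d] ..
  also have "\<dots> = psh_res A (tp (PP B) d) p (\<lambda>a. psh_res B (tp (PP B) d) (psh B (G a)) (at (psh B d)))"
    unfolding tp_P[OF d] by (rule psh_res_wsum[OF B p fam is_psh_at[OF P_objE(1)[OF B d]]])
  also have "\<dots> = psh_res A (tp (PP B) d) p (\<lambda>a. hom (PP B) (G a, d))"
    by (rule psh_res_cong) (simp add: hom_P[OF B functor_dest(1)[OF G] d] tp_P[OF d])
  finally show "hom (PP B) (obj B ?w, d) = psh_res A (tp (PP B) d) p (\<lambda>a. hom (PP B) (G a, d))" .
qed

text \<open>Two colimits have the same arrows out of them, which in a skeletal category leaves one
  object. Hence the choice inside \<open>colim\<close> has a single candidate.\<close>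

lemma is_colim_P_iff:
  assumes A: "qcat A" and B: "qcat B" and G: "G \<in> functors Q A (PP B)" and p: "p \<in> presheaves Q A"
  shows "is_colim Q A (PP B) p G c \<longleftrightarrow> c = obj B (wsum A B p (\<lambda>a. psh B (G a)))"
proof
  note w = is_colim_wsum[OF A B G p]
  note iff = is_colim_iff[OF A qcategory_P[OF B] G p]
  assume "is_colim Q A (PP B) p G c"
  with w show "c = obj B (wsum A B p (\<lambda>a. psh B (G a)))"
    unfolding iff by (intro P_obj_eqI[OF B]) simp_all
qed (simp add: is_colim_wsum[OF A B G p])

lemma colim_P_eq:
  assumes "qcat A" "qcat B" "G \<in> functors Q A (PP B)" "p \<in> presheaves Q A"
  shows "colim Q A (PP B) p G = obj B (wsum A B p (\<lambda>a. psh B (G a)))"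
  unfolding colim_def is_colim_P_iff[OF assms] by (rule some_eq_trivial)

lemma P_map_apply:
  assumes A: "qcat A" and u: "u \<in> objs (PP A)"
  shows "P_map Q A B F u = obj B (push A B F (psh A u))"
  using u push_eq[of "psh A u" A B F] by (simp add: P_map_def Let_def case_prod_beta)

lemma Yoneda_functor:
  assumes A: "qcat A"
  shows "Yoneda Q A \<in> functors Q A (PP A)"
proof -
  have Y: "Yoneda Q A a = obj A (representable A a)" if "a \<in> objs A" for a
    using that by (simp add: Yoneda_def)
  note R = representable_presheaves[OF A] and inv = psh_obj_inverse[OF A R]
  have "tp (PP A) (Yoneda Q A a) = tp A a" if "a \<in> objs A" for a
    using that tp_P[OF obj_P[OF R[OF that]]] inv[OF that] by (simp add: Y representable_eq)
  moreover have "hom (PP A) (Yoneda Q A a', Yoneda Q A a) = hom A (a', a)" if a: "a' \<in> objs A" "a \<in> objs A" for a' a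
  proof -
    have "is_psh A (tp A a) (\<lambda>a'. hom A (a', a))" by (rule is_psh_representable[OF A a(2)])
    from hom_P_mk_psh[OF A obj_P[OF R[OF a(1)]] this] psh_res_representable[OF A a(1) this]
    show ?thesis using a by (simp add: Y inv flip: representable_eq)
  qed
  ultimately show ?thesis
    using obj_P[OF R] leq_refl[OF qcat_Hom[OF A]]
    unfolding functors_def mem_Collect_eq by (intro conjI ballI PiE_I) (simp_all add: Y, simp add: Yoneda_def)
qed

lemma functor_iso_P_eq:
  assumes B: "qcat B" and F: "F \<in> functors Q A (PP B)" and G: "G \<in> functors Q A (PP B)"
    and iso: "functor_iso Q A (PP B) F G" and a: "a \<in> objs A"
  shows "F a = G a"
  using iso a functor_dest(1,2)[OF F a] functor_dest(1,2)[OF G a]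
  unfolding functor_iso_iff[OF qcategory_P[OF B] F G] by (intro P_obj_eqI[OF B]) simp_all

end

section \<open>Saturated classes\<close>

locale saturated_class = small_quantaloid Q U
  for Q :: "('o, 'm) quantaloid_data" (structure) and U :: "'v::set_universe itself" +
  fixes C :: "('v, 'o, 'm) psh_class"
  assumes class_presheaf: "presheaf_class Q C" and class_saturated: "saturated Q C"
begin

abbreviation CC :: "('v, 'o, 'm) qcat \<Rightarrow> ('v, 'o, 'm) qcat" where "CC \<equiv> C_obj Q C"

lemma class_presheaves: "qcat A \<Longrightarrow> p \<in> C A \<Longrightarrow> p \<in> presheaves Q A"
  using class_presheaf by (auto simp: presheaf_class_def)

lemma representable_class: "qcat A \<Longrightarrow> a \<in> objs A \<Longrightarrow> representable A a \<in> C A"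
  using class_saturated by (auto simp: saturated_def)

text \<open>The second saturation condition, with the chosen colimit replaced by its
  formula.\<close>

lemma wsum_class:
  assumes A: "qcat A" and B: "qcat B" and p: "p \<in> C A" and G: "G \<in> functors Q A (PP B)"
    and GC: "\<And>a. a \<in> objs A \<Longrightarrow> psh B (G a) \<in> C B"
  shows "wsum A B p (\<lambda>a. psh B (G a)) \<in> C B"
proof -
  note p' = class_presheaves[OF A p]
  have "psh B (colim Q A (PP B) p G) \<in> C B"
    using class_saturated assms unfolding saturated_def by blast
  then show ?thesis
    unfolding colim_P_eq[OF A B G p'] psh_obj_inverse[OF B wsum_presheaves[OF B p' psh_family_functor[OF A B G]]] .
qed

text \<open>A pushed weight is a colimit of representables, so the two saturation conditions
  together give the closure.\<close>

lemma push_class: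
  assumes A: "qcat A" and B: "qcat B" and F: "F \<in> functors Q A B" and p: "p \<in> C A"
  shows "push A B F p \<in> C B"
proof -
  let ?G = "compose (objs A) (Yoneda Q B) F"
  have G: "psh B (?G a) = representable B (F a)" if "a \<in> objs A" for a
    using functor_dest(1)[OF F that] that psh_obj_inverse[OF B representable_presheaves[OF B]]
    by (simp add: compose_def Yoneda_def)
  have "wsum A B p (\<lambda>a. psh B (?G a)) \<in> C B"
  proof (rule wsum_class[OF A B p compose_functor[OF A B qcategory_P[OF B] F Yoneda_functor[OF B]]])
    show "psh B (?G a) \<in> C B" if "a \<in> objs A" for a
      unfolding G[OF that] by (rule representable_class[OF B functor_dest(1)[OF F that]])
  qed
  then show ?thesis unfolding push_def using G by (simp cong: wsum_cong)
qed

lemma C_obj_subset: "qcat A \<Longrightarrow> objs (CC A) \<subseteq> objs (PP A)"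
  using class_presheaves obj_P by (auto simp: C_obj_def full_subcat_def)

lemma C_objD:
  assumes A: "qcat A" and u: "u \<in> objs (CC A)"
  shows "u \<in> objs (PP A)" "psh A u \<in> C A" "psh A u \<in> presheaves Q A" "obj A (psh A u) = u"
proof -
  show P: "u \<in> objs (PP A)" using C_obj_subset[OF A] u by blast
  show "psh A u \<in> presheaves Q A" "obj A (psh A u) = u" by (rule P_objE[OF A P])+
  show "psh A u \<in> C A"
    using u psh_obj_inverse[OF A class_presheaves[OF A]] by (auto simp: C_obj_def full_subcat_def)
qed

lemma obj_C: "p \<in> C A \<Longrightarrow> obj A p \<in> objs (CC A)"
  by (simp add: C_obj_def full_subcat_def)

lemma tp_C_P: "u \<in> objs (CC A) \<Longrightarrow> tp (CC A) u = tp (PP A) u"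
  by (simp add: C_obj_def full_subcat_def)

lemma hom_C_P: "u \<in> objs (CC A) \<Longrightarrow> v \<in> objs (CC A) \<Longrightarrow> hom (CC A) (u, v) = hom (PP A) (u, v)"
  by (simp add: C_obj_def full_subcat_def)

lemma tp_C: "qcat A \<Longrightarrow> u \<in> objs (CC A) \<Longrightarrow> tp (CC A) u = fst (psh A u)"
  using tp_C_P tp_P C_objD(1) by simp

lemma hom_C:
  "qcat A \<Longrightarrow> u \<in> objs (CC A) \<Longrightarrow> v \<in> objs (CC A) \<Longrightarrow>
    hom (CC A) (u, v) = psh_res A (fst (psh A v)) (psh A u) (at (psh A v))"
  using hom_C_P hom_P C_objD(1) by simp

lemma qcategory_C: "qcat A \<Longrightarrow> qcat (CC A)"
  using qcategory_full_subcat[OF qcategory_P C_obj_subset] by (simp add: C_obj_def full_subcat_def)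

lemma J_functor:
  assumes A: "qcat A"
  shows "J Q C A \<in> functors Q (CC A) (PP A)"
  using C_objD(1)[OF A] leq_refl[OF qcat_Hom[OF qcategory_P[OF A]]]
  unfolding functors_def by (auto simp: J_def tp_C_P hom_C_P)

lemma C_map_apply:
  "qcat A \<Longrightarrow> u \<in> objs (CC A) \<Longrightarrow> C_map Q C A B F u = obj B (push A B F (psh A u))"
  using P_map_apply[OF _ C_objD(1)] by (simp add: C_map_def)

lemma C_obj_eqI:
  assumes A: "qcat A" and u: "u \<in> objs (CC A)" and v: "v \<in> objs (CC A)"
    and t: "fst (psh A u) = fst (psh A v)" and eq: "\<And>X r. is_psh A X r \<Longrightarrow> psh_res A X (psh A u) r = psh_res A X (psh A v) r"
  shows "u = v"
  using arg_cong[OF presheaf_eq_res[OF C_objD(3)[OF A u] C_objD(3)[OF A v] t eq], of "obj A"]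
  unfolding C_objD(4)[OF A u] C_objD(4)[OF A v] .

section \<open>Multiplication, action on functors and unit\<close>

lemma psh_family_C:
  assumes A: "qcat A"
  shows "psh_family (CC A) A (psh A)"
  using C_objD(3)[OF A] tp_C[OF A] by (simp add: psh_family_def)

lemma is_psh_C:
  assumes A: "qcat A" and r: "is_psh A X r"
  shows "is_psh (CC A) X (\<lambda>u. psh_res A X (psh A u) r)"
  using is_psh_psh_res[OF qcategory_C[OF A] A J_functor[OF A] r]
  by (rule iffD1[OF is_psh_cong, rotated]) (simp add: J_def)

text \<open>The formula for the colimit of \<open>J Q C A\<close> weighted by \<Theta>. It avoids
  iterated presheaf categories; \<open>P_mult_J\<close> compares it with the multiplication of the
  presheaf monad.\<close>

definition mult :: "('v, 'o, 'm) qcat \<Rightarrow> 'v \<Rightarrow> 'v"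
  where "mult A = (\<lambda>\<Theta>\<in>objs (CC (CC A)). obj A (wsum (CC A) A (psh (CC A) \<Theta>) (psh A)))"

lemma mult:
  assumes A: "qcat A" and \<Theta>: "\<Theta> \<in> objs (CC (CC A))"
  shows "mult A \<Theta> \<in> objs (CC A)" "psh A (mult A \<Theta>) = wsum (CC A) A (psh (CC A) \<Theta>) (psh A)"
proof -
  note \<Theta>' = C_objD[OF qcategory_C[OF A] \<Theta>]
  have "wsum (CC A) A (psh (CC A) \<Theta>) (\<lambda>u. psh A (J Q C A u)) \<in> C A"
    by (rule wsum_class[OF qcategory_C[OF A] A \<Theta>'(2) J_functor[OF A]]) (simp add: J_def C_objD(2)[OF A])
  then have "wsum (CC A) A (psh (CC A) \<Theta>) (psh A) \<in> C A"
    by (simp add: J_def cong: wsum_cong)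
  then show "mult A \<Theta> \<in> objs (CC A)" "psh A (mult A \<Theta>) = wsum (CC A) A (psh (CC A) \<Theta>) (psh A)"
    using obj_C psh_obj_inverse[OF A class_presheaves[OF A]] \<Theta> by (simp_all add: mult_def)
qed

lemma psh_res_mult:
  assumes A: "qcat A" and \<Theta>: "\<Theta> \<in> objs (CC (CC A))" and r: "is_psh A X r"
  shows "psh_res A X (psh A (mult A \<Theta>)) r = psh_res (CC A) X (psh (CC A) \<Theta>) (\<lambda>u. psh_res A X (psh A u) r)"
  unfolding mult(2)[OF A \<Theta>]
  by (rule psh_res_wsum[OF A C_objD(3)[OF qcategory_C[OF A] \<Theta>] psh_family_C[OF A] r])

lemma mult_functor:
  assumes A: "qcat A"
  shows "mult A \<in> functors Q (CC (CC A)) (CC A)"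
proof -
  note A' = qcategory_C[OF A]
  have "hom (CC (CC A)) (\<Theta>, \<Xi>) \<preceq> hom (CC A) (mult A \<Theta>, mult A \<Xi>)"
    if "\<Theta> \<in> objs (CC (CC A))" "\<Xi> \<in> objs (CC (CC A))" for \<Theta> \<Xi>
    using wsum_mono[OF A C_objD(3)[OF A' that(1)] C_objD(3)[OF A' that(2)] psh_family_C[OF A]] that
    by (simp add: hom_C[OF A] hom_C[OF A'] mult[OF A])
  then show ?thesis
    using mult[OF A] tp_C[OF A] tp_C[OF A'] unfolding functors_def by (auto simp: PiE_iff) (simp add: mult_def)
qed

lemma C_map:
  assumes A: "qcat A" and B: "qcat B" and F: "F \<in> functors Q A B" and u: "u \<in> objs (CC A)"
  shows "C_map Q C A B F u \<in> objs (CC B)" "psh B (C_map Q C A B F u) = push A B F (psh A u)"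
  using C_map_apply[OF A u] obj_C push_class[OF A B F C_objD(2)[OF A u]]
    psh_obj_inverse[OF B push_presheaves[OF B F C_objD(3)[OF A u]]]
  by simp_all

lemma psh_res_C_map:
  assumes A: "qcat A" and B: "qcat B" and F: "F \<in> functors Q A B" and u: "u \<in> objs (CC A)" and r: "is_psh B X r"
  shows "psh_res B X (psh B (C_map Q C A B F u)) r = psh_res A X (psh A u) (\<lambda>a. r (F a))"
  unfolding C_map(2)[OF A B F u] by (rule psh_res_push[OF B F C_objD(3)[OF A u] r])

lemma C_map_functor:
  assumes A: "qcat A" and B: "qcat B" and F: "F \<in> functors Q A B"
  shows "C_map Q C A B F \<in> functors Q (CC A) (CC B)"
proof -
  note CF = C_map[OF A B F]
  have "hom (CC A) (u, v) \<preceq> hom (CC B) (C_map Q C A B F u, C_map Q C A B F v)"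
    if "u \<in> objs (CC A)" "v \<in> objs (CC A)" for u v
    using wsum_mono[OF B C_objD(3)[OF A that(1)] C_objD(3)[OF A that(2)] psh_family_representable[OF B F]] that
    by (simp add: hom_C[OF A] hom_C[OF B] CF push_def)
  then show ?thesis
    using CF tp_C[OF A] tp_C[OF B] unfolding functors_def by (auto simp: PiE_iff) (simp add: C_map_def)
qed

lemma Yoneda_C:
  assumes A: "qcat A" and a: "a \<in> objs A"
  shows "Yoneda Q A a \<in> objs (CC A)" "psh A (Yoneda Q A a) = representable A a"
  using a obj_C[OF representable_class[OF A a]] psh_obj_inverse[OF A representable_presheaves[OF A a]]
  by (simp_all add: Yoneda_def)

lemma Yoneda_C_functor:
  assumes A: "qcat A"
  shows "Yoneda Q A \<in> functors Q A (CC A)"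
  using functor_dest[OF Yoneda_functor[OF A]] Yoneda_C(1)[OF A]
  unfolding functors_def by (auto simp: PiE_iff tp_C_P hom_C_P)

lemma hom_Yoneda:
  assumes A: "qcat A" and a: "a \<in> objs A" and u: "u \<in> objs (CC A)"
  shows "hom (CC A) (Yoneda Q A a, u) = at (psh A u) a"
  unfolding hom_C[OF A Yoneda_C(1)[OF A a] u] Yoneda_C(2)[OF A a]
  by (rule psh_res_representable[OF A a is_psh_at[OF C_objD(3)[OF A u]]])

section \<open>The full sub-doctrine and its factorisations\<close>

lemma two_functor_C: "two_functor Q CC (C_map Q C)"
  unfolding two_functor_def
proof (intro conjI allI impI, (elim conjE)?)
  show "qcat A \<Longrightarrow> qcat (CC A)" for A by (rule qcategory_C)
  show "\<And>A B F. qcat A \<and> qcat B \<and> F \<in> functors Q A B \<Longrightarrow> C_map Q C A B F \<in> functors Q (CC A) (CC B)"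
    using C_map_functor by blast
  show "C_map Q C A A (id_functor A) = id_functor (CC A)" if A: "qcat A" for A
  proof (rule extensionalityI[of _ "objs (CC A)"])
    show "C_map Q C A A (id_functor A) u = id_functor (CC A) u" if u: "u \<in> objs (CC A)" for u
      using C_map_apply[OF A u] push_id[OF A C_objD(3)[OF A u]] C_objD(4)[OF A u] u by simp
  qed (simp_all add: C_map_def id_functor_def)
  fix A B :: "('v, 'o, 'm) qcat" and F G
  show "\<And>D. qcat A \<and> qcat B \<and> qcat D \<and> F \<in> functors Q A B \<and> G \<in> functors Q B D \<Longrightarrow>
      C_map Q C A D (compose (objs A) G F) = compose (objs (CC A)) (C_map Q C B D G) (C_map Q C A B F)"
  proof (elim conjE)
    fix D assume A: "qcat A" and B: "qcat B" and D: "qcat D" and F: "F \<in> functors Q A B" and G: "G \<in> functors Q B D"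
    show "C_map Q C A D (compose (objs A) G F) = compose (objs (CC A)) (C_map Q C B D G) (C_map Q C A B F)"
    proof (rule extensionalityI[of _ "objs (CC A)"])
      fix u assume u: "u \<in> objs (CC A)"
      show "C_map Q C A D (compose (objs A) G F) u = compose (objs (CC A)) (C_map Q C B D G) (C_map Q C A B F) u"
        using C_map_apply[OF A u] C_map_apply[OF B C_map(1)[OF A B F u]] C_map(2)[OF A B F u]
          push_compose[OF A B D F G C_objD(3)[OF A u]] u
        by (simp add: compose_def)
    qed (simp_all add: C_map_def compose_def)
  qed
  assume "qcat A \<and> qcat B \<and> F \<in> functors Q A B \<and> G \<in> functors Q A B \<and> functor_le Q A B F G"
  then have A: "qcat A" and B: "qcat B" and F: "F \<in> functors Q A B" and G: "G \<in> functors Q A B"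
    and FG: "functor_le Q A B F G" by blast+
  show "functor_le Q (CC A) (CC B) (C_map Q C A B F) (C_map Q C A B G)"
    unfolding functor_le_iff[OF qcategory_C[OF B] C_map_functor[OF A B F] C_map_functor[OF A B G]]
  proof
    fix u assume u: "u \<in> objs (CC A)"
    note u' = C_objD(3)[OF A u]
    note PG = push_presheaves[OF B G u']
    note F' = functor_dest[OF F] and G' = functor_dest[OF G]
    have PGF: "at (push A B G (psh A u)) (F a) \<in> Hom Q (fst (psh A u)) (tp A a)" if a: "a \<in> objs A" for a
      using psh_Hom[OF PG F'(1)[OF a]] F'(2)[OF a] by simp
    \<comment> \<open>The unit for \<open>G\<close> bounds p(a) by the value of its push-forward at
      \<open>G a\<close>. Presheaves are contravariant, so 1 \<le> B(Fa, Ga) carries this bound to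
      the value at \<open>F a\<close>, which is what the residual along \<open>F\<close> asks
      for.\<close>
    have le: "at (psh A u) a \<preceq> at (push A B G (psh A u)) (F a)" if a: "a \<in> objs A" for a
    proof -
      have H: "hom B (F a, G a) \<in> Hom Q (tp A a) (tp A a)"
        using qcat_Hom[OF B F'(1)[OF a] G'(1)[OF a]] F'(2)[OF a] G'(2)[OF a] by simp
      have s: "at (push A B G (psh A u)) (G a) \<in> Hom Q (fst (psh A u)) (tp A a)"
        using psh_Hom[OF PG G'(1)[OF a]] G'(2)[OF a] by simp
      have "Id Q (tp A a) \<preceq> hom B (F a, G a)"
        using FG a unfolding functor_le_iff[OF B F G] by blast
      then have "Id Q (tp A a) \<cdot> at (push A B G (psh A u)) (G a) \<preceq> hom B (F a, G a) \<cdot> at (push A B G (psh A u)) (G a)"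
        by (rule comp_mono_left[OF _ Id_Hom[OF qcat_Ob[OF A a]] H s])
      then have "at (push A B G (psh A u)) (G a) \<preceq> at (push A B G (psh A u)) (F a)"
        using leq_trans[OF _ is_pshD(3)[OF is_psh_at[OF PG] F'(1)[OF a] G'(1)[OF a]] s comp_Hom[OF s H] PGF[OF a]]
          Id_comp[OF s] by simp
      then show ?thesis
        by (rule leq_trans[OF at_le_push[OF B G u' a] _ psh_Hom[OF u' a] s PGF[OF a]])
    qed
    have "is_psh B (fst (psh A u)) (at (push A B G (psh A u)))" using is_psh_at[OF PG] by simp
    from psh_res_push[OF B F u' this] have "hom (CC B) (C_map Q C A B F u, C_map Q C A B G u) =
        psh_res A (fst (psh A u)) (psh A u) (\<lambda>a. at (push A B G (psh A u)) (F a))"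
      unfolding hom_C[OF B C_map(1)[OF A B F u] C_map(1)[OF A B G u]] C_map(2)[OF A B F u] C_map(2)[OF A B G u] by simp
    then show "Id Q (tp (CC A) u) \<preceq> hom (CC B) (C_map Q C A B F u, C_map Q C A B G u)"
      using Id_le_psh_res_iff[OF u' PGF] le tp_C[OF A u] by simp
  qed
qed

lemma two_natural_J: "two_natural Q CC (C_map Q C) PP (P_map Q) (J Q C)"
  unfolding two_natural_def
proof (intro conjI allI impI, (elim conjE)?)
  show "qcat A \<Longrightarrow> J Q C A \<in> functors Q (CC A) (PP A)" for A by (rule J_functor)
  fix A B :: "('v, 'o, 'm) qcat" and F
  assume "qcat A \<and> qcat B \<and> F \<in> functors Q A B"
  then have A: "qcat A" and B: "qcat B" and F: "F \<in> functors Q A B" by blast+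
  have "P_map Q A B F u = C_map Q C A B F u" if "u \<in> objs (CC A)" for u
    using that by (simp add: C_map_def)
  then show "functor_iso Q (CC A) (PP B) (compose (objs (CC A)) (J Q C B) (C_map Q C A B F))
      (compose (objs (CC A)) (P_map Q A B F) (J Q C A))"
    using C_map(1)[OF A B F] C_objD(1)[OF B C_map(1)[OF A B F]]
    by (intro functor_iso_eqI[OF qcategory_P[OF B]]) (simp_all add: compose_def J_def)
qed

text \<open>The left side is the colimit of an identity weighted by a weight pushed along
  \<open>J\<close>. Undoing the push gives the colimit of \<open>J\<close> weighted by \<Theta>, and
  colimits of presheaves are strictly unique.\<close>

lemma P_mult_J:
  assumes A: "qcat A" and \<Theta>: "\<Theta> \<in> objs (CC (CC A))"
  shows "P_mult Q A (P_map Q (CC A) (PP A) (J Q C A) \<Theta>) = mult A \<Theta>"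
proof -
  note A' = qcategory_C[OF A] and PA = qcategory_P[OF A] and JA = J_functor[OF A]
  note \<Theta>' = C_objD[OF A' \<Theta>]
  let ?p = "push (CC A) (PP A) (J Q C A) (psh (CC A) \<Theta>)"
  note p = push_presheaves[OF PA JA \<Theta>'(3)]
  have J: "compose (objs (CC A)) (id_functor (PP A)) (J Q C A) = J Q C A"
    using C_objD(1)[OF A] by (auto simp: compose_def J_def restrict_def fun_eq_iff)
  have "is_colim Q (PP A) (PP A) ?p (id_functor (PP A)) (mult A \<Theta>)"
    unfolding is_colim_push_iff[OF A' PA PA JA id_functor[OF PA] \<Theta>'(3)] J is_colim_P_iff[OF A' A JA \<Theta>'(3)]
    using \<Theta> by (simp add: mult_def J_def cong: wsum_cong)
  then have "colim Q (PP A) (PP A) ?p (id_functor (PP A)) = mult A \<Theta>"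
    unfolding is_colim_P_iff[OF PA A id_functor[OF PA] p] colim_P_eq[OF PA A id_functor[OF PA] p] ..
  then show ?thesis
    using obj_P[OF p] by (simp add: P_map_apply[OF A' \<Theta>'(1)] P_mult_def psh_obj_inverse[OF PA p])
qed

lemma factorisation_mult: "factorisation Q CC (J Q C) mult (Yoneda Q)"
  unfolding factorisation_def
proof (intro allI impI conjI)
  fix A assume A: "qcat A"
  show "mult A \<in> functors Q (CC (CC A)) (CC A)" by (rule mult_functor[OF A])
  show "Yoneda Q A \<in> functors Q A (CC A)" by (rule Yoneda_C_functor[OF A])
  show "functor_iso Q (CC (CC A)) (PP A)
      (compose (objs (CC (CC A))) (P_mult Q A)
        (compose (objs (CC (CC A))) (P_map Q (CC A) (PP A) (J Q C A)) (J Q C (CC A))))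
      (compose (objs (CC (CC A))) (J Q C A) (mult A))"
    using P_mult_J[OF A] mult(1)[OF A] C_objD(1)[OF A mult(1)[OF A]]
    by (intro functor_iso_eqI[OF qcategory_P[OF A]]) (simp_all add: compose_def J_def)
  show "functor_iso Q A (PP A) (Yoneda Q A) (compose (objs A) (J Q C A) (Yoneda Q A))"
    using Yoneda_C(1)[OF A] C_objD(1)[OF A Yoneda_C(1)[OF A]]
    by (intro functor_iso_eqI[OF qcategory_P[OF A]]) (simp_all add: compose_def J_def)
qed

text \<open>Isomorphic functors into \<P>(A) agree on objects, and the inclusion \<open>J\<close>
  changes no object. Off the objects, extensionality of functors fixes the values.\<close>

lemma factorisation_unique:
  assumes fac: "factorisation Q CC (J Q C) \<mu> \<eta>" and A: "qcat A"
  shows "\<mu> A = mult A" "\<eta> A = Yoneda Q A"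
proof -
  note A' = qcategory_C[OF A] and PA = qcategory_P[OF A] and JA = J_functor[OF A]
  note A'' = qcategory_C[OF A']
  have \<mu>: "\<mu> A \<in> functors Q (CC (CC A)) (CC A)" and \<eta>: "\<eta> A \<in> functors Q A (CC A)"
    and iso: "functor_iso Q (CC (CC A)) (PP A)
      (compose (objs (CC (CC A))) (P_mult Q A)
        (compose (objs (CC (CC A))) (P_map Q (CC A) (PP A) (J Q C A)) (J Q C (CC A))))
      (compose (objs (CC (CC A))) (J Q C A) (\<mu> A))"
    and iso': "functor_iso Q A (PP A) (Yoneda Q A) (compose (objs A) (J Q C A) (\<eta> A))"
    using fac A unfolding factorisation_def by blast+
  have "compose (objs (CC (CC A))) (P_mult Q A)
        (compose (objs (CC (CC A))) (P_map Q (CC A) (PP A) (J Q C A)) (J Q C (CC A))) =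
      compose (objs (CC (CC A))) (J Q C A) (mult A)"
    using P_mult_J[OF A] mult(1)[OF A] by (auto simp: compose_def J_def restrict_def fun_eq_iff)
  with iso have iso: "functor_iso Q (CC (CC A)) (PP A) (compose (objs (CC (CC A))) (J Q C A) (mult A))
      (compose (objs (CC (CC A))) (J Q C A) (\<mu> A))" by simp
  have "mult A \<Theta> = \<mu> A \<Theta>" if "\<Theta> \<in> objs (CC (CC A))" for \<Theta>
    using functor_iso_P_eq[OF A compose_functor[OF A'' A' PA mult_functor[OF A] JA]
        compose_functor[OF A'' A' PA \<mu> JA] iso that] that mult(1)[OF A that] functor_dest(1)[OF \<mu> that]
    by (simp add: compose_def J_def)
  then show "\<mu> A = mult A"
    by (intro extensionalityI[OF functor_dest(4)[OF \<mu>] functor_dest(4)[OF mult_functor[OF A]]]) simp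
  have "Yoneda Q A a = \<eta> A a" if "a \<in> objs A" for a
    using functor_iso_P_eq[OF A Yoneda_functor[OF A] compose_functor[OF A A' PA \<eta> JA] iso' that]
      that functor_dest(1)[OF \<eta> that]
    by (simp add: compose_def J_def)
  then show "\<eta> A = Yoneda Q A"
    by (intro extensionalityI[OF functor_dest(4)[OF \<eta>] functor_dest(4)[OF Yoneda_functor[OF A]]]) simp
qed

subsection \<open>Monad laws\<close>

text \<open>Tested against \<open>r\<close>, both sides are the residual of \<Theta> against the
  family of all [u, rF].\<close>

lemma mult_natural:
  assumes A: "qcat A" and B: "qcat B" and F: "F \<in> functors Q A B" and \<Theta>: "\<Theta> \<in> objs (CC (CC A))"
  shows "mult B (C_map Q C (CC A) (CC B) (C_map Q C A B F) \<Theta>) = C_map Q C A B F (mult A \<Theta>)"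
proof (rule C_obj_eqI[OF B])
  note A' = qcategory_C[OF A] and B' = qcategory_C[OF B] and CF = C_map_functor[OF A B F]
  note T = C_map[OF A' B' CF \<Theta>]
  show "mult B (C_map Q C (CC A) (CC B) (C_map Q C A B F) \<Theta>) \<in> objs (CC B)" by (rule mult(1)[OF B T(1)])
  show "C_map Q C A B F (mult A \<Theta>) \<in> objs (CC B)" by (rule C_map(1)[OF A B F mult(1)[OF A \<Theta>]])
  show "fst (psh B (mult B (C_map Q C (CC A) (CC B) (C_map Q C A B F) \<Theta>))) = fst (psh B (C_map Q C A B F (mult A \<Theta>)))"
    by (simp add: mult(2)[OF B T(1)] T(2) C_map(2)[OF A B F mult(1)[OF A \<Theta>]] mult(2)[OF A \<Theta>])
  fix X r assume r: "is_psh B X r"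
  have "psh_res B X (psh B (mult B (C_map Q C (CC A) (CC B) (C_map Q C A B F) \<Theta>))) r =
      psh_res (CC A) X (psh (CC A) \<Theta>) (\<lambda>u. psh_res B X (psh B (C_map Q C A B F u)) r)"
    unfolding psh_res_mult[OF B T(1) r] by (rule psh_res_C_map[OF A' B' CF \<Theta> is_psh_C[OF B r]])
  also have "\<dots> = psh_res (CC A) X (psh (CC A) \<Theta>) (\<lambda>u. psh_res A X (psh A u) (\<lambda>a. r (F a)))"
    by (rule psh_res_cong) (rule psh_res_C_map[OF A B F _ r])
  also have "\<dots> = psh_res B X (psh B (C_map Q C A B F (mult A \<Theta>))) r"
    unfolding psh_res_C_map[OF A B F mult(1)[OF A \<Theta>] r]
    by (rule psh_res_mult[OF A \<Theta> is_psh_comp_functor[OF A B F r], symmetric])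
  finally show "psh_res B X (psh B (mult B (C_map Q C (CC A) (CC B) (C_map Q C A B F) \<Theta>))) r =
      psh_res B X (psh B (C_map Q C A B F (mult A \<Theta>))) r" .
qed

lemma Yoneda_natural:
  assumes A: "qcat A" and B: "qcat B" and F: "F \<in> functors Q A B" and a: "a \<in> objs A"
  shows "Yoneda Q B (F a) = C_map Q C A B F (Yoneda Q A a)"
proof (rule C_obj_eqI[OF B])
  note Fa = functor_dest(1,2)[OF F a] and Y = Yoneda_C[OF A a]
  show "Yoneda Q B (F a) \<in> objs (CC B)" by (rule Yoneda_C(1)[OF B Fa(1)])
  show "C_map Q C A B F (Yoneda Q A a) \<in> objs (CC B)" by (rule C_map(1)[OF A B F Y(1)])
  show "fst (psh B (Yoneda Q B (F a))) = fst (psh B (C_map Q C A B F (Yoneda Q A a)))"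
    by (simp add: Yoneda_C(2)[OF B Fa(1)] C_map(2)[OF A B F Y(1)] Y(2) representable_eq Fa(2))
  show "psh_res B X (psh B (Yoneda Q B (F a))) r = psh_res B X (psh B (C_map Q C A B F (Yoneda Q A a))) r"
    if r: "is_psh B X r" for X r
    unfolding psh_res_C_map[OF A B F Y(1) r] Y(2) Yoneda_C(2)[OF B Fa(1)]
      psh_res_representable[OF A a is_psh_comp_functor[OF A B F r]]
    by (rule psh_res_representable[OF B Fa(1) r])
qed

text \<open>Both sides have the threefold nested residual [\<Xi>, [\<Theta>, [u, r]]] as their value
  at \<open>r\<close>.\<close>

lemma mult_assoc:
  assumes A: "qcat A" and \<Xi>: "\<Xi> \<in> objs (CC (CC (CC A)))"
  shows "mult A (C_map Q C (CC (CC A)) (CC A) (mult A) \<Xi>) = mult A (mult (CC A) \<Xi>)"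
proof (rule C_obj_eqI[OF A])
  note A' = qcategory_C[OF A]
  note A'' = qcategory_C[OF A'] and mA = mult_functor[OF A]
  note T = C_map[OF A'' A' mA \<Xi>] and M = mult[OF A' \<Xi>]
  show "mult A (C_map Q C (CC (CC A)) (CC A) (mult A) \<Xi>) \<in> objs (CC A)" by (rule mult(1)[OF A T(1)])
  show "mult A (mult (CC A) \<Xi>) \<in> objs (CC A)" by (rule mult(1)[OF A M(1)])
  show "fst (psh A (mult A (C_map Q C (CC (CC A)) (CC A) (mult A) \<Xi>))) = fst (psh A (mult A (mult (CC A) \<Xi>)))"
    by (simp add: mult(2)[OF A T(1)] T(2) mult(2)[OF A M(1)] M(2))
  fix X r assume r: "is_psh A X r"
  have "psh_res A X (psh A (mult A (C_map Q C (CC (CC A)) (CC A) (mult A) \<Xi>))) r =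
      psh_res (CC (CC A)) X (psh (CC (CC A)) \<Xi>) (\<lambda>\<Theta>. psh_res A X (psh A (mult A \<Theta>)) r)"
    unfolding psh_res_mult[OF A T(1) r] by (rule psh_res_C_map[OF A'' A' mA \<Xi> is_psh_C[OF A r]])
  also have "\<dots> = psh_res (CC (CC A)) X (psh (CC (CC A)) \<Xi>)
      (\<lambda>\<Theta>. psh_res (CC A) X (psh (CC A) \<Theta>) (\<lambda>u. psh_res A X (psh A u) r))"
    by (rule psh_res_cong) (rule psh_res_mult[OF A _ r])
  also have "\<dots> = psh_res A X (psh A (mult A (mult (CC A) \<Xi>))) r"
    unfolding psh_res_mult[OF A M(1) r] by (rule psh_res_mult[OF A' \<Xi> is_psh_C[OF A r], symmetric])
  finally show "psh_res A X (psh A (mult A (C_map Q C (CC (CC A)) (CC A) (mult A) \<Xi>))) r =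
      psh_res A X (psh A (mult A (mult (CC A) \<Xi>))) r" .
qed

text \<open>Here the Yoneda rule is applied inside the residual of \<open>u\<close>; in the other
  unit law, \<open>mult_Yoneda\<close>, it is applied outside.\<close>

lemma mult_C_map_Yoneda:
  assumes A: "qcat A" and u: "u \<in> objs (CC A)"
  shows "mult A (C_map Q C A (CC A) (Yoneda Q A) u) = u"
proof (rule C_obj_eqI[OF A _ u])
  note A' = qcategory_C[OF A] and Y = Yoneda_C_functor[OF A]
  note T = C_map[OF A A' Y u]
  show "mult A (C_map Q C A (CC A) (Yoneda Q A) u) \<in> objs (CC A)" by (rule mult(1)[OF A T(1)])
  show "fst (psh A (mult A (C_map Q C A (CC A) (Yoneda Q A) u))) = fst (psh A u)"
    by (simp add: mult(2)[OF A T(1)] T(2))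
  show "psh_res A X (psh A (mult A (C_map Q C A (CC A) (Yoneda Q A) u))) r = psh_res A X (psh A u) r"
    if r: "is_psh A X r" for X r
    unfolding psh_res_mult[OF A T(1) r] psh_res_C_map[OF A A' Y u is_psh_C[OF A r]]
    by (rule psh_res_cong) (simp add: Yoneda_C(2)[OF A] psh_res_representable[OF A _ r])
qed

lemma mult_Yoneda:
  assumes A: "qcat A" and u: "u \<in> objs (CC A)"
  shows "mult A (Yoneda Q (CC A) u) = u"
proof (rule C_obj_eqI[OF A _ u])
  note A' = qcategory_C[OF A]
  note Y = Yoneda_C[OF A' u]
  show "mult A (Yoneda Q (CC A) u) \<in> objs (CC A)" by (rule mult(1)[OF A Y(1)])
  show "fst (psh A (mult A (Yoneda Q (CC A) u))) = fst (psh A u)"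
    by (simp add: mult(2)[OF A Y(1)] Y(2) representable_eq tp_C[OF A u])
  show "psh_res A X (psh A (mult A (Yoneda Q (CC A) u))) r = psh_res A X (psh A u) r"
    if r: "is_psh A X r" for X r
    unfolding psh_res_mult[OF A Y(1) r] Y(2) by (rule psh_res_representable[OF A' u is_psh_C[OF A r]])
qed

text \<open>Pushing along Y and then using the Yoneda rule, the hom-arrow in question becomes
  [u, C(A)(Y-, u)] = [u, u], which lies above the identity.\<close>

lemma C_map_Yoneda_le:
  assumes A: "qcat A"
  shows "functor_le Q (CC A) (CC (CC A)) (C_map Q C A (CC A) (Yoneda Q A)) (Yoneda Q (CC A))"
proof -
  note A' = qcategory_C[OF A] and Y = Yoneda_C_functor[OF A]
  show ?thesis
    unfolding functor_le_iff[OF qcategory_C[OF A'] C_map_functor[OF A A' Y] Yoneda_C_functor[OF A']]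
  proof
    fix u assume u: "u \<in> objs (CC A)"
    note T = C_map[OF A A' Y u] and YY = Yoneda_C[OF A' u] and u' = C_objD(3)[OF A u]
    note r = is_psh_representable[OF A' u]
    have "hom (CC (CC A)) (C_map Q C A (CC A) (Yoneda Q A) u, Yoneda Q (CC A) u) =
        psh_res (CC A) (tp (CC A) u) (push A (CC A) (Yoneda Q A) (psh A u)) (\<lambda>v. hom (CC A) (v, u))"
      unfolding hom_C[OF A' T(1) YY(1)] T(2) YY(2) representable_eq fst_mk_psh
      by (rule psh_res_cong) simp
    also have "\<dots> = psh_res A (tp (CC A) u) (psh A u) (\<lambda>a. hom (CC A) (Yoneda Q A a, u))"
      by (rule psh_res_push[OF A' Y u' r])
    also have "\<dots> = psh_res A (fst (psh A u)) (psh A u) (at (psh A u))"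
      unfolding tp_C[OF A u] by (rule psh_res_cong) (rule hom_Yoneda[OF A _ u])
    finally show "Id Q (tp (CC A) u) \<preceq> hom (CC (CC A)) (C_map Q C A (CC A) (Yoneda Q A) u, Yoneda Q (CC A) u)"
      using Id_le_psh_res_iff[OF u', of "at (psh A u)"] psh_Hom[OF u'] leq_refl tp_C[OF A u] by auto
  qed
qed

text \<open>A factorisation constrains \<open>\<mu>\<close> and \<open>\<eta>\<close> on actual
  categories only, hence equations under \<open>qcat\<close> instead of equalities of
  transformations.\<close>

lemma KZ_doctrine_C:
  assumes \<mu>: "\<And>A. qcat A \<Longrightarrow> \<mu> A = mult A" and \<eta>: "\<And>A. qcat A \<Longrightarrow> \<eta> A = Yoneda Q A"
  shows "KZ_doctrine Q CC (C_map Q C) \<mu> \<eta>"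
  unfolding KZ_doctrine_def two_monad_def
proof (intro conjI allI impI)
  show "two_functor Q CC (C_map Q C)" by (rule two_functor_C)
  show "two_natural Q (\<lambda>A. CC (CC A)) (\<lambda>A B F. C_map Q C (CC A) (CC B) (C_map Q C A B F)) CC (C_map Q C) \<mu>"
    unfolding two_natural_def
  proof (intro conjI allI impI)
    show "\<mu> A \<in> functors Q (CC (CC A)) (CC A)" if "qcat A" for A
      unfolding \<mu>[OF that] by (rule mult_functor[OF that])
    fix A B :: "('v, 'o, 'm) qcat" and F
    assume "qcat A \<and> qcat B \<and> F \<in> functors Q A B"
    then have A: "qcat A" and B: "qcat B" and F: "F \<in> functors Q A B" by blast+
    show "functor_iso Q (CC (CC A)) (CC B)
        (compose (objs (CC (CC A))) (\<mu> B) (C_map Q C (CC A) (CC B) (C_map Q C A B F)))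
        (compose (objs (CC (CC A))) (C_map Q C A B F) (\<mu> A))"
      unfolding \<mu>[OF A] \<mu>[OF B]
      using mult_natural[OF A B F] C_map(1)[OF A B F mult(1)[OF A]]
      by (intro functor_iso_eqI[OF qcategory_C[OF B]]) (simp_all add: compose_def)
  qed
  show "two_natural Q (\<lambda>A. A) (\<lambda>A B F. F) CC (C_map Q C) \<eta>"
    unfolding two_natural_def
  proof (intro conjI allI impI)
    show "\<eta> A \<in> functors Q A (CC A)" if "qcat A" for A
      unfolding \<eta>[OF that] by (rule Yoneda_C_functor[OF that])
    fix A B :: "('v, 'o, 'm) qcat" and F
    assume "qcat A \<and> qcat B \<and> F \<in> functors Q A B"
    then have A: "qcat A" and B: "qcat B" and F: "F \<in> functors Q A B" by blast+
    show "functor_iso Q A (CC B) (compose (objs A) (\<eta> B) F) (compose (objs A) (C_map Q C A B F) (\<eta> A))"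
      unfolding \<eta>[OF A] \<eta>[OF B]
      using Yoneda_natural[OF A B F] C_map(1)[OF A B F Yoneda_C(1)[OF A]]
      by (intro functor_iso_eqI[OF qcategory_C[OF B]]) (simp_all add: compose_def)
  qed
  fix A :: "('v, 'o, 'm) qcat" assume A: "qcat A"
  note A' = qcategory_C[OF A]
  show "functor_iso Q (CC (CC (CC A))) (CC A)
      (compose (objs (CC (CC (CC A)))) (\<mu> A) (C_map Q C (CC (CC A)) (CC A) (\<mu> A)))
      (compose (objs (CC (CC (CC A)))) (\<mu> A) (\<mu> (CC A)))"
    unfolding \<mu>[OF A] \<mu>[OF A']
    using mult_assoc[OF A] mult(1)[OF A mult(1)[OF A']]
    by (intro functor_iso_eqI[OF A']) (simp_all add: compose_def)
  show "functor_iso Q (CC A) (CC A) (compose (objs (CC A)) (\<mu> A) (C_map Q C A (CC A) (\<eta> A))) (id_functor (CC A))"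
    unfolding \<mu>[OF A] \<eta>[OF A] using mult_C_map_Yoneda[OF A]
    by (intro functor_iso_eqI[OF A']) (simp_all add: compose_def)
  show "functor_iso Q (CC A) (CC A) (compose (objs (CC A)) (\<mu> A) (\<eta> (CC A))) (id_functor (CC A))"
    unfolding \<mu>[OF A] \<eta>[OF A'] using mult_Yoneda[OF A]
    by (intro functor_iso_eqI[OF A']) (simp_all add: compose_def)
  show "functor_le Q (CC A) (CC (CC A)) (C_map Q C A (CC A) (\<eta> A)) (\<eta> (CC A))"
    unfolding \<eta>[OF A] \<eta>[OF A'] by (rule C_map_Yoneda_le[OF A])
qed

subsection \<open>Algebras\<close>

lemma is_colim_id_iff:
  assumes B: "qcat B" and p: "p \<in> presheaves Q B"
  shows "is_colim Q B B p (id_functor B) c \<longleftrightarrow> c \<in> objs B \<and> tp B c = fst p \<and>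
    (\<forall>d\<in>objs B. hom B (c, d) = psh_res B (tp B d) p (\<lambda>b. hom B (b, d)))"
proof -
  have "psh_res B X p (\<lambda>b. hom B (id_functor B b, d)) = psh_res B X p (\<lambda>b. hom B (b, d))" for X d
    by (rule psh_res_cong) simp
  then show ?thesis unfolding is_colim_iff[OF B B id_functor[OF B] p] by simp
qed

lemma algebra_imp_is_colim:
  assumes B: "qcat B" and alg: "algebra Q CC (C_map Q C) \<mu> \<eta> B L" and \<eta>: "\<eta> B = Yoneda Q B"
    and u: "u \<in> objs (CC B)"
  shows "is_colim Q B B (psh B u) (id_functor B) (L u)"
proof -
  note B' = qcategory_C[OF B] and Y = Yoneda_C_functor[OF B] and u' = C_objD(3)[OF B u]
  have L: "L \<in> functors Q (CC B) B"
    and iso: "functor_iso Q B B (compose (objs B) L (Yoneda Q B)) (id_functor B)"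
    using alg unfolding algebra_def \<eta> by blast+
  note L' = functor_dest[OF L]
  have LY: "hom B (d, L (Yoneda Q B b)) = hom B (d, b)" if "b \<in> objs B" "d \<in> objs B" for b d
    using iso that unfolding functor_iso_lower_iff[OF B compose_functor[OF B B' B Y L] id_functor[OF B]]
    by (simp add: compose_def)
  show ?thesis
    unfolding is_colim_id_iff[OF B u']
  proof (intro conjI ballI)
    show "L u \<in> objs B" by (rule L'(1)[OF u])
    show tLu: "tp B (L u) = fst (psh B u)" using L'(2)[OF u] tp_C[OF B u] by simp
    fix b assume b: "b \<in> objs B"
    let ?R = "psh_res B (tp B b) (psh B u) (\<lambda>b'. hom B (b', b))"
    note Yb = Yoneda_C[OF B b] and r = is_psh_representable[OF B b]
    have R: "?R \<in> Hom Q (tp B b) (fst (psh B u))" by (rule psh_res_Hom[OF u' qcat_Ob[OF B b]])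
    have H: "hom B (L u, b) \<in> Hom Q (tp B b) (fst (psh B u))"
      using qcat_Hom[OF B L'(1)[OF u] b] tLu by simp
    \<comment> \<open>The residual is a hom-arrow into the representable of \<open>b\<close>. The
      functor \<open>L\<close> carries it to a hom-arrow into L(Yb), which is isomorphic to
      \<open>b\<close>.\<close>
    have "?R = hom (CC B) (u, Yoneda Q B b)"
      unfolding hom_C[OF B u Yb(1)] Yb(2) representable_eq fst_mk_psh by (rule psh_res_cong) simp
    then have "?R \<preceq> hom B (L u, b)"
      using L'(3)[OF u Yb(1)] LY[OF b L'(1)[OF u]] by simp
    moreover have "at (psh B u) b' \<cdot> hom B (L u, b) \<preceq> hom B (b', b)" if b': "b' \<in> objs B" for b'
    proof -
      note ub' = psh_Hom[OF u' b']
      have H': "hom B (b', L u) \<in> Hom Q (fst (psh B u)) (tp B b')"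
        using qcat_Hom[OF B b' L'(1)[OF u]] tLu by simp
      \<comment> \<open>The unit law read on arrows out of L(Yb'), where \<open>LY\<close> reads it
        on arrows into L(Yb).\<close>
      have "hom B (L (Yoneda Q B b'), L u) = hom B (b', L u)"
        using iso b' L'(1)[OF u] unfolding functor_iso_iff[OF B compose_functor[OF B B' B Y L] id_functor[OF B]]
        by (simp add: compose_def)
      then have "at (psh B u) b' \<preceq> hom B (b', L u)"
        using L'(3)[OF Yoneda_C(1)[OF B b'] u] hom_Yoneda[OF B b' u] by simp
      then have "at (psh B u) b' \<cdot> hom B (L u, b) \<preceq> hom B (b', L u) \<cdot> hom B (L u, b)"
        by (rule comp_mono_left[OF _ ub' H' H])
      then show ?thesis
        by (rule leq_trans[OF _ qcat_comp[OF B b' L'(1)[OF u] b] comp_Hom[OF H ub'] comp_Hom[OF H H'] qcat_Hom[OF B b' b]])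
    qed
    then have "hom B (L u, b) \<preceq> ?R"
      using le_psh_res_iff[OF u' is_pshD(2)[OF r] H] by blast
    ultimately show "hom B (L u, b) = ?R" using leq_antisym[OF _ _ H R] by blast
  qed
qed

text \<open>For associativity, the arrows into \<open>d\<close> out of either side are the residual
  of \<Theta> against B(L-, d): for \<open>mult\<close> by the nested residual, for the image of
  \<open>L\<close> by precomposition.\<close>

lemma is_colim_imp_algebra:
  assumes B: "qcat B" and L: "L \<in> functors Q (CC B) B"
    and colim: "\<And>u. u \<in> objs (CC B) \<Longrightarrow> is_colim Q B B (psh B u) (id_functor B) (L u)"
    and \<mu>: "\<mu> B = mult B" and \<eta>: "\<eta> B = Yoneda Q B"
  shows "algebra Q CC (C_map Q C) \<mu> \<eta> B L"
proof -
  note B' = qcategory_C[OF B] and Y = Yoneda_C_functor[OF B]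
  note B'' = qcategory_C[OF B']
  have hom_L: "hom B (L u, d) = psh_res B (tp B d) (psh B u) (\<lambda>b. hom B (b, d))"
    if "u \<in> objs (CC B)" "d \<in> objs B" for u d
    using colim[OF that(1)] that(2) unfolding is_colim_id_iff[OF B C_objD(3)[OF B that(1)]] by blast
  show ?thesis
    unfolding algebra_def \<mu> \<eta>
  proof (intro conjI)
    show "functor_iso Q B B (compose (objs B) L (Yoneda Q B)) (id_functor B)"
      unfolding functor_iso_iff[OF B compose_functor[OF B B' B Y L] id_functor[OF B]]
      using psh_res_representable[OF B _ is_psh_representable[OF B]]
      by (simp add: compose_def hom_L[OF Yoneda_C(1)[OF B]] Yoneda_C(2)[OF B])
    have "hom B (L (mult B \<Theta>), d) = hom B (L (C_map Q C (CC B) B L \<Theta>), d)"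
      if \<Theta>: "\<Theta> \<in> objs (CC (CC B))" and d: "d \<in> objs B" for \<Theta> d
    proof -
      note r = is_psh_representable[OF B d]
      have "hom B (L (mult B \<Theta>), d) =
          psh_res (CC B) (tp B d) (psh (CC B) \<Theta>) (\<lambda>u. psh_res B (tp B d) (psh B u) (\<lambda>b. hom B (b, d)))"
        unfolding hom_L[OF mult(1)[OF B \<Theta>] d] by (rule psh_res_mult[OF B \<Theta> r])
      also have "\<dots> = psh_res (CC B) (tp B d) (psh (CC B) \<Theta>) (\<lambda>u. hom B (L u, d))"
        by (rule psh_res_cong) (rule hom_L[OF _ d, symmetric])
      also have "\<dots> = hom B (L (C_map Q C (CC B) B L \<Theta>), d)"
        unfolding hom_L[OF C_map(1)[OF B' B L \<Theta>] d] by (rule psh_res_C_map[OF B' B L \<Theta> r, symmetric])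
      finally show ?thesis .
    qed
    then show "functor_iso Q (CC (CC B)) B (compose (objs (CC (CC B))) L (mult B))
        (compose (objs (CC (CC B))) L (C_map Q C (CC B) B L))"
      unfolding functor_iso_iff[OF B compose_functor[OF B'' B' B mult_functor[OF B] L]
          compose_functor[OF B'' B' B C_map_functor[OF B' B L] L]]
      by (simp add: compose_def)
  qed (rule L)
qed

text \<open>The pushed weight stays in the class, so \<open>L\<close> can be applied to it; this
  gives colimits for arbitrary shapes \<open>A\<close>.\<close>

lemma is_colim_via_push:
  assumes A: "qcat A" and B: "qcat B" and p: "p \<in> C A" and F: "F \<in> functors Q A B"
    and colim: "\<And>u. u \<in> objs (CC B) \<Longrightarrow> is_colim Q B B (psh B u) (id_functor B) (L u)"
  shows "is_colim Q A B p F (L (obj B (push A B F p)))"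
proof -
  note q = push_class[OF A B F p] and p' = class_presheaves[OF A p]
  show ?thesis
    using colim[OF obj_C[OF q]]
    unfolding psh_obj_inverse[OF B class_presheaves[OF B q]] is_colim_push_iff[OF A B B F id_functor[OF B] p']
      compose_id_functor(1)[OF F] .
qed

lemma cocomplete_iff_algebra:
  assumes B: "qcat B" and \<mu>: "\<mu> B = mult B" and \<eta>: "\<eta> B = Yoneda Q B"
  shows "cocomplete Q C B \<longleftrightarrow> (\<exists>L. algebra Q CC (C_map Q C) \<mu> \<eta> B L)"
proof
  assume "\<exists>L. algebra Q CC (C_map Q C) \<mu> \<eta> B L"
  then obtain L where "algebra Q CC (C_map Q C) \<mu> \<eta> B L" ..
  from is_colim_via_push[OF _ B _ _ algebra_imp_is_colim[OF B this \<eta>]]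
  show "cocomplete Q C B" unfolding cocomplete_def by blast
next
  assume cc: "cocomplete Q C B"
  define L where "L = (\<lambda>u\<in>objs (CC B). SOME c. is_colim Q B B (psh B u) (id_functor B) c)"
  have colim: "is_colim Q B B (psh B u) (id_functor B) (L u)" if u: "u \<in> objs (CC B)" for u
  proof -
    have "\<exists>c. is_colim Q B B (psh B u) (id_functor B) c"
      using cc B C_objD(2)[OF B u] id_functor[OF B] unfolding cocomplete_def by blast
    from someI_ex[OF this] show ?thesis using u by (simp add: L_def)
  qed
  have L: "L u \<in> objs B" "tp B (L u) = fst (psh B u)"
    "d \<in> objs B \<Longrightarrow> hom B (L u, d) = psh_res B (tp B d) (psh B u) (\<lambda>b. hom B (b, d))"
    if "u \<in> objs (CC B)" for u d
    using colim[OF that] unfolding is_colim_id_iff[OF B C_objD(3)[OF B that]] by blast+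
  \<comment> \<open>The chosen colimits must be shown functorial. From 1 \<le> B(Lv, Lv) =
    [v, B(-, Lv)] follows v(b) \<le> B(b, Lv), and monotonicity of the residual gives [u, v] \<le>
    [u, B(-, Lv)] = B(Lu, Lv).\<close>
  have "hom (CC B) (u, v) \<preceq> hom B (L u, L v)" if u: "u \<in> objs (CC B)" and v: "v \<in> objs (CC B)" for u v
  proof -
    note u' = C_objD(3)[OF B u] and v' = C_objD(3)[OF B v] and Lv = L(1,2)[OF v]
    have H: "hom B (b, L v) \<in> Hom Q (fst (psh B v)) (tp B b)" if "b \<in> objs B" for b
      using qcat_Hom[OF B that Lv(1)] Lv(2) by simp
    have "Id Q (fst (psh B v)) \<preceq> psh_res B (fst (psh B v)) (psh B v) (\<lambda>b. hom B (b, L v))"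
      using qcat_Id[OF B Lv(1)] L(3)[OF v Lv(1)] Lv(2) by simp
    then have "at (psh B v) b \<preceq> hom B (b, L v)" if "b \<in> objs B" for b
      using Id_le_psh_res_iff[OF v' H] that by blast
    then show ?thesis
      unfolding hom_C[OF B u v] L(3)[OF u Lv(1)] Lv(2)
      by (intro psh_res_mono[OF u' psh_Ob[OF v'] psh_Hom[OF v'] H])
  qed
  then have "L \<in> functors Q (CC B) B"
    using L(1,2) tp_C[OF B] unfolding functors_def by (auto simp: PiE_iff) (simp add: L_def)
  then show "\<exists>L. algebra Q CC (C_map Q C) \<mu> \<eta> B L"
    using is_colim_imp_algebra[where \<mu> = \<mu> and \<eta> = \<eta>, OF B _ colim \<mu> \<eta>] by blast
qed

text \<open>Applied to the pushed weight, \<open>L'\<close> computes the colimit of \<open>G\<close>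
  weighted by \<open>u\<close>. The homomorphism law therefore says that \<open>G (L u)\<close> has
  the arrows out of it that this colimit must have.\<close>

lemma algebra_hom_iff:
  assumes B: "qcat B" and B': "qcat B'" and G: "G \<in> functors Q B B'"
    and L: "L \<in> functors Q (CC B) B" and L': "L' \<in> functors Q (CC B') B'"
    and colim': "\<And>u. u \<in> objs (CC B') \<Longrightarrow> is_colim Q B' B' (psh B' u) (id_functor B') (L' u)"
  shows "algebra_hom Q CC (C_map Q C) B L B' L' G \<longleftrightarrow> (\<forall>u\<in>objs (CC B). is_colim Q B B' (psh B u) G (G (L u)))"
proof -
  note CB = qcategory_C[OF B] and CB' = qcategory_C[OF B'] and CG = C_map_functor[OF B B' G]
  have "hom B' (L' (C_map Q C B B' G u), d) = psh_res B (tp B' d) (psh B u) (\<lambda>b. hom B' (G b, d))"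
    if u: "u \<in> objs (CC B)" and d: "d \<in> objs B'" for u d
  proof -
    note T = C_map(1)[OF B B' G u]
    have "hom B' (L' (C_map Q C B B' G u), d) =
        psh_res B' (tp B' d) (psh B' (C_map Q C B B' G u)) (\<lambda>b. hom B' (b, d))"
      using colim'[OF T] d unfolding is_colim_id_iff[OF B' C_objD(3)[OF B' T]] by blast
    then show ?thesis using psh_res_C_map[OF B B' G u is_psh_representable[OF B' d]] by simp
  qed
  moreover have "G (L u) \<in> objs B'" "tp B' (G (L u)) = fst (psh B u)" if "u \<in> objs (CC B)" for u
    using functor_dest(1,2)[OF L that] functor_dest(1,2)[OF G] tp_C[OF B that] by simp_all
  ultimately show ?thesis
    unfolding algebra_hom_def functor_iso_iff[OF B' compose_functor[OF CB B B' L G] compose_functor[OF CB CB' B' CG L']]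
    using G by (simp add: compose_def is_colim_iff[OF B B' G C_objD(3)[OF B]])
qed

text \<open>Preservation needs testing only on the identity diagram and on the colimits given by
  \<open>L\<close>, since all others come from these by pushing weights and by isomorphism.\<close>

lemma cocontinuous_iff:
  assumes B: "qcat B" and B': "qcat B'" and G: "G \<in> functors Q B B'" and L: "L \<in> functors Q (CC B) B"
    and colim: "\<And>u. u \<in> objs (CC B) \<Longrightarrow> is_colim Q B B (psh B u) (id_functor B) (L u)"
  shows "cocontinuous Q C B B' G \<longleftrightarrow> (\<forall>u\<in>objs (CC B). is_colim Q B B' (psh B u) G (G (L u)))"
proof
  assume cc: "cocontinuous Q C B B' G"
  show "\<forall>u\<in>objs (CC B). is_colim Q B B' (psh B u) G (G (L u))"
  proof
    fix u assume u: "u \<in> objs (CC B)"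
    have "preserves_colim Q B B B' (psh B u) (id_functor B) G"
      using cc B C_objD(2)[OF B u] id_functor[OF B] unfolding cocontinuous_def by blast
    then show "is_colim Q B B' (psh B u) G (G (L u))"
      using colim[OF u] compose_id_functor(2)[OF G] unfolding preserves_colim_def by auto
  qed
next
  assume pres: "\<forall>u\<in>objs (CC B). is_colim Q B B' (psh B u) G (G (L u))"
  show "cocontinuous Q C B B' G"
    unfolding cocontinuous_def preserves_colim_def
  proof (intro allI impI)
    fix A p F c assume asm: "qcat A \<and> p \<in> C A \<and> F \<in> functors Q A B" and c: "is_colim Q A B p F c"
    then have A: "qcat A" and p: "p \<in> C A" and F: "F \<in> functors Q A B" by blast+
    note p' = class_presheaves[OF A p] and q = push_class[OF A B F p]
    note GF = compose_functor[OF A B B' F G] and u = obj_C[OF q]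
    \<comment> \<open>The colimit supplied by \<open>L\<close>, whose image under \<open>G\<close>
      is controlled by \<open>pres\<close>. The given \<open>c\<close> is isomorphic to it but may
      be a different object.\<close>
    let ?e = "L (obj B (push A B F p))"
    have e: "is_colim Q A B p F ?e" by (rule is_colim_via_push[OF A B p F colim])
    note c' = c[unfolded is_colim_iff[OF A B F p']] and e' = e[unfolded is_colim_iff[OF A B F p']]
    have Ge: "is_colim Q A B' p (compose (objs A) G F) (G ?e)"
      using pres[rule_format, OF u]
      unfolding psh_obj_inverse[OF B class_presheaves[OF B q]] is_colim_push_iff[OF A B B' F G p'] .
    show "is_colim Q A B' p (compose (objs A) G F) (G c)"
    proof (rule is_colim_iso[OF A B' GF p' Ge])
      show "G c \<in> objs B'" "tp B' (G c) = tp B' (G ?e)"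
        using functor_dest(1,2)[OF G] c' e' by simp_all
      show "hom B' (G c, d) = hom B' (G ?e, d)" if "d \<in> objs B'" for d
        using c' e' by (intro functor_preserves_iso[OF B B' G _ _ _ _ that]) simp_all
    qed
  qed
qed

end

theorem proposition4p4:
  fixes Q :: "('o, 'm) quantaloid_data"
    and C :: "('v::set_universe, 'o, 'm) psh_class"
  assumes "quantaloid Q"
    and "small TYPE('v) (Ob Q)" and "small TYPE('v) (Arr Q)"
    and "presheaf_class Q C" and "saturated Q C"
  shows "full_sub_KZ_doctrine Q (C_obj Q C) (C_map Q C) (J Q C) \<and>
    (\<forall>\<mu> \<eta>. factorisation Q (C_obj Q C) (J Q C) \<mu> \<eta> \<longrightarrow>
      KZ_doctrine Q (C_obj Q C) (C_map Q C) \<mu> \<eta> \<and>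
      (\<forall>B. qcategory Q B \<longrightarrow>
        (cocomplete Q C B \<longleftrightarrow> (\<exists>L. algebra Q (C_obj Q C) (C_map Q C) \<mu> \<eta> B L))) \<and>
      (\<forall>B B' L L' G.
        qcategory Q B \<and> qcategory Q B' \<and> cocomplete Q C B \<and> cocomplete Q C B' \<and>
        algebra Q (C_obj Q C) (C_map Q C) \<mu> \<eta> B L \<and>
        algebra Q (C_obj Q C) (C_map Q C) \<mu> \<eta> B' L' \<and>
        G \<in> functors Q B B' \<longrightarrow>
        (cocontinuous Q C B B' G \<longleftrightarrow>
          algebra_hom Q (C_obj Q C) (C_map Q C) B L B' L' G)))"
proof -
  interpret saturated_class Q "TYPE('v)" C
    by (intro saturated_class.intro small_quantaloid.intro small_quantaloid_axioms.intro
        saturated_class_axioms.intro assms)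
  show ?thesis
  proof (intro conjI allI impI)
    have "fully_faithful (CC A) (PP A) (J Q C A)" for A
      by (simp add: fully_faithful_def J_def hom_C_P)
    then show "full_sub_KZ_doctrine Q CC (C_map Q C) (J Q C)"
      unfolding full_sub_KZ_doctrine_def
      using two_functor_C two_natural_J factorisation_mult by blast
    fix \<mu> \<eta> assume "factorisation Q CC (J Q C) \<mu> \<eta>"
    note unique = factorisation_unique[OF this]
    show "KZ_doctrine Q CC (C_map Q C) \<mu> \<eta>" by (rule KZ_doctrine_C) (rule unique, assumption)+
    show "cocomplete Q C B \<longleftrightarrow> (\<exists>L. algebra Q CC (C_map Q C) \<mu> \<eta> B L)" if "qcat B" for B
      by (rule cocomplete_iff_algebra[of B \<mu> \<eta>, OF that unique[OF that]])
    fix B B' L L' G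
    assume "qcat B \<and> qcat B' \<and> cocomplete Q C B \<and> cocomplete Q C B' \<and>
      algebra Q CC (C_map Q C) \<mu> \<eta> B L \<and> algebra Q CC (C_map Q C) \<mu> \<eta> B' L' \<and> G \<in> functors Q B B'"
    then have B: "qcat B" and B': "qcat B'" and alg: "algebra Q CC (C_map Q C) \<mu> \<eta> B L"
      and alg': "algebra Q CC (C_map Q C) \<mu> \<eta> B' L'" and G: "G \<in> functors Q B B'" by blast+
    have L: "L \<in> functors Q (CC B) B" and L': "L' \<in> functors Q (CC B') B'"
      using alg alg' unfolding algebra_def by blast+
    show "cocontinuous Q C B B' G \<longleftrightarrow> algebra_hom Q CC (C_map Q C) B L B' L' G"
      using cocontinuous_iff[OF B B' G L algebra_imp_is_colim[OF B alg unique(2)[OF B]]]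
        algebra_hom_iff[OF B B' G L L' algebra_imp_is_colim[OF B' alg' unique(2)[OF B']]]
      by blast
  qed
qed

end
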